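(* For every class $\mathcal{C}$ of instances the following are equivalent: (1) $\mathcal{C}$ admits both a left query algorithm over $\mathbb{B}$ and a right query algorithm over $\mathbb{B}$; (2) $\mathcal{C}$ admits a left query algorithm over $\mathbb{N}$ and a right query algorithm over $\mathbb{B}$; (3) $\mathcal{C}$ is definable by a Boolean combination of Berge-acyclic Boolean conjunctive queries; (4) $\mathcal{C}$ is definable by a Boolean combination of FO-definable CSPs (i.e., classes $\mathrm{CSP}(D)$ that are FO-definable).
   Context: A schema is a finite set of relation symbols, each with a positive arity. An instance $A$ over a schema $\sigma$ assigns to each $R\in\sigma$ of arity $r$ a finite $r$-ary relation $R^A$; $\mathrm{adom}(A)$ is the set of elements occurring in its facts. A homomorphism $h:A\to B$ is a map $h:\mathrm{adom}(A)\to\mathrm{adom}(B)$ preserving every relation; we write $A\to B$ if one exists. $\mathrm{CSP}(B)=\{A: A\to B\}$. A class of instances is a collection of instances over a fixed schema closed under isomorphism. $\hom_{\mathbb{N}}(A,B)$ is the number of homomorphisms $A\to B$; $\hom_{\mathbb{B}}(A,B)=1$ if $A\to B$ and $0$ otherwise. For $\mathcal{F}=\{F_1,\dots,F_k\}$, $\hom_K(\mathcal{F},A)=(\hom_K(F_i,A))_{i\le k}$ and $\hom_K(A,\mathcal{F})=(\hom_K(A,F_i))_{i\le k}$. A left $k$-query algorithm over $K\in\{\mathbb{B},\mathbb{N}\}$ for $\mathcal{C}$ is a pair $(\mathcal{F},X)$ with $|\mathcal{F}|=k$ and $X$ a set of $k$-tuples over $K$ such that for every instance $D$: $D\in\mathcal{C}$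 iff $\hom_K(\mathcal{F},D)\in X$; a right one uses $\hom_K(D,\mathcal{F})$; $\mathcal{C}$ admits one if one exists for some $k>0$. FO-definable means equal to the class of instances satisfying a first-order sentence under active-domain semantics. A Boolean conjunctive query is a sentence $\exists x_1\dots x_n(\alpha_1\wedge\dots\wedge\alpha_m)$ of relational atoms over these variables, each variable occurring; its canonical instance has the variables as elements and the atoms as facts. The incidence multigraph of an instance is the bipartite multigraph between $\mathrm{adom}(A)$ and the set of facts $(R,t)$, with one edge per occurrence of an element in a fact; a cycle in $A$ is a closed path in this multigraph of positive length not traversing an edge twice in succession in opposite directions (so e.g. an element occurring twice in one fact yields a cycle). $A$ is acyclic if it has no cycle. A CQ is Berge-acyclic if its canonical instance is acyclic. *)

theory Defs
  imports Main "HOL-Library.FuncSet"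
begin

text \<open>A schema is given by a finite set sig of relation symbols of type 'r together with
an arity function ar (positive on sig). Instances have elements of type nat (every finite
instance is isomorphic to one of these). A fact is a pair (R, t) with t a tuple (list).\<close>

type_synonym 'r inst = "('r \<times> nat list) set"

definition schema :: "'r set \<Rightarrow> ('r \<Rightarrow> nat) \<Rightarrow> bool" where
  "schema sig ar \<longleftrightarrow> finite sig \<and> (\<forall>R\<in>sig. ar R > 0)"

definition is_inst :: "'r set \<Rightarrow> ('r \<Rightarrow> nat) \<Rightarrow> 'r inst \<Rightarrow> bool" where
  "is_inst sig ar A \<longleftrightarrow> finite A \<and> (\<forall>(R, t)\<in>A. R \<in> sig \<and> length t = ar R)"

definition insts :: "'r set \<Rightarrow> ('r \<Rightarrow> nat) \<Rightarrow> 'r inst set" where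
  "insts sig ar = {A. is_inst sig ar A}"

definition adom :: "'r inst \<Rightarrow> nat set" where
  "adom A = (\<Union>(R, t)\<in>A. set t)"

definition homs :: "'r inst \<Rightarrow> 'r inst \<Rightarrow> (nat \<Rightarrow> nat) set" where
  "homs A B = {h \<in> adom A \<rightarrow>\<^sub>E adom B. \<forall>(R, t)\<in>A. (R, map h t) \<in> B}"

definition hom_ex :: "'r inst \<Rightarrow> 'r inst \<Rightarrow> bool" where
  "hom_ex A B \<longleftrightarrow> homs A B \<noteq> {}"

definition CSP :: "'r set \<Rightarrow> ('r \<Rightarrow> nat) \<Rightarrow> 'r inst \<Rightarrow> 'r inst set" where
  "CSP sig ar B = {A \<in> insts sig ar. hom_ex A B}"

definition iso :: "'r inst \<Rightarrow> 'r inst \<Rightarrow> bool" where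
  "iso A B \<longleftrightarrow> (\<exists>f. inj_on f (adom A) \<and> B = (\<lambda>(R, t). (R, map f t)) ` A)"

definition is_class :: "'r set \<Rightarrow> ('r \<Rightarrow> nat) \<Rightarrow> 'r inst set \<Rightarrow> bool" where
  "is_class sig ar C \<longleftrightarrow> C \<subseteq> insts sig ar \<and>
     (\<forall>A B. A \<in> insts sig ar \<longrightarrow> B \<in> insts sig ar \<longrightarrow> iso A B \<longrightarrow> (A \<in> C \<longleftrightarrow> B \<in> C))"

datatype K = KB | KN

definition homK :: "K \<Rightarrow> 'r inst \<Rightarrow> 'r inst \<Rightarrow> nat" where
  "homK K A B = (case K of KB \<Rightarrow> (if hom_ex A B then 1 else 0) | KN \<Rightarrow> card (homs A B))"

definition left_qa :: "K \<Rightarrow> 'r set \<Rightarrow> ('r \<Rightarrow> nat) \<Rightarrow> 'r inst set \<Rightarrow> bool" where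
  "left_qa K sig ar C \<longleftrightarrow> (\<exists>Fs X. Fs \<noteq> [] \<and> set Fs \<subseteq> insts sig ar \<and>
     (\<forall>D \<in> insts sig ar. D \<in> C \<longleftrightarrow> map (\<lambda>F. homK K F D) Fs \<in> X))"

definition right_qa :: "K \<Rightarrow> 'r set \<Rightarrow> ('r \<Rightarrow> nat) \<Rightarrow> 'r inst set \<Rightarrow> bool" where
  "right_qa K sig ar C \<longleftrightarrow> (\<exists>Fs X. Fs \<noteq> [] \<and> set Fs \<subseteq> insts sig ar \<and>
     (\<forall>D \<in> insts sig ar. D \<in> C \<longleftrightarrow> map (\<lambda>F. homK K D F) Fs \<in> X))"

datatype 'r fo = FTrue | FAtom 'r "nat list" | FEq nat nat | FNot "'r fo"
  | FAnd "'r fo" "'r fo" | FEx nat "'r fo"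

fun sat :: "'r inst \<Rightarrow> (nat \<Rightarrow> nat) \<Rightarrow> 'r fo \<Rightarrow> bool" where
  "sat A \<rho> FTrue = True"
| "sat A \<rho> (FAtom R xs) = ((R, map \<rho> xs) \<in> A)"
| "sat A \<rho> (FEq x y) = (\<rho> x = \<rho> y)"
| "sat A \<rho> (FNot \<phi>) = (\<not> sat A \<rho> \<phi>)"
| "sat A \<rho> (FAnd \<phi> \<psi>) = (sat A \<rho> \<phi> \<and> sat A \<rho> \<psi>)"
| "sat A \<rho> (FEx x \<phi>) = (\<exists>a \<in> adom A. sat A (\<rho>(x := a)) \<phi>)"

fun fv :: "'r fo \<Rightarrow> nat set" where
  "fv FTrue = {}"
| "fv (FAtom R xs) = set xs"
| "fv (FEq x y) = {x, y}"
| "fv (FNot \<phi>) = fv \<phi>"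
| "fv (FAnd \<phi> \<psi>) = fv \<phi> \<union> fv \<psi>"
| "fv (FEx x \<phi>) = fv \<phi> - {x}"

fun fo_over :: "'r set \<Rightarrow> ('r \<Rightarrow> nat) \<Rightarrow> 'r fo \<Rightarrow> bool" where
  "fo_over sig ar FTrue = True"
| "fo_over sig ar (FAtom R xs) = (R \<in> sig \<and> length xs = ar R)"
| "fo_over sig ar (FEq x y) = True"
| "fo_over sig ar (FNot \<phi>) = fo_over sig ar \<phi>"
| "fo_over sig ar (FAnd \<phi> \<psi>) = (fo_over sig ar \<phi> \<and> fo_over sig ar \<psi>)"
| "fo_over sig ar (FEx x \<phi>) = fo_over sig ar \<phi>"

text \<open>Class of sigma-instances defined by a sentence (no free variables, so the
assignment is irrelevant).\<close>
definition models :: "'r set \<Rightarrow> ('r \<Rightarrow> nat) \<Rightarrow> 'r fo \<Rightarrow> 'r inst set" where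
  "models sig ar \<phi> = {D \<in> insts sig ar. sat D (\<lambda>_. 0) \<phi>}"

definition fo_definable :: "'r set \<Rightarrow> ('r \<Rightarrow> nat) \<Rightarrow> 'r inst set \<Rightarrow> bool" where
  "fo_definable sig ar C \<longleftrightarrow>
     (\<exists>\<phi>. fo_over sig ar \<phi> \<and> fv \<phi> = {} \<and> C = models sig ar \<phi>)"

text \<open>Boolean conjunctive queries: a list of atoms (R, variable tuple); the sentence
existentially quantifies all variables occurring in the atoms. Its canonical instance is
the set of atoms (variables are nats, so this is an instance).\<close>
type_synonym 'r cq = "('r \<times> nat list) list"

definition cq_wf :: "'r set \<Rightarrow> ('r \<Rightarrow> nat) \<Rightarrow> 'r cq \<Rightarrow> bool" where
  "cq_wf sig ar q \<longleftrightarrow> (\<forall>(R, xs)\<in>set q. R \<in> sig \<and> length xs = ar R)"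

definition cq_vars :: "'r cq \<Rightarrow> nat set" where
  "cq_vars q = (\<Union>(R, xs)\<in>set q. set xs)"

definition cq_formula :: "'r cq \<Rightarrow> 'r fo" where
  "cq_formula q = foldr FEx (sorted_list_of_set (cq_vars q))
      (foldr (\<lambda>(R, xs) \<phi>. FAnd (FAtom R xs) \<phi>) q FTrue)"

definition canonical :: "'r cq \<Rightarrow> 'r inst" where
  "canonical q = set q"

text \<open>Cycles in the incidence multigraph. Edges are occurrences (f, i) of the element
(snd f) ! i in the fact f. A cycle is encoded, starting at an element node, as a nonempty
list of passages (f, i, j) through fact f, entering via occurrence edge (f, i) and leaving via
(f, j). No immediate reversal of an edge: at fact nodes i \<noteq> j; at element nodes the leaving
edge (f_k, j_k) differs from the next entering edge (f_{k+1}, i_{k+1}); the walk is closed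
(indices taken cyclically).\<close>
definition is_cycle :: "'r inst \<Rightarrow> (('r \<times> nat list) \<times> nat \<times> nat) list \<Rightarrow> bool" where
  "is_cycle A cs \<longleftrightarrow> cs \<noteq> [] \<and>
     (\<forall>k < length cs. let (f, i, j) = cs ! k; (f', i', j') = cs ! ((k + 1) mod length cs) in
        f \<in> A \<and> i < length (snd f) \<and> j < length (snd f) \<and> i \<noteq> j \<and>
        snd f ! j = snd f' ! i' \<and> (f, j) \<noteq> (f', i'))"

definition acyclic_inst :: "'r inst \<Rightarrow> bool" where
  "acyclic_inst A \<longleftrightarrow> \<not> (\<exists>cs. is_cycle A cs)"

definition berge_acyclic :: "'r cq \<Rightarrow> bool" where
  "berge_acyclic q \<longleftrightarrow> acyclic_inst (canonical q)"

inductive_set bool_comb :: "'a set \<Rightarrow> 'a set set \<Rightarrow> 'a set set" for U S where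
  base: "X \<in> S \<Longrightarrow> X \<in> bool_comb U S"
| compl: "X \<in> bool_comb U S \<Longrightarrow> U - X \<in> bool_comb U S"
| inter: "X \<in> bool_comb U S \<Longrightarrow> Y \<in> bool_comb U S \<Longrightarrow> X \<inter> Y \<in> bool_comb U S"

definition berge_cq_classes :: "'r set \<Rightarrow> ('r \<Rightarrow> nat) \<Rightarrow> 'r inst set set" where
  "berge_cq_classes sig ar =
     {models sig ar (cq_formula q) | q. cq_wf sig ar q \<and> berge_acyclic q}"

definition fo_csp_classes :: "'r set \<Rightarrow> ('r \<Rightarrow> nat) \<Rightarrow> 'r inst set set" where
  "fo_csp_classes sig ar =
     {CSP sig ar B | B. B \<in> insts sig ar \<and> fo_definable sig ar (CSP sig ar B)}"

end

theory Submission
  imports Defs "HOL-Library.Countable"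
begin

text \<open>Call an instance \<open>g\<close>-sparse if all its sets of at most \<open>g\<close> facts are Berge-acyclic. By the
  partite construction, every instance \<open>D\<close> is the target of a homomorphism from a \<open>g\<close>-sparse
  instance \<open>D0\<close> that maps to no more of finitely many given instances than \<open>D\<close> does.

  (2) implies (3): membership in the class depends only on which acyclic instances of bounded
  size map to \<open>D\<close>. Indeed, if this is the same for \<open>D\<close> and \<open>D'\<close>, then disjointly adding small acyclic
  instances to \<open>D0\<close> and \<open>D0'\<close> equalizes the numbers of their connected substructures of each small
  isomorphism type. As images of small instances in sparse ones are acyclic, this equalizes the
  homomorphism counts from the left, and it changes nothing on the right.

  (3) implies (1) and (4): a tree has a dual instance, whose CSP is the complement of the class
  defined by the tree.

  (4) implies (3): a minimal sparse instance without homomorphism to \<open>B\<close> has bounded radius if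
  \<open>CSP(B)\<close> is first-order definable, by an Ehrenfeucht-Fraisse game. It is therefore layered like a
  tree, so that arc consistency in a bounded number of rounds decides whether it maps to \<open>B\<close>; the facts
  responsible for a negative answer form an acyclic instance of bounded size.\<close>

text \<open>Acyclicity is used as a counting inequality because this form is additive: it passes to
  disjoint unions and amalgams by summation, where cycles would have to be cut and spliced. One
  number \<open>N\<close> bounds both girth and size, so that every substructure small enough to be
  counted is also one about which the profile speaks. The partite construction needs uncolourable
  hypergraphs that are themselves of large girth. These come from the same construction applied to
  complete hypergraphs, by induction on the girth; the gain in each round is the point of the second
  alternative in \<open>amalg_sparse\<close>. When counts are equalized, the obstacle is to keep the
  right-hand answers. Only instances mapping to \<open>D\<close> are added, so the result
  \<open>E\<close> satisfies \<open>D0\<close> -> \<open>E\<close> -> \<open>D\<close>, and both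
  ends give the same answers. The radius in (4) => (3) is \<open>2 ^ q\<close> for a sentence of
  quantifier rank \<open>q\<close>, since each round of the game halves the distance within which
  the two sides must agree. The girth \<open>2 * r + 2\<close> is the size of a closed configuration
  made of two paths from the centre and two further facts.\<close>

section \<open>Homomorphisms, renamings and active domains\<close>

definition hom :: "(nat \<Rightarrow> nat) \<Rightarrow> 'r inst \<Rightarrow> 'r inst \<Rightarrow> bool" where
  "hom h A B \<longleftrightarrow> (\<forall>R t. (R, t) \<in> A \<longrightarrow> (R, map h t) \<in> B)"

definition rename :: "(nat \<Rightarrow> nat) \<Rightarrow> 'r inst \<Rightarrow> 'r inst" where
  "rename f A = (\<lambda>(R, t). (R, map f t)) ` A"

lemma in_adom: "(R, t) \<in> A \<Longrightarrow> x \<in> set t \<Longrightarrow> x \<in> adom A"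
  unfolding adom_def by blast

lemma adom_iff: "x \<in> adom A \<longleftrightarrow> (\<exists>R t. (R, t) \<in> A \<and> x \<in> set t)"
  unfolding adom_def by blast

lemma adom_iff2: "x \<in> adom A \<longleftrightarrow> (\<exists>f\<in>A. x \<in> set (snd f))"
  unfolding adom_def by force

lemma adom_UN: "adom A = (\<Union>f\<in>A. set (snd f))"
  unfolding adom_def by (simp add: case_prod_beta)

lemma adom_empty [simp]: "adom {} = {}"
  unfolding adom_def by simp

lemma adom_Un: "adom (A \<union> B) = adom A \<union> adom B"
  unfolding adom_def by blast

lemma adom_insert: "adom (insert f A) = set (snd f) \<union> adom A"
  by (auto simp: adom_iff2)

lemma adom_mono: "A \<subseteq> B \<Longrightarrow> adom A \<subseteq> adom B"
  unfolding adom_def by blast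

lemma finite_adom [simp]: "finite A \<Longrightarrow> finite (adom A)"
  unfolding adom_def by auto

lemma finite_rename [simp]: "finite A \<Longrightarrow> finite (rename f A)"
  unfolding rename_def by simp

lemma rename_iff: "(R, t) \<in> rename f A \<longleftrightarrow> (\<exists>s. (R, s) \<in> A \<and> t = map f s)"
  unfolding rename_def by force

lemma adom_rename: "adom (rename f A) = f ` adom A"
proof (intro set_eqI iffI)
  fix x assume "x \<in> adom (rename f A)"
  then obtain R s where "(R, s) \<in> A" "x \<in> set (map f s)" unfolding adom_iff rename_iff by blast
  then show "x \<in> f ` adom A" using in_adom[of R s A] by auto
next
  fix x assume "x \<in> f ` adom A"
  then obtain y where "y \<in> adom A" "x = f y" by blast
  then obtain R s where "(R, s) \<in> A" "y \<in> set s" "x = f y" unfolding adom_iff by blast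
  then have "(R, map f s) \<in> rename f A" "x \<in> set (map f s)" by (auto simp: rename_iff)
  then show "x \<in> adom (rename f A)" by (rule in_adom)
qed

lemma hom_rename_iff: "hom h A B \<longleftrightarrow> rename h A \<subseteq> B"
  unfolding hom_def rename_def by force

lemma hom_rename: "hom f A (rename f A)"
  by (simp add: hom_rename_iff)

lemma hom_comp: "hom f A B \<Longrightarrow> hom g B C \<Longrightarrow> hom (g \<circ> f) A C"
  unfolding hom_def by (metis list.map_comp)

lemma hom_mono: "hom f A B \<Longrightarrow> A' \<subseteq> A \<Longrightarrow> B \<subseteq> B' \<Longrightarrow> hom f A' B'"
  unfolding hom_def by blast

lemma hom_cong: "(\<And>x. x \<in> adom A \<Longrightarrow> f x = g x) \<Longrightarrow> hom f A B \<longleftrightarrow> hom g A B"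
  unfolding hom_def by (metis in_adom map_cong)

lemma rename_cong: "(\<And>x. x \<in> adom A \<Longrightarrow> f x = g x) \<Longrightarrow> rename f A = rename g A"
  unfolding rename_def by (rule image_cong) (use in_adom in \<open>fastforce+\<close>)

lemma rename_comp: "rename g (rename f A) = rename (g \<circ> f) A"
  unfolding rename_def by force

lemma rename_id: "(\<And>x. x \<in> adom A \<Longrightarrow> f x = x) \<Longrightarrow> rename f A = A"
  using rename_cong[of A f id] by (auto simp: rename_def)

lemma hom_adom: "hom h A B \<Longrightarrow> x \<in> adom A \<Longrightarrow> h x \<in> adom B"
  unfolding hom_def adom_iff by force

text \<open>Total maps that agree on \<open>adom A\<close> are the same homomorphism; extensionality
  picks one representative, which matters only for counting. All existence arguments can therefore
  use \<open>hom\<close>.\<close>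

lemma homs_iff: "h \<in> homs A B \<longleftrightarrow> h \<in> extensional (adom A) \<and> hom h A B"
proof -
  have "h \<in> adom A \<rightarrow> adom B" if "hom h A B" using that hom_adom by blast
  then show ?thesis unfolding homs_def by (auto simp: PiE_def hom_def)
qed

lemma hom_ex_iff: "hom_ex A B \<longleftrightarrow> (\<exists>h. hom h A B)"
proof
  assume "\<exists>h. hom h A B"
  then obtain h where "hom h A B" by blast
  then have "restrict h (adom A) \<in> homs A B"
    by (simp add: homs_iff hom_cong[of A "restrict h (adom A)" h])
  then show "hom_ex A B" by (auto simp: hom_ex_def)
qed (auto simp: hom_ex_def homs_iff)

lemma hom_ex_trans: "hom_ex A B \<Longrightarrow> hom_ex B C \<Longrightarrow> hom_ex A C"
  unfolding hom_ex_iff using hom_comp by blast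

lemma hom_ex_subset: "A \<subseteq> B \<Longrightarrow> hom_ex A B"
  unfolding hom_ex_iff by (auto simp: hom_def intro!: exI[of _ id])

lemma finite_homs [simp]: "finite A \<Longrightarrow> finite B \<Longrightarrow> finite (homs A B)"
  by (rule finite_subset[of _ "adom A \<rightarrow>\<^sub>E adom B"]) (auto simp: homs_def intro!: finite_PiE)

lemma inst_hom: "hom h A B \<Longrightarrow> B \<in> insts sig ar \<Longrightarrow> finite A \<Longrightarrow> A \<in> insts sig ar"
  unfolding insts_def is_inst_def hom_def by fastforce

lemma inst_finite: "A \<in> insts sig ar \<Longrightarrow> finite A"
  by (simp add: insts_def is_inst_def)

lemma inst_subset: "A \<subseteq> B \<Longrightarrow> B \<in> insts sig ar \<Longrightarrow> A \<in> insts sig ar"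
  unfolding insts_def is_inst_def by (auto intro: finite_subset)

lemma inst_Un: "A \<in> insts sig ar \<Longrightarrow> B \<in> insts sig ar \<Longrightarrow> A \<union> B \<in> insts sig ar"
  unfolding insts_def is_inst_def by auto

lemma inst_rename: "A \<in> insts sig ar \<Longrightarrow> rename f A \<in> insts sig ar"
  unfolding insts_def is_inst_def rename_def by auto

lemma inst_fact: "A \<in> insts sig ar \<Longrightarrow> (R, t) \<in> A \<Longrightarrow> R \<in> sig \<and> length t = ar R"
  unfolding insts_def is_inst_def by auto

lemma inst_nonempty: "schema sig ar \<Longrightarrow> A \<in> insts sig ar \<Longrightarrow> f \<in> A \<Longrightarrow> snd f \<noteq> []"
  using inst_fact[of A sig ar "fst f" "snd f"] unfolding schema_def by (cases f) fastforce

lemma card_adom_le: "finite S \<Longrightarrow> card (adom S) \<le> (\<Sum>f\<in>S. length (snd f))"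
proof (induction S rule: finite_induct)
  case (insert f S)
  have "card (adom (insert f S)) \<le> card (set (snd f)) + card (adom S)"
    by (simp add: adom_insert card_Un_le)
  also have "\<dots> \<le> length (snd f) + (\<Sum>f\<in>S. length (snd f))"
    using insert card_length[of "snd f"] by simp
  finally show ?case using insert by simp
qed simp

section \<open>Acyclicity by counting\<close>

text \<open>The incidence multigraph of a set \<open>S\<close> of facts has \<open>card (adom S) + card S\<close> nodes and
  one edge per position of a fact, so the inequality for all nonempty subsets says that it is a
  forest.\<close>

definition sparse :: "nat \<Rightarrow> 'r inst \<Rightarrow> bool" where
  "sparse g A \<longleftrightarrow> (\<forall>S\<subseteq>A. S \<noteq> {} \<longrightarrow> card S \<le> g \<longrightarrow>
     (\<Sum>f\<in>S. length (snd f)) < card (adom S) + card S)"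

text \<open>An elimination order, read backwards: facts meeting the rest in at most one element are
  peeled off. It links cycles and counting, as both absence of cycles and sparsity yield a fact to
  peel off.\<close>

inductive forest :: "'r inst \<Rightarrow> bool" where
  empty: "forest {}"
| insert: "forest S \<Longrightarrow> f \<notin> S \<Longrightarrow> distinct (snd f) \<Longrightarrow> card (set (snd f) \<inter> adom S) \<le> 1 \<Longrightarrow>
    forest (insert f S)"

text \<open>Apart from position \<open>i\<close>, the elements of \<open>f\<close> occur nowhere else in \<open>S\<close>.\<close>

definition pendant :: "'r inst \<Rightarrow> 'r \<times> nat list \<Rightarrow> nat \<Rightarrow> bool" where
  "pendant S f i \<longleftrightarrow> f \<in> S \<and> (\<forall>j<length (snd f). j \<noteq> i \<longrightarrow>
     (\<forall>f'\<in>S. \<forall>i'<length (snd f'). snd f' ! i' = snd f ! j \<longrightarrow> (f', i') = (f, j)))"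

lemma pendantD: "pendant S f i \<Longrightarrow> j < length (snd f) \<Longrightarrow> j \<noteq> i \<Longrightarrow> f' \<in> S \<Longrightarrow>
    i' < length (snd f') \<Longrightarrow> snd f' ! i' = snd f ! j \<Longrightarrow> f' = f \<and> i' = j"
  unfolding pendant_def by blast

lemma pendant_distinct: assumes p: "pendant S f i" shows "distinct (snd f)"
  unfolding distinct_conv_nth
proof (intro allI impI notI)
  fix j j' assume j: "j < length (snd f)" "j' < length (snd f)" "j \<noteq> j'" "snd f ! j = snd f ! j'"
  have "f \<in> S" using p by (simp add: pendant_def)
  show False
  proof (cases "j = i")
    case True
    then show False using pendantD[OF p, of j' f j] j \<open>f \<in> S\<close> by simp
  next
    case False
    then show False using pendantD[OF p, of j f j'] j \<open>f \<in> S\<close> by simp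
  qed
qed

lemma pendant_meet: assumes "pendant S f i" shows "card (set (snd f) \<inter> adom (S - {f})) \<le> 1"
proof -
  have "set (snd f) \<inter> adom (S - {f}) \<subseteq> {snd f ! i}"
  proof
    fix x assume "x \<in> set (snd f) \<inter> adom (S - {f})"
    then obtain f' where f': "f' \<in> S" "f' \<noteq> f" "x \<in> set (snd f')" "x \<in> set (snd f)"
      by (auto simp: adom_iff2)
    then obtain j i' where "j < length (snd f)" "snd f ! j = x" "i' < length (snd f')" "snd f' ! i' = x"
      by (meson in_set_conv_nth)
    then show "x \<in> {snd f ! i}" using f' pendantD[OF assms, of j f' i'] by auto
  qed
  from card_mono[OF _ this] show ?thesis by simp
qed

lemma forest_if_pendants:
  assumes "finite S" "\<And>S'. S' \<subseteq> S \<Longrightarrow> S' \<noteq> {} \<Longrightarrow> \<exists>f i. pendant S' f i"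
  shows "forest S"
  using assms
proof (induction S rule: finite_psubset_induct)
  case (psubset S)
  show ?case
  proof (cases "S = {}")
    case False
    then obtain f i where p: "pendant S f i" using psubset.prems by blast
    then have fS: "f \<in> S" by (simp add: pendant_def)
    have "forest (S - {f})" using fS psubset.prems by (intro psubset.IH) auto
    then have "forest (insert f (S - {f}))"
      using p by (intro forest.insert) (auto simp: pendant_distinct pendant_meet[unfolded One_nat_def])
    then show ?thesis using fS by (simp add: insert_absorb)
  qed (simp add: forest.empty)
qed

lemma is_cycle_iff:
  "is_cycle A cs \<longleftrightarrow> cs \<noteq> [] \<and> (\<forall>k<length cs. fst (cs ! k) \<in> A \<and>
     fst (snd (cs ! k)) < length (snd (fst (cs ! k))) \<and>
     snd (snd (cs ! k)) < length (snd (fst (cs ! k))) \<and>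
     fst (snd (cs ! k)) \<noteq> snd (snd (cs ! k)) \<and>
     snd (fst (cs ! k)) ! snd (snd (cs ! k)) =
       snd (fst (cs ! ((k + 1) mod length cs))) ! fst (snd (cs ! ((k + 1) mod length cs))) \<and>
     (fst (cs ! k), snd (snd (cs ! k))) \<noteq>
       (fst (cs ! ((k + 1) mod length cs)), fst (snd (cs ! ((k + 1) mod length cs)))))"
  unfolding is_cycle_def Let_def case_prod_beta by (rule refl)

lemma acyclic_subset: "acyclic_inst S \<Longrightarrow> S' \<subseteq> S \<Longrightarrow> acyclic_inst S'"
  unfolding acyclic_inst_def is_cycle_iff by blast

text \<open>If no fact is pendant, then a walk that has entered a fact can always leave it at
  another position and go on to a different occurrence of the element found there. Finiteness makes
  such a walk return.\<close>

lemma acyclic_pendant: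
  assumes fin: "finite S" and ne: "S \<noteq> {}" and pos: "\<And>f. f \<in> S \<Longrightarrow> snd f \<noteq> []"
    and ac: "acyclic_inst S"
  shows "\<exists>f i. pendant S f i"
proof (rule ccontr)
  assume no: "\<not> ?thesis"
  define Ent where "Ent = Sigma S (\<lambda>f. {..<length (snd f)})"
  have "\<exists>j f' i'. j < length (snd f) \<and> j \<noteq> i \<and> (f', i') \<in> Ent \<and> snd f' ! i' = snd f ! j \<and> (f, j) \<noteq> (f', i')"
    if "(f, i) \<in> Ent" for f i
  proof -
    have "f \<in> S" using that by (simp add: Ent_def)
    then obtain j f' i' where "j<length (snd f)" "j \<noteq> i" "f' \<in> S" "i'<length (snd f')"
       "snd f' ! i' = snd f ! j" "(f', i') \<noteq> (f, j)"
      using no unfolding pendant_def by blast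
    then show ?thesis unfolding Ent_def by (intro exI[of _ j] exI[of _ f'] exI[of _ i']) auto
  qed
  then have "\<forall>e. \<exists>n. e \<in> Ent \<longrightarrow> fst n < length (snd (fst e)) \<and> fst n \<noteq> snd e \<and>
      snd n \<in> Ent \<and> snd (fst (snd n)) ! snd (snd n) = snd (fst e) ! fst n \<and> (fst e, fst n) \<noteq> snd n"
    by force
  from choice[OF this] obtain N where N: "\<forall>e. e \<in> Ent \<longrightarrow> fst (N e) < length (snd (fst e)) \<and> fst (N e) \<noteq> snd e \<and>
      snd (N e) \<in> Ent \<and> snd (fst (snd (N e))) ! snd (snd (N e)) = snd (fst e) ! fst (N e) \<and>
      (fst e, fst (N e)) \<noteq> snd (N e)" ..
  define J where "J e = fst (N e)" for e
  define F where "F e = fst (snd (N e))" for e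
  define I where "I e = snd (snd (N e))" for e
  have JFI: "J (f, i) < length (snd f) \<and> J (f, i) \<noteq> i \<and>
      (F (f, i), I (f, i)) \<in> Ent \<and> snd (F (f, i)) ! I (f, i) = snd f ! J (f, i) \<and>
      (f, J (f, i)) \<noteq> (F (f, i), I (f, i))" if "(f, i) \<in> Ent" for f i
    using N[rule_format, OF that] by (simp add: J_def F_def I_def)
  define nxt where "nxt e = (F e, I e)" for e
  obtain f0 where "f0 \<in> S" using ne by blast
  define e where "e n = (nxt ^^ n) (f0, 0)" for n
  have e_in: "e n \<in> Ent" for n
  proof (induction n)
    case 0 then show ?case using \<open>f0 \<in> S\<close> pos by (auto simp: e_def Ent_def)
  next
    case (Suc n) then show ?case using JFI[of "fst (e n)" "snd (e n)"] by (simp add: e_def nxt_def)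
  qed
  have "finite Ent" using fin by (auto simp: Ent_def)
  then have "\<not> inj e" using e_in finite_imageD[of e UNIV] finite_subset[of "range e" Ent] by auto
  then obtain a b where ab: "a < b" "e a = e b" by (auto simp: inj_def) (metis linorder_neqE_nat)
  \<comment> \<open>What repeats is an entry, that is, a fact together with the position of
    entrance. So the last exit is followed by the first entry, and the conditions of a cycle hold at
    the closing point as well.\<close>
  define cs where "cs = map (\<lambda>k. (fst (e k), snd (e k), J (e k))) [a..<b]"
  have len: "length cs = b - a" by (simp add: cs_def)
  have "is_cycle S cs"
    unfolding is_cycle_def
  proof (intro conjI allI impI)
    show "cs \<noteq> []" using ab by (simp add: cs_def)
  next
    fix k assume k: "k < length cs"
    have ek: "e (Suc n) = (F (e n), I (e n))" for n by (simp add: e_def nxt_def)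
    have nx: "cs ! ((k + 1) mod length cs) = (fst (e (Suc (a + k))), snd (e (Suc (a + k))), J (e (Suc (a + k))))"
    proof (cases "Suc k = length cs")
      case True
      then have "e (Suc (a + k)) = e a" using ab len by (metis add_Suc_right le_add_diff_inverse less_imp_le)
      then show ?thesis using True ab len by (simp add: cs_def)
    next
      case False
      then show ?thesis using k len by (simp add: cs_def)
    qed
    have ck: "cs ! k = (fst (e (a + k)), snd (e (a + k)), J (e (a + k)))" using k len by (simp add: cs_def)
    have "J (e (a+k)) < length (snd (fst (e (a+k)))) \<and> J (e (a+k)) \<noteq> snd (e (a+k)) \<and>
      snd (F (e (a+k))) ! I (e (a+k)) = snd (fst (e (a+k))) ! J (e (a+k)) \<and>
      (fst (e (a+k)), J (e (a+k))) \<noteq> (F (e (a+k)), I (e (a+k)))"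
      using JFI[of "fst (e (a+k))" "snd (e (a+k))"] e_in[of "a+k"] by simp
    then show "let (f, i, j) = cs ! k; (f', i', j') = cs ! ((k + 1) mod length cs) in
        f \<in> S \<and> i < length (snd f) \<and> j < length (snd f) \<and> i \<noteq> j \<and>
        snd f ! j = snd f' ! i' \<and> (f, j) \<noteq> (f', i')"
      unfolding nx ck ek using e_in[of "a+k"] by (auto simp: Ent_def)
  qed
  then show False using ac by (auto simp: acyclic_inst_def)
qed

lemma acyclic_imp_forest:
  assumes "finite S" "\<And>f. f \<in> S \<Longrightarrow> snd f \<noteq> []" "acyclic_inst S"
  shows "forest S"
proof (rule forest_if_pendants[OF assms(1)])
  fix S' assume S': "S' \<subseteq> S" "S' \<noteq> {}"
  show "\<exists>f i. pendant S' f i"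
    using acyclic_pendant[of S'] S' assms acyclic_subset[OF assms(3) S'(1)] finite_subset[OF S'(1)] by blast
qed

text \<open>Double counting of the set \<open>Q\<close> of positions whose element has another
  occurrence. Without a pendant fact, every fact has at least two positions in \<open>Q\<close>, and
  every element occurring in \<open>Q\<close> does so at least twice. So facts and elements of
  \<open>Q\<close> number at most \<open>card Q\<close> together, and each element outside
  \<open>Q\<close> uses up a position of its own, contradicting the strict inequality.\<close>

lemma sparse_pendant:
  assumes fin: "finite S" and ne: "S \<noteq> {}"
    and cnt: "(\<Sum>f\<in>S. length (snd f)) < card (adom S) + card S"
  shows "\<exists>f i. pendant S f i"
proof (rule ccontr)
  assume no: "\<not> ?thesis"
  define Pos where "Pos = Sigma S (\<lambda>f. {..<length (snd f)})"
  define el :: "('a \<times> nat list) \<times> nat \<Rightarrow> nat" where "el = (\<lambda>(f, i). snd f ! i)"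
  define Q where "Q = {p \<in> Pos. \<exists>p'\<in>Pos. p' \<noteq> p \<and> el p' = el p}"
  have finP: "finite Pos" using fin by (auto simp: Pos_def)
  then have finQ: "finite Q" by (simp add: Q_def)
  have cP: "card Pos = (\<Sum>f\<in>S. length (snd f))" using fin by (simp add: Pos_def)
  have "x \<in> adom S \<longleftrightarrow> x \<in> el ` Pos" for x
    by (auto simp: adom_iff2 el_def Pos_def in_set_conv_nth image_iff)
  then have adomP: "adom S = el ` Pos" by blast
  have Qf: "2 \<le> card {i. (f, i) \<in> Q}" if fS: "f \<in> S" for f
  proof -
    define Z where "Z = {i. (f, i) \<in> Q}"
    have "Z \<subseteq> {..<length (snd f)}" by (auto simp: Z_def Q_def Pos_def)
    then have fZ: "finite Z" by (rule finite_subset) simp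
    have ex: "\<exists>j\<in>Z. j \<noteq> i" for i
    proof -
      obtain j f' i' where j: "j<length (snd f)" "j \<noteq> i" "f' \<in> S" "i'<length (snd f')"
       "snd f' ! i' = snd f ! j" "(f', i') \<noteq> (f, j)"
        using no fS unfolding pendant_def by blast
      then have "j \<in> Z" using fS by (auto simp: Z_def Q_def Pos_def el_def intro!: bexI[of _ "(f', i')"])
      then show ?thesis using j by blast
    qed
    obtain i where i: "i \<in> Z" using ex by blast
    obtain j where j: "j \<in> Z" "j \<noteq> i" using ex by blast
    have "card {i, j} \<le> card Z" using i j fZ by (intro card_mono) auto
    then show ?thesis using j by (simp add: Z_def)
  qed
  have "Q = Sigma S (\<lambda>f. {i. (f, i) \<in> Q})" by (auto simp: Q_def Pos_def)
  moreover have "finite {i. (f, i) \<in> Q}" for f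
    using finQ by (rule finite_subset[rotated, OF finite_imageI[of Q snd]]) force
  ultimately have "card Q = (\<Sum>f\<in>S. card {i. (f, i) \<in> Q})"
    using card_SigmaI[OF fin, of "\<lambda>f. {i. (f, i) \<in> Q}"] by simp
  also have "\<dots> \<ge> (\<Sum>f\<in>S. 2)" by (rule sum_mono) (rule Qf)
  finally have cQ: "2 * card S \<le> card Q" by simp
  have fib: "2 \<le> card {p \<in> Q. el p = y}" if "y \<in> el ` Q" for y
  proof -
    from that obtain p where p: "p \<in> Q" "el p = y" by blast
    then obtain p' where p': "p' \<in> Pos" "p' \<noteq> p" "el p' = el p" by (auto simp: Q_def)
    then have "p' \<in> Q" using p by (auto simp: Q_def)
    then have "card {p, p'} \<le> card {p \<in> Q. el p = y}" using p p' finQ by (intro card_mono) auto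
    then show ?thesis using p' by simp
  qed
  have "card Q = (\<Sum>y\<in>el ` Q. card {p \<in> Q. el p = y})"
    using sum.image_gen[OF finQ, of "\<lambda>_. 1::nat" el] by simp
  also have "\<dots> \<ge> (\<Sum>y\<in>el ` Q. 2)" by (rule sum_mono) (rule fib)
  finally have cQ2: "2 * card (el ` Q) \<le> card Q" by simp
  have "adom S \<subseteq> el ` (Pos - Q) \<union> el ` Q" using adomP by blast
  then have "card (adom S) \<le> card (el ` (Pos - Q) \<union> el ` Q)" using finP finQ by (intro card_mono) auto
  also have "\<dots> \<le> card (el ` (Pos - Q)) + card (el ` Q)" by (rule card_Un_le)
  also have "\<dots> \<le> card (Pos - Q) + card (el ` Q)" using finP by (simp add: card_image_le)
  also have "card (Pos - Q) = card Pos - card Q" using finQ by (intro card_Diff_subset) (auto simp: Q_def)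
  finally have "card (adom S) \<le> card Pos - card Q + card (el ` Q)" .
  moreover have "card Q \<le> card Pos" using finP by (intro card_mono) (auto simp: Q_def)
  ultimately show False using cQ cQ2 cnt cP by linarith
qed

text \<open>A cycle through the fact \<open>f\<close> added last enters and leaves it at distinct
  positions. As \<open>f\<close> repeats no element, the neighbouring passages continue in other
  facts, so \<open>f\<close> would share two elements with \<open>S\<close>.\<close>

lemma forest_imp_acyclic: "forest S \<Longrightarrow> acyclic_inst S"
proof (induction rule: forest.induct)
  case empty
  show ?case unfolding acyclic_inst_def is_cycle_iff by auto
next
  case (insert S f)
  show ?case unfolding acyclic_inst_def
  proof
    assume "\<exists>cs. is_cycle (insert f S) cs"
    then obtain cs where cs: "is_cycle (insert f S) cs" by blast
    define n where "n = length cs"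
    have n: "n > 0" using cs by (simp add: n_def is_cycle_def)
    define ff where "ff k = fst (cs ! k)" for k
    define ii where "ii k = fst (snd (cs ! k))" for k
    define jj where "jj k = snd (snd (cs ! k))" for k
    have P: "ff k \<in> insert f S \<and> ii k < length (snd (ff k)) \<and> jj k < length (snd (ff k)) \<and> ii k \<noteq> jj k \<and>
        snd (ff k) ! jj k = snd (ff ((k+1) mod n)) ! ii ((k+1) mod n) \<and> (ff k, jj k) \<noteq> (ff ((k+1) mod n), ii ((k+1) mod n))"
      if "k < n" for k
      using cs[unfolded is_cycle_iff, THEN conjunct2, rule_format, of k] that
      unfolding n_def ff_def ii_def jj_def by simp
    show False
    proof (cases "\<exists>k<n. ff k = f")
      case False
      then have "is_cycle S cs"
        using P False n unfolding is_cycle_iff n_def ff_def ii_def jj_def by simp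
      then show False using insert by (auto simp: acyclic_inst_def)
    next
      case True
      then obtain k where k: "k < n" "ff k = f" by blast
      have Sf: "x \<in> adom S" if "g \<in> insert f S" "i < length (snd g)" "j < length (snd f)"
         "x = snd g ! i" "x = snd f ! j" "(f, j) \<noteq> (g, i)" for g i j x
      proof -
        have "g \<noteq> f" using that insert.hyps(3) nth_eq_iff_index_eq[of "snd f" i j] by auto
        then have "(fst g, snd g) \<in> S" using that(1) by simp
        then show ?thesis unfolding that(4) by (rule in_adom) (simp add: that(2))
      qed
      have l: "(k+1) mod n < n" using n by simp
      have a1: "snd f ! jj k \<in> adom S"
        using P[OF k(1)] P[OF l] unfolding k(2) by (intro Sf[of "ff ((k+1) mod n)" "ii ((k+1) mod n)" "jj k"]) simp_all
      define m where "m = (if k = 0 then n - 1 else k - 1)"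
      have m: "m < n" "(m + 1) mod n = k" using k n by (auto simp: m_def)
      have a2: "snd f ! ii k \<in> adom S"
        using P[OF m(1)] P[OF k(1)] unfolding m(2) k(2) by (intro Sf[of "ff m" "jj m" "ii k"]) (simp_all, metis prod.inject)
      have mem: "snd f ! ii k \<in> set (snd f)" "snd f ! jj k \<in> set (snd f)"
        using P[OF k(1), unfolded k(2)] nth_mem[of "ii k" "snd f"] nth_mem[of "jj k" "snd f"] by blast+
      have "snd f ! ii k \<noteq> snd f ! jj k" using P[OF k(1)] insert.hyps(3) nth_eq_iff_index_eq[of "snd f" "ii k" "jj k"] unfolding k(2) by simp
      moreover have "card {snd f ! ii k, snd f ! jj k} \<le> card (set (snd f) \<inter> adom S)"
        using a1 a2 mem by (intro card_mono) auto
      ultimately show False using insert.hyps(4) by simp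
    qed
  qed
qed

lemma sparse_imp_acyclic: "finite S \<Longrightarrow> sparse (card S) S \<Longrightarrow> acyclic_inst S"
proof -
  assume fin: "finite S" and sp: "sparse (card S) S"
  have "forest S"
  proof (rule forest_if_pendants[OF fin])
    fix S' assume S': "S' \<subseteq> S" "S' \<noteq> {}"
    then have "card S' \<le> card S" using fin card_mono by blast
    then show "\<exists>f i. pendant S' f i"
      using sp S' finite_subset[OF S'(1) fin] unfolding sparse_def by (intro sparse_pendant) auto
  qed
  then show ?thesis by (rule forest_imp_acyclic)
qed

lemma sparse_subset: "sparse g A \<Longrightarrow> A' \<subseteq> A \<Longrightarrow> g' \<le> g \<Longrightarrow> sparse g' A'"
  unfolding sparse_def by (meson order_trans)

section \<open>Sparse incomparability\<close>

lemma hom_fact: "hom h A B \<Longrightarrow> f \<in> A \<Longrightarrow> (fst f, map h (snd f)) \<in> B"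
  unfolding hom_def by (cases f) simp

lemma sparse_if_disjoint:
  assumes fin: "finite A" and d: "\<And>f. f \<in> A \<Longrightarrow> distinct (snd f)"
    and dis: "\<And>f f'. f \<in> A \<Longrightarrow> f' \<in> A \<Longrightarrow> f \<noteq> f' \<Longrightarrow> set (snd f) \<inter> set (snd f') = {}"
  shows "sparse g A"
  unfolding sparse_def
proof (intro allI impI)
  fix S assume S: "S \<subseteq> A" "S \<noteq> {}"
  have fS: "finite S" using S fin finite_subset by blast
  note adom_UN[of S]
  moreover have "card (\<Union>f\<in>S. set (snd f)) = (\<Sum>f\<in>S. card (set (snd f)))"
  proof (rule card_UN_disjoint[OF fS])
    show "\<forall>f\<in>S. \<forall>f'\<in>S. f \<noteq> f' \<longrightarrow> set (snd f) \<inter> set (snd f') = {}" using S dis by blast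
  qed simp
  moreover have "(\<Sum>f\<in>S. card (set (snd f))) = (\<Sum>f\<in>S. length (snd f))"
    using S d by (intro sum.cong) (auto simp: distinct_card)
  moreover have "card S > 0" using S fS by (simp add: card_gt_0_iff)
  ultimately show "(\<Sum>f\<in>S. length (snd f)) < card (adom S) + card S" by simp
qed

text \<open>One step of the partite construction of Nesetril and Roedl: \<open>amalg xs H P\<close> has one copy of \<open>P\<close>
  per hyperedge \<open>e\<close> of \<open>H\<close>, in which the elements \<open>xs\<close> are replaced by those of \<open>e\<close>. If \<open>H\<close> is not
  properly colourable, then every colouring has a copy of \<open>P\<close> on which \<open>xs\<close> is monochromatic.\<close>

definition sel :: "nat list \<Rightarrow> nat list \<Rightarrow> nat \<Rightarrow> nat" where
  "sel xs e y = e ! (SOME i. i < length xs \<and> xs ! i = y)"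

definition glue :: "nat list \<Rightarrow> nat list \<Rightarrow> nat \<Rightarrow> nat" where
  "glue xs e y = to_nat (if y \<in> set xs then Inl (sel xs e y) else Inr (e, y) :: nat + nat list \<times> nat)"

definition amalg :: "nat list \<Rightarrow> unit inst \<Rightarrow> 'r inst \<Rightarrow> 'r inst" where
  "amalg xs H P = (\<Union>e\<in>H. rename (glue xs (snd e)) P)"

lemma sel_ex: assumes "y \<in> set xs" shows "\<exists>i<length xs. xs ! i = y \<and> sel xs e y = e ! i"
proof -
  have "\<exists>i. i < length xs \<and> xs ! i = y" using assms unfolding in_set_conv_nth .
  from someI_ex[OF this] show ?thesis unfolding sel_def by blast
qed

lemma sel_mem: assumes "y \<in> set xs" "length e = length xs" shows "sel xs e y \<in> set e"
  using sel_ex[OF assms(1), of e] assms(2) nth_mem by fastforce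

lemma sel_inj: assumes "length e = length xs" "distinct e" shows "inj_on (sel xs e) (set xs)"
proof (rule inj_onI)
  fix y z assume yz: "y \<in> set xs" "z \<in> set xs" "sel xs e y = sel xs e z"
  obtain i where i: "i < length xs" "xs ! i = y" "sel xs e y = e ! i" using sel_ex[OF yz(1)] by blast
  obtain j where j: "j < length xs" "xs ! j = z" "sel xs e z = e ! j" using sel_ex[OF yz(2)] by blast
  have "e ! i = e ! j" using yz(3) i(3) j(3) by (rule box_equals)
  then have "i = j" using assms i(1) j(1) nth_eq_iff_index_eq[of e i j] by simp
  then show "y = z" using i(2) j(2) by blast
qed

lemma glue_inj: assumes "length e = length xs" "distinct e" shows "inj (glue xs e)"
proof (rule injI)
  fix y z assume "glue xs e y = glue xs e z"
  then have "(if y \<in> set xs then Inl (sel xs e y) else Inr (e, y)) = (if z \<in> set xs then Inl (sel xs e z) else Inr (e, z))"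
    unfolding glue_def by simp
  then show "y = z" using sel_inj[OF assms] by (auto split: if_splits simp: inj_on_def)
qed

lemma glue_in: "y \<in> set xs \<Longrightarrow> glue xs e y = to_nat (Inl (sel xs e y) :: nat + nat list \<times> nat)"
  by (simp add: glue_def)

text \<open>Deleting incidences from a forest leaves a forest: shrinking the hyperedges to
  \<open>T e\<close> lowers the sum on the left by at least as much as the number of vertices on the
  right.\<close>

lemma traces_bound:
  assumes fin: "finite H" and sp: "sparse g H" and H2: "H2 \<subseteq> H" "H2 \<noteq> {}" "card H2 \<le> g"
    and T: "\<And>e. e \<in> H2 \<Longrightarrow> T e \<subseteq> set (snd e)"
  shows "(\<Sum>e\<in>H2. card (T e)) < card (\<Union>e\<in>H2. T e) + card H2"
proof -
  have f2: "finite H2" using H2 fin finite_subset by blast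
  have fT: "finite (T e)" if "e \<in> H2" for e using T[OF that] by (rule finite_subset) simp
  have 1: "(\<Sum>e\<in>H2. length (snd e)) < card (adom H2) + card H2"
    using sp H2 unfolding sparse_def by blast
  have "adom H2 \<subseteq> (\<Union>e\<in>H2. T e) \<union> (\<Union>e\<in>H2. set (snd e) - T e)" unfolding adom_UN by blast
  then have "card (adom H2) \<le> card ((\<Union>e\<in>H2. T e) \<union> (\<Union>e\<in>H2. set (snd e) - T e))"
    using f2 fT by (intro card_mono) auto
  also have "\<dots> \<le> card (\<Union>e\<in>H2. T e) + card (\<Union>e\<in>H2. set (snd e) - T e)" by (rule card_Un_le)
  also have "card (\<Union>e\<in>H2. set (snd e) - T e) \<le> (\<Sum>e\<in>H2. card (set (snd e) - T e))"
    using f2 by (rule card_UN_le)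
  finally have 2: "card (adom H2) \<le> card (\<Union>e\<in>H2. T e) + (\<Sum>e\<in>H2. card (set (snd e) - T e))" by simp
  have "(\<Sum>e\<in>H2. card (set (snd e) - T e)) + (\<Sum>e\<in>H2. card (T e)) = (\<Sum>e\<in>H2. card (set (snd e) - T e) + card (T e))"
    by (simp add: sum.distrib)
  also have "\<dots> \<le> (\<Sum>e\<in>H2. length (snd e))"
  proof (rule sum_mono)
    fix e assume e: "e \<in> H2"
    have "card (set (snd e) - T e) = card (set (snd e)) - card (T e)" by (rule card_Diff_subset) (use fT T e in auto)
    moreover have "card (T e) \<le> card (set (snd e))" using T[OF e] by (intro card_mono) auto
    ultimately show "card (set (snd e) - T e) + card (T e) \<le> length (snd e)" using card_length[of "snd e"] by linarith
  qed
  finally show ?thesis using 1 2 by linarith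
qed

text \<open>If every fact of \<open>P\<close> meets \<open>xs\<close> at most once, then a cycle spends at least two facts in each copy
  that it passes through; this makes the amalgam sparser than \<open>H\<close>.\<close>

lemma amalg_sparse:
  fixes P :: "'r inst"
  assumes finP: "finite P" and finH: "finite H"
    and H: "\<And>e. e \<in> H \<Longrightarrow> length (snd e) = length xs \<and> distinct (snd e)"
    and spP: "sparse g P" and spH: "sparse g' H"
    and cond: "g \<le> g' \<or> g \<le> 2 * g' + 1 \<and> (\<forall>f\<in>P. card (set (snd f) \<inter> set xs) \<le> 1)"
  shows "sparse g (amalg xs H P)"
  unfolding sparse_def
proof (intro allI impI)
  fix S assume S: "S \<subseteq> amalg xs H P" "S \<noteq> {}" "card S \<le> g"
  define rn where "rn e f = (fst f, map (glue xs (snd e)) (snd f))" for e :: "unit \<times> nat list" and f :: "'r \<times> nat list"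
  have am: "amalg xs H P = (\<Union>e\<in>H. rn e ` P)"
    unfolding amalg_def rename_def rn_def case_prod_beta ..
  have finS: "finite S" using finite_subset[OF S(1)] finP finH unfolding am by simp
  have "\<forall>f. \<exists>ep. f \<in> S \<longrightarrow> fst ep \<in> H \<and> snd ep \<in> P \<and> f = rn (fst ep) (snd ep)"
    using S(1) unfolding am by fastforce
  from choice[OF this] obtain EP where EP: "\<forall>f. f \<in> S \<longrightarrow> fst (EP f) \<in> H \<and> snd (EP f) \<in> P \<and> f = rn (fst (EP f)) (snd (EP f))" ..
  define E where "E f = fst (EP f)" for f
  define Q where "Q f = snd (EP f)" for f
  have EQ: "E f \<in> H" "Q f \<in> P" if "f \<in> S" for f
    using EP[rule_format, OF that] by (simp_all add: E_def Q_def)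
  have EQ3: "f = rn (E f) (Q f)" if "f \<in> S" for f
    using EP[rule_format, OF that] by (simp only: E_def Q_def)
  define HS where "HS = E ` S"
  define F where "F e = {f \<in> S. E f = e}" for e
  define W where "W e = Q ` F e" for e
  have finHS: "finite HS" and HSH: "HS \<subseteq> H" using finS EQ by (auto simp: HS_def)
  have injQ: "inj_on Q (F e)" for e
  proof (rule inj_onI)
    fix f f' assume a: "f \<in> F e" "f' \<in> F e" "Q f = Q f'"
    have "f \<in> S" "f' \<in> S" "E f = e" "E f' = e" using a(1,2) by (simp_all add: F_def)
    then have "f = rn e (Q f)" "f' = rn e (Q f')" using EQ3[of f] EQ3[of f'] by argo+
    then show "f = f'" using a(3) by simp
  qed
  have cW: "card (W e) = card (F e)" for e unfolding W_def using injQ by (rule card_image)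
  have lW: "(\<Sum>f\<in>W e. length (snd f)) = (\<Sum>f\<in>F e. length (snd f))" for e
  proof -
    have "(\<Sum>f\<in>W e. length (snd f)) = (\<Sum>f\<in>F e. length (snd (Q f)))"
      unfolding W_def by (simp add: sum.reindex[OF injQ])
    also have "\<dots> = (\<Sum>f\<in>F e. length (snd f))"
    proof (rule sum.cong[OF refl])
      fix f assume "f \<in> F e"
      then have "f = rn (E f) (Q f)" unfolding F_def by (intro EQ3) blast
      then have "length (snd f) = length (snd (rn (E f) (Q f)))" by (rule arg_cong)
      then show "length (snd (Q f)) = length (snd f)" by (simp add: rn_def)
    qed
    finally show ?thesis .
  qed
  have grp: "(\<Sum>f\<in>S. (w f :: nat)) = (\<Sum>e\<in>HS. \<Sum>f\<in>F e. w f)" for w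
    unfolding HS_def F_def by (rule sum.image_gen[OF finS])
  have cS: "card S = (\<Sum>e\<in>HS. card (W e))" using grp[of "\<lambda>_. 1"] by (simp add: cW)
  have lS: "(\<Sum>f\<in>S. length (snd f)) = (\<Sum>e\<in>HS. \<Sum>f\<in>W e. length (snd f))" using grp by (simp add: lW)
  have WP: "W e \<subseteq> P" for e using EQ by (auto simp: W_def F_def)
  have finW: "finite (W e)" for e using WP finP finite_subset by blast
  have Wne: "W e \<noteq> {}" if "e \<in> HS" for e using that by (auto simp: W_def F_def HS_def)
  have cWS: "card (W e) \<le> card S" if "e \<in> HS" for e
    unfolding cW using finS by (intro card_mono) (auto simp: F_def)
  have adS: "adom S = (\<Union>e\<in>HS. glue xs (snd e) ` adom (W e))"
  proof (intro set_eqI iffI)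
    fix x assume "x \<in> adom S"
    then obtain f where f: "f \<in> S" "x \<in> set (snd f)" unfolding adom_iff2 by blast
    have "snd f = map (glue xs (snd (E f))) (snd (Q f))" using arg_cong[OF EQ3[OF f(1)], of snd] by (simp add: rn_def)
    then obtain y where y: "y \<in> set (snd (Q f))" "x = glue xs (snd (E f)) y" using f by auto
    have "Q f \<in> W (E f)" "E f \<in> HS" using f by (auto simp: W_def F_def HS_def)
    then have "y \<in> adom (W (E f))" using y(1) unfolding adom_iff2 by blast
    then show "x \<in> (\<Union>e\<in>HS. glue xs (snd e) ` adom (W e))"
      using \<open>E f \<in> HS\<close> y(2) by (intro UN_I[of "E f"]) simp_all
  next
    fix x assume "x \<in> (\<Union>e\<in>HS. glue xs (snd e) ` adom (W e))"
    then obtain e y where "y \<in> adom (W e)" and xy: "x = glue xs (snd e) y" by blast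
    then obtain f where y: "f \<in> F e" "y \<in> set (snd (Q f))" "x = glue xs (snd e) y"
      unfolding adom_iff2 W_def by blast
    have f: "f \<in> S" "E f = e" using y by (auto simp: F_def)
    have "snd f = map (glue xs (snd (E f))) (snd (Q f))" using arg_cong[OF EQ3[OF f(1)], of snd] by (simp add: rn_def)
    then have "x \<in> set (snd f)" using y(2,3) f(2) by simp
    then show "x \<in> adom S" using f unfolding adom_iff2 by blast
  qed
  \<comment> \<open>The elements of \<open>xs\<close> become vertices of \<open>H\<close>, which
    several copies may share; all others remain private to their copy. The private parts simply add
    up, so only the shared parts need care.\<close>
  define Y where "Y e = adom (W e) \<inter> set xs" for e
  define N where "N e = adom (W e) - set xs" for e
  have finY: "finite (Y e)" and finN: "finite (N e)" for e using finW by (auto simp: Y_def N_def)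
  have cYN: "card (adom (W e)) = card (Y e) + card (N e)" for e
    using card_Un_disjoint[OF finY finN, of e e] by (simp add: Y_def N_def Int_Diff_disjoint Int_Diff_Un)
  define U where "U = (\<Union>e\<in>HS. glue xs (snd e) ` Y e)"
  define V where "V = (\<Union>e\<in>HS. glue xs (snd e) ` N e)"
  have finU: "finite U" and finV: "finite V" using finHS finY finN by (auto simp: U_def V_def)
  have UV: "U \<inter> V = {}" by (auto simp: U_def V_def Y_def N_def glue_def)
  have "adom S = U \<union> V" unfolding adS U_def V_def Y_def N_def by blast
  from arg_cong[OF this, of card] have cad: "card (adom S) = card U + card V"
    using card_Un_disjoint[OF finU finV UV] by (rule trans)
  have "card V = (\<Sum>e\<in>HS. card (glue xs (snd e) ` N e))"
    unfolding V_def
  proof (rule card_UN_disjoint)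
    show "\<forall>i\<in>HS. \<forall>j\<in>HS. i \<noteq> j \<longrightarrow> glue xs (snd i) ` N i \<inter> glue xs (snd j) ` N j = {}"
      by (auto simp: N_def glue_def prod_eq_iff)
  qed (use finHS finN in auto)
  also have "\<dots> = (\<Sum>e\<in>HS. card (N e))"
  proof (rule sum.cong[OF refl])
    fix e assume "e \<in> HS"
    then have "e \<in> H" using HSH by blast
    then have "inj (glue xs (snd e))" using H[of e] by (intro glue_inj) simp_all
    then show "card (glue xs (snd e) ` N e) = card (N e)" by (intro card_image) (rule inj_on_subset, auto)
  qed
  finally have cV: "card V = (\<Sum>e\<in>HS. card (N e))" .
  define T where "T e = sel xs (snd e) ` Y e" for e
  have cT: "card (T e) = card (Y e)" if "e \<in> HS" for e
  proof -
    have "e \<in> H" using that HSH by blast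
    then have "inj_on (sel xs (snd e)) (set xs)" using H[of e] by (intro sel_inj) simp_all
    then show ?thesis unfolding T_def by (intro card_image) (rule inj_on_subset, auto simp: Y_def)
  qed
  have "U = (\<lambda>v. to_nat (Inl v :: nat + nat list \<times> nat)) ` (\<Union>e\<in>HS. T e)"
    unfolding U_def T_def image_UN image_image by (rule SUP_cong[OF refl], rule image_cong[OF refl]) (simp add: Y_def glue_in)
  then have cU: "card U = card (\<Union>e\<in>HS. T e)"
    by (simp add: card_image inj_on_def)
  \<comment> \<open>The incidence graph between copies and shared vertices is a forest as well. A
    copy with at most one shared vertex is a leaf or isolated in it, so sparsity of \<open>H\<close>
    is needed only for the copies in \<open>H2\<close>.\<close>
  have key: "(\<Sum>e\<in>HS. card (Y e)) < card U + card HS"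
  proof -
    define H2 where "H2 = {e \<in> HS. 2 \<le> card (Y e)}"
    have H2: "H2 \<subseteq> HS" "finite H2" using finHS by (auto simp: H2_def)
    have split: "(\<Sum>e\<in>HS. (w e :: nat)) = (\<Sum>e\<in>H2. w e) + (\<Sum>e\<in>HS - H2. w e)" for w
      using sum.subset_diff[OF H2(1) finHS, of w] by simp
    have le1: "(\<Sum>e\<in>HS - H2. card (Y e)) \<le> card (HS - H2)"
    proof -
      have "(\<Sum>e\<in>HS - H2. card (Y e)) \<le> (\<Sum>e\<in>HS - H2. 1)"
      proof (rule sum_mono)
        fix e assume "e \<in> HS - H2"
        then show "card (Y e) \<le> 1" unfolding H2_def mem_Collect_eq Diff_iff by linarith
      qed
      then show ?thesis by simp
    qed
    have cHS: "card HS = card H2 + card (HS - H2)" using split[of "\<lambda>_. 1"] by simp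
    show ?thesis
    proof (cases "H2 = {}")
      case False
      have HScard: "card HS \<le> card S" unfolding HS_def using finS by (rule card_image_le)
      have c2: "card H2 \<le> g'"
      proof (cases "g \<le> g'")
        case True
        then show ?thesis using HScard S(3) cHS by linarith
      next
        case False
        then have g: "g \<le> 2 * g' + 1" and c1: "\<forall>f\<in>P. card (set (snd f) \<inter> set xs) \<le> 1" using cond by auto
        \<comment> \<open>A single fact meets \<open>xs\<close> at most once, so a copy with two
          shared vertices contributes two facts of \<open>S\<close>. Hence
          \<open>2 * card H2\<close> is at most \<open>2 * g' + 1\<close>, and
          \<open>card H2\<close> at most \<open>g'\<close>.\<close>
        have "2 \<le> card (W e)" if "e \<in> H2" for e
        proof (rule ccontr)
          assume "\<not> 2 \<le> card (W e)"
          moreover have "card (W e) > 0" using that H2 Wne[of e] finW[of e] by (auto simp: card_gt_0_iff)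
          ultimately have "card (W e) = 1" by linarith
          then obtain f where f: "W e = {f}" by (auto simp: card_1_singleton_iff)
          then have "Y e = set (snd f) \<inter> set xs" by (simp add: Y_def adom_UN)
          moreover have "f \<in> P" using f WP by blast
          ultimately have "card (Y e) \<le> 1" using c1 by simp
          then show False using that by (simp add: H2_def)
        qed
        then have "(\<Sum>e\<in>H2. 2) \<le> (\<Sum>e\<in>H2. card (W e))" by (rule sum_mono)
        also have "\<dots> \<le> card S" unfolding cS using H2 finHS by (intro sum_mono2) auto
        finally show ?thesis using S(3) g by simp
      qed
      have "(\<Sum>e\<in>H2. card (T e)) < card (\<Union>e\<in>H2. T e) + card H2"
      proof (rule traces_bound[OF finH spH _ False c2])
        show "H2 \<subseteq> H" using H2 HSH by blast
        fix e assume "e \<in> H2"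
        then have "e \<in> H" using H2 HSH by blast
        then show "T e \<subseteq> set (snd e)" unfolding T_def Y_def using H[of e] sel_mem[of _ xs "snd e"] by blast
      qed
      moreover have "card (\<Union>e\<in>H2. T e) \<le> card (\<Union>e\<in>HS. T e)"
        using H2 finHS finY by (intro card_mono) (auto simp: T_def)
      moreover have "(\<Sum>e\<in>H2. card (T e)) = (\<Sum>e\<in>H2. card (Y e))"
        using H2 cT by (intro sum.cong) auto
      ultimately show ?thesis using split[of "\<lambda>e. card (Y e)"] le1 cHS cU by linarith
    next
      case True
      then have le: "(\<Sum>e\<in>HS. card (Y e)) \<le> card HS" using le1 by simp
      have ne: "card HS > 0" using S(2) finHS by (simp add: HS_def card_gt_0_iff)
      show ?thesis
      proof (cases "U = {}")
        case True
        then have "\<forall>e\<in>HS. Y e = {}" by (auto simp: U_def)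
        then show ?thesis using ne by simp
      next
        case False
        then have "card U > 0" using finU by (simp add: card_gt_0_iff)
        then show ?thesis using le by simp
      qed
    qed
  qed
  \<comment> \<open>Strictness of the inequality inside each copy leaves one unit to spare per copy;
    these \<open>card HS\<close> units pay for the identifications bounded in
    \<open>key\<close>.\<close>
  have "(\<Sum>e\<in>HS. (\<Sum>f\<in>W e. length (snd f)) + 1) \<le> (\<Sum>e\<in>HS. card (Y e) + card (N e) + card (W e))"
  proof (rule sum_mono)
    fix e assume e: "e \<in> HS"
    have "(\<Sum>f\<in>W e. length (snd f)) < card (adom (W e)) + card (W e)"
      using spP WP[of e] Wne[OF e] cWS[OF e] S(3) unfolding sparse_def by auto
    then show "(\<Sum>f\<in>W e. length (snd f)) + 1 \<le> card (Y e) + card (N e) + card (W e)" using cYN by simp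
  qed
  then have "(\<Sum>e\<in>HS. \<Sum>f\<in>W e. length (snd f)) + card HS \<le>
      (\<Sum>e\<in>HS. card (Y e)) + (\<Sum>e\<in>HS. card (N e)) + (\<Sum>e\<in>HS. card (W e))"
    unfolding sum.distrib by simp
  then show "(\<Sum>f\<in>S. length (snd f)) < card (adom S) + card S"
    using key cad cV cS lS by linarith
qed

text \<open>Existence of \<open>s\<close>-uniform hypergraphs of large girth and chromatic number
  above \<open>k\<close>. They are encoded as instances over the one symbol of type
  \<open>unit\<close>, so that \<open>sparse\<close> and the partite construction apply to
  them.\<close>

definition mono_hyp :: "nat \<Rightarrow> nat \<Rightarrow> nat \<Rightarrow> bool" where
  "mono_hyp k s g \<longleftrightarrow> (\<exists>H :: unit inst. finite H \<and> (\<forall>e\<in>H. length (snd e) = s \<and> distinct (snd e)) \<and> sparse g H \<and>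
     (\<forall>c. (\<forall>x. c x < k) \<longrightarrow> (\<exists>e\<in>H. \<exists>\<kappa>::nat. \<forall>y\<in>set (snd e). c y = \<kappa>)))"

text \<open>\<open>Z\<close> is the set of elements of \<open>A\<close> whose fibres have already been made monochromatic.\<close>

definition partite :: "nat \<Rightarrow> nat \<Rightarrow> 'r inst \<Rightarrow> nat set \<Rightarrow> 'r inst \<Rightarrow> (nat \<Rightarrow> nat) \<Rightarrow> bool" where
  "partite g k A Z P \<pi> \<longleftrightarrow> finite P \<and> hom \<pi> P A \<and> sparse g P \<and>
     (\<forall>c. (\<forall>x. c x < k) \<longrightarrow> (\<exists>h. (\<forall>x. h x < k) \<and> (\<forall>R t. (R, t) \<in> A \<longrightarrow>
        (\<exists>t'. (R, t') \<in> P \<and> map \<pi> t' = t \<and> (\<forall>i<length t. t ! i \<in> Z \<longrightarrow> c (t' ! i) = h (t ! i))))))"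

lemma partiteD:
  assumes "partite g k A Z P \<pi>" "\<forall>x. c x < k"
  obtains h where "\<forall>x. h x < k" "\<And>R t. (R, t) \<in> A \<Longrightarrow> \<exists>t'. (R, t') \<in> P \<and> map \<pi> t' = t \<and>
     (\<forall>i<length t. t ! i \<in> Z \<longrightarrow> c (t' ! i) = h (t ! i))"
proof -
  have "\<exists>h. (\<forall>x. h x < k) \<and> (\<forall>R t. (R, t) \<in> A \<longrightarrow>
        (\<exists>t'. (R, t') \<in> P \<and> map \<pi> t' = t \<and> (\<forall>i<length t. t ! i \<in> Z \<longrightarrow> c (t' ! i) = h (t ! i))))"
    using assms(1)[unfolded partite_def, THEN conjunct2, THEN conjunct2, THEN conjunct2, rule_format, of c] assms(2)
    by blast
  then show thesis using that by blast
qed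

text \<open>Every fact is replaced by a copy on fresh elements, one for each position, so that even
  repeated elements are pulled apart. No fibre has been treated, so any colouring may serve as
  \<open>h\<close>.\<close>

lemma partite_start:
  fixes A :: "'r inst"
  assumes fin: "finite A"
  shows "\<exists>P \<pi>. partite g k A {} P \<pi>"
proof -
  obtain num :: "'r \<times> nat list \<Rightarrow> nat" where num: "inj_on num A"
    using finite_imp_inj_to_nat_seg[OF fin] by blast
  define cp where "cp f = (fst f, map (\<lambda>i. prod_encode (num f, i)) [0..<length (snd f)])" for f
  define \<pi> where "\<pi> z = snd (inv_into A num (fst (prod_decode z))) ! snd (prod_decode z)" for z
  have \<pi>: "map \<pi> (snd (cp f)) = snd f" if "f \<in> A" for f
    using that num by (intro nth_equalityI) (auto simp: cp_def \<pi>_def)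
  have "partite g k A {} (cp ` A) \<pi>"
    unfolding partite_def
  proof (intro conjI allI impI)
    show "finite (cp ` A)" using fin by simp
    show "hom \<pi> (cp ` A) A" unfolding hom_def
    proof (intro allI impI)
      fix R t assume "(R, t) \<in> cp ` A"
      then obtain f where f: "f \<in> A" "(R, t) = cp f" by blast
      then have "R = fst f" "t = snd (cp f)" by (simp_all add: cp_def)
      then show "(R, map \<pi> t) \<in> A" using \<pi>[OF f(1)] f(1) by simp
    qed
    show "sparse g (cp ` A)"
    proof (rule sparse_if_disjoint)
      show "finite (cp ` A)" using fin by simp
      show "distinct (snd f)" if "f \<in> cp ` A" for f
        using that by (auto simp: cp_def distinct_map inj_on_def)
      show "set (snd f) \<inter> set (snd f') = {}" if "f \<in> cp ` A" "f' \<in> cp ` A" "f \<noteq> f'" for f f'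
      proof -
        obtain a b where ab: "f = cp a" "f' = cp b" "a \<in> A" "b \<in> A" "a \<noteq> b" using \<open>f \<in> cp ` A\<close> \<open>f' \<in> cp ` A\<close> \<open>f \<noteq> f'\<close> by blast
        then have "num a \<noteq> num b" using num by (auto dest: inj_onD)
        then show ?thesis unfolding ab by (auto simp: cp_def)
      qed
    qed
    fix c :: "nat \<Rightarrow> nat" assume "\<forall>x. c x < k"
    then show "\<exists>h. (\<forall>x. h x < k) \<and> (\<forall>R t. (R, t) \<in> A \<longrightarrow> (\<exists>t'. (R, t') \<in> cp ` A \<and> map \<pi> t' = t \<and>
            (\<forall>i<length t. t ! i \<in> {} \<longrightarrow> c (t' ! i) = h (t ! i))))"
    proof (intro exI[of _ c] conjI allI impI)
      fix R t assume a: "(R, t) \<in> A"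
      have "(R, snd (cp (R, t))) = cp (R, t)" by (simp add: cp_def)
      then show "\<exists>t'. (R, t') \<in> cp ` A \<and> map \<pi> t' = t \<and>
            (\<forall>i<length t. t ! i \<in> {} \<longrightarrow> c (t' ! i) = c (t ! i))"
        using a \<pi>[OF a] by (intro exI[of _ "snd (cp (R, t))"]) auto
    qed auto
  qed
  then show ?thesis by blast
qed

lemma partite_step:
  fixes A :: "'r inst"
  assumes P: "partite g k A Z P \<pi>" and hyp: "\<And>s. mono_hyp k s g'"
    and cond: "g \<le> g' \<or> g \<le> 2 * g' + 1 \<and> (\<forall>f\<in>A. distinct (snd f))"
  shows "\<exists>P' \<pi>'. partite g k A (insert x Z) P' \<pi>'"
proof -
  have finP: "finite P" and homP: "hom \<pi> P A" and spP: "sparse g P" using P by (auto simp: partite_def)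
  define X where "X = {y \<in> adom P. \<pi> y = x}"
  have finX: "finite X" using finP by (simp add: X_def)
  define xs where "xs = sorted_list_of_set X"
  have xs: "set xs = X" using finX by (simp add: xs_def)
  obtain H :: "unit inst" where finH: "finite H" and H: "\<And>e. e \<in> H \<Longrightarrow> length (snd e) = length xs \<and> distinct (snd e)"
    and spH: "sparse g' H"
    and mono: "\<And>c. \<forall>x. c x < k \<Longrightarrow> \<exists>e\<in>H. \<exists>\<kappa>::nat. \<forall>y\<in>set (snd e). c y = \<kappa>"
    using hyp[of "length xs"] unfolding mono_hyp_def by blast
  define \<pi>' where "\<pi>' z = (case (from_nat z :: nat + nat list \<times> nat) of Inl _ \<Rightarrow> x | Inr p \<Rightarrow> \<pi> (snd p))" for z
  have \<pi>': "\<pi>' (glue xs e y) = \<pi> y" if "y \<in> adom P" for e y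
    using that by (simp add: \<pi>'_def glue_def xs X_def)
  have map\<pi>': "map \<pi>' (map (glue xs e) s) = map \<pi> s" if "(R, s) \<in> P" for R e s
    using that \<pi>' in_adom[OF that] by simp
  have "partite g k A (insert x Z) (amalg xs H P) \<pi>'"
    unfolding partite_def
  proof (intro conjI allI impI)
    show "finite (amalg xs H P)" using finH finP by (simp add: amalg_def)
    show "hom \<pi>' (amalg xs H P) A" unfolding hom_def
    proof (intro allI impI)
      fix R t assume "(R, t) \<in> amalg xs H P"
      then obtain e s where "(R, s) \<in> P" "t = map (glue xs e) s" by (auto simp: amalg_def rename_iff)
      then show "(R, map \<pi>' t) \<in> A" using map\<pi>'[of R s e] homP unfolding hom_def by metis
    qed
    show "sparse g (amalg xs H P)"
    proof (rule amalg_sparse[OF finP finH H spP spH])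
      \<comment> \<open>The image of \<open>f\<close> in \<open>A\<close> repeats no element, so the
        projection is injective on \<open>f\<close>, which therefore meets the fibre over
        \<open>x\<close> at most once.\<close>
      have "card (set (snd f) \<inter> set xs) \<le> 1" if d: "\<forall>f\<in>A. distinct (snd f)" and f: "f \<in> P" for f
      proof -
        have "(fst f, map \<pi> (snd f)) \<in> A" using homP f by (simp add: hom_def)
        then have "distinct (map \<pi> (snd f))" using d by fastforce
        then have inj: "inj_on \<pi> (set (snd f))" by (simp add: distinct_map)
        have "set (snd f) \<inter> set xs \<subseteq> {SOME y. y \<in> set (snd f) \<inter> set xs}"
        proof
          fix y assume y: "y \<in> set (snd f) \<inter> set xs"
          then have "(SOME y. y \<in> set (snd f) \<inter> set xs) \<in> set (snd f) \<inter> set xs" by (rule someI)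
          then show "y \<in> {SOME y. y \<in> set (snd f) \<inter> set xs}" using y inj unfolding xs X_def inj_on_def by simp
        qed
        from card_mono[OF _ this] show ?thesis by simp
      qed
      then show "g \<le> g' \<or> g \<le> 2 * g' + 1 \<and> (\<forall>f\<in>P. card (set (snd f) \<inter> set xs) \<le> 1)" using cond by blast
    qed auto
    fix c :: "nat \<Rightarrow> nat" assume c: "\<forall>x. c x < k"
    \<comment> \<open>The colouring is used twice: on the vertices of \<open>H\<close> it yields a
      monochromatic hyperedge \<open>e\<close>, and pulled back to the copy of \<open>P\<close>
      along \<open>e\<close> it is fed into the property of \<open>P\<close>. On that copy the fibre
      over \<open>x\<close> has the single colour \<kappa>.\<close>
    have "\<forall>v. c (to_nat (Inl v :: nat + nat list \<times> nat)) < k" using c by blast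
    from mono[OF this] obtain e \<kappa> where e: "e \<in> H" and \<kappa>: "\<And>v. v \<in> set (snd e) \<Longrightarrow> c (to_nat (Inl v :: nat + nat list \<times> nat)) = \<kappa>"
      by blast
    have "\<forall>y. c (glue xs (snd e) y) < k" using c by blast
    from partiteD[OF P this] obtain h where hk: "\<forall>x. h x < k"
      and h: "\<And>R t. (R, t) \<in> A \<Longrightarrow> \<exists>t'. (R, t') \<in> P \<and> map \<pi> t' = t \<and>
        (\<forall>i<length t. t ! i \<in> Z \<longrightarrow> c (glue xs (snd e) (t' ! i)) = h (t ! i))" by blast
    \<comment> \<open>If the fibre is empty, the hyperedges are empty and \<kappa> need not be a
      colour below \<open>k\<close>; then \<open>h\<close> can be kept, as no lifted fact has an
      element over \<open>x\<close>.\<close>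
    define h' where "h' = (if X = {} then h else h(x := \<kappa>))"
    have col: "c (glue xs (snd e) y) = \<kappa>" if "y \<in> X" for y
      using that \<kappa> sel_mem[of y xs "snd e"] H[OF e] by (simp add: glue_in xs)
    have h'k: "h' z < k" for z
    proof (cases "X = {}")
      case False
      then obtain y where "y \<in> X" by blast
      then have "\<kappa> < k" using col c by metis
      then show ?thesis using hk by (simp add: h'_def)
    qed (simp add: h'_def hk)
    show "\<exists>h. (\<forall>x. h x < k) \<and> (\<forall>R t. (R, t) \<in> A \<longrightarrow> (\<exists>t'. (R, t') \<in> amalg xs H P \<and> map \<pi>' t' = t \<and>
            (\<forall>i<length t. t ! i \<in> insert x Z \<longrightarrow> c (t' ! i) = h (t ! i))))"
    proof (intro exI[of _ h'] conjI allI impI h'k)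
      fix R t assume "(R, t) \<in> A"
      from h[OF this] obtain s where s: "(R, s) \<in> P" "map \<pi> s = t"
        "\<And>i. i<length t \<Longrightarrow> t ! i \<in> Z \<Longrightarrow> c (glue xs (snd e) (s ! i)) = h (t ! i)" by blast
      show "\<exists>t'. (R, t') \<in> amalg xs H P \<and> map \<pi>' t' = t \<and>
            (\<forall>i<length t. t ! i \<in> insert x Z \<longrightarrow> c (t' ! i) = h' (t ! i))"
      proof (intro exI[of _ "map (glue xs (snd e)) s"] conjI allI impI)
        show "(R, map (glue xs (snd e)) s) \<in> amalg xs H P" using e s(1) by (auto simp: amalg_def rename_iff)
        show "map \<pi>' (map (glue xs (snd e)) s) = t" using map\<pi>'[OF s(1)] s(2) by simp
        fix i assume i: "i < length t" "t ! i \<in> insert x Z"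
        have ls: "length s = length t" using s(2) by auto
        have ti: "\<pi> (s ! i) = t ! i" using s(2) i ls by (metis nth_map)
        have sP: "s ! i \<in> adom P" using in_adom[OF s(1)] i ls by simp
        show "c (map (glue xs (snd e)) s ! i) = h' (t ! i)"
        proof (cases "t ! i = x")
          case True
          then have "s ! i \<in> X" using ti sP by (simp add: X_def)
          then show ?thesis using col[of "s ! i"] True i ls by (auto simp: h'_def)
        next
          case False
          then show ?thesis using s(3)[of i] i ls by (auto simp: h'_def)
        qed
      qed
    qed
  qed
  then show ?thesis by blast
qed

lemma partite_exists:
  assumes fin: "finite A" and hyp: "\<And>s. mono_hyp k s g'"
    and cond: "g \<le> g' \<or> g \<le> 2 * g' + 1 \<and> (\<forall>f\<in>A. distinct (snd f))"
  shows "\<exists>P \<pi>. partite g k A (adom A) P \<pi>"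
proof -
  have "\<exists>P \<pi>. partite g k A Z P \<pi>" if "finite Z" for Z
    using that
  proof (induction Z rule: finite_induct)
    case empty then show ?case by (rule partite_start[OF fin])
  next
    case (insert x Z) then show ?case using partite_step[OF _ hyp cond] by blast
  qed
  then show ?thesis using fin by simp
qed

section \<open>Hypergraphs of large girth and large chromatic number\<close>

text \<open>Among \<open>s * k + 1\<close> vertices with \<open>k\<close> colours some colour class
  has at least \<open>s\<close> vertices, which form a hyperedge.\<close>

definition complete_hyp :: "nat \<Rightarrow> nat \<Rightarrow> unit inst" where
  "complete_hyp k s = {e. distinct (snd e) \<and> length (snd e) = s \<and> set (snd e) \<subseteq> {..<s * k + 1}}"

lemma finite_complete_hyp: "finite (complete_hyp k s)"
proof -
  have "complete_hyp k s \<subseteq> Pair () ` {e. set e \<subseteq> {..<s * k + 1} \<and> length e = s}"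
    by (auto simp: complete_hyp_def)
  then show ?thesis by (rule finite_subset) (simp add: finite_lists_length_eq)
qed

lemma complete_hyp_mono:
  assumes "\<forall>x. h x < k"
  shows "\<exists>e\<in>complete_hyp k s. \<exists>\<kappa>::nat. \<forall>y\<in>set (snd e). h y = \<kappa>"
proof -
  define K where "K \<kappa> = {v \<in> {..<s * k + 1}. h v = \<kappa>}" for \<kappa>
  have "\<exists>\<kappa><k. s \<le> card (K \<kappa>)"
  proof (rule ccontr)
    assume "\<not> ?thesis"
    then have "(\<Sum>\<kappa><k. card (K \<kappa>)) \<le> (\<Sum>\<kappa><k. s)" by (intro sum_mono) auto
    moreover have "(\<Sum>\<kappa><k. card (K \<kappa>)) = card (\<Union>\<kappa><k. K \<kappa>)"
      by (rule card_UN_disjoint[symmetric]) (auto simp: K_def)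
    moreover have "(\<Union>\<kappa><k. K \<kappa>) = {..<s * k + 1}" using assms by (auto simp: K_def)
    ultimately show False by simp
  qed
  then obtain \<kappa> where \<kappa>: "s \<le> card (K \<kappa>)" by blast
  then obtain T where T: "T \<subseteq> K \<kappa>" "card T = s" "finite T" by (meson obtain_subset_with_card_n)
  then obtain e where "set e = T" "distinct e" using finite_distinct_list by blast
  then have "((), e) \<in> complete_hyp k s" "\<forall>y\<in>set e. h y = \<kappa>"
    using T distinct_card[of e] by (auto simp: complete_hyp_def K_def)
  then show ?thesis by (intro bexI[of _ "((), e)"] exI[of _ \<kappa>]) simp_all
qed

text \<open>Hypergraphs of girth parameter \<open>g\<close> serve as gluing patterns for a partite
  construction over the complete hypergraph, not over one of girth \<open>g\<close>. The hyperedges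
  below repeat no vertex, so the result is \<open>2 * g + 1\<close>-sparse, enough for
  \<open>Suc g\<close>. A colouring above induces one below, whose monochromatic hyperedge has a
  lift of the same colour. For \<open>g = 0\<close> sparsity is vacuous.\<close>

lemma mono_hyp: "mono_hyp k s g"
proof (induction g arbitrary: s)
  case 0
  have "sparse 0 (complete_hyp k s)"
    unfolding sparse_def
  proof (intro allI impI)
    fix S assume S: "S \<subseteq> complete_hyp k s" "S \<noteq> {}" "card S \<le> 0"
    have "finite S" using S(1) finite_complete_hyp by (rule finite_subset)
    then show "(\<Sum>f\<in>S. length (snd f)) < card (adom S) + card S" using S by simp
  qed
  moreover have "length (snd e) = s \<and> distinct (snd e)" if "e \<in> complete_hyp k s" for e
    using that unfolding complete_hyp_def by blast
  ultimately show ?case unfolding mono_hyp_def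
    by (intro exI[of _ "complete_hyp k s"] conjI finite_complete_hyp allI impI ballI complete_hyp_mono) blast+
next
  case (Suc g)
  let ?K = "complete_hyp k s"
  have "\<forall>f\<in>?K. distinct (snd f)" unfolding complete_hyp_def by blast
  then have "\<exists>P \<pi>. partite (Suc g) k ?K (adom ?K) P \<pi>"
    by (intro partite_exists[OF finite_complete_hyp Suc.IH] disjI2 conjI) simp_all
  then obtain P \<pi> where P: "partite (Suc g) k ?K (adom ?K) P \<pi>" by blast
  show ?case unfolding mono_hyp_def
  proof (intro exI[of _ P] conjI ballI allI impI)
    show "finite P" "sparse (Suc g) P" using P by (auto simp: partite_def)
  next
    fix e assume "e \<in> P"
    moreover have "hom \<pi> P ?K" using P by (simp add: partite_def)
    ultimately have "(fst e, map \<pi> (snd e)) \<in> ?K" using hom_fact by blast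
    then have "length (map \<pi> (snd e)) = s" "distinct (map \<pi> (snd e))" unfolding complete_hyp_def by simp_all
    then show "length (snd e) = s" "distinct (snd e)" by (simp_all add: distinct_map)
  next
    fix c :: "nat \<Rightarrow> nat" assume c: "\<forall>x. c x < k"
    from partiteD[OF P c] obtain h where hk: "\<forall>x. h x < k"
      and h: "\<And>R t. (R, t) \<in> ?K \<Longrightarrow> \<exists>t'. (R, t') \<in> P \<and> map \<pi> t' = t \<and>
        (\<forall>i<length t. t ! i \<in> adom ?K \<longrightarrow> c (t' ! i) = h (t ! i))" by blast
    obtain e0 \<kappa> where e0: "e0 \<in> ?K" "\<forall>y\<in>set (snd e0). h y = \<kappa>" using complete_hyp_mono[OF hk] by blast
    obtain e where "e0 = ((), e)" by (cases e0) simp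
    then have e: "((), e) \<in> ?K" "\<forall>y\<in>set e. h y = \<kappa>" using e0 by simp_all
    from h[OF e(1)] obtain t' where t': "((), t') \<in> P" "map \<pi> t' = e"
      "\<forall>i<length e. e ! i \<in> adom ?K \<longrightarrow> c (t' ! i) = h (e ! i)" by blast
    have "c y = \<kappa>" if "y \<in> set t'" for y
    proof -
      from that obtain i where i: "i < length t'" "y = t' ! i" by (auto simp: in_set_conv_nth)
      have l: "length t' = length e" using t'(2) by (metis length_map)
      have "e ! i \<in> adom ?K" using in_adom[OF e(1)] i l by simp
      then show ?thesis using t'(3) i l e(2) by simp
    qed
    then show "\<exists>e\<in>P. \<exists>\<kappa>. \<forall>y\<in>set (snd e). c y = \<kappa>" using t'(1) by (intro bexI[of _ "((), t')"] exI[of _ \<kappa>]) simp_all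
  qed
qed

text \<open>A homomorphism from \<open>P\<close> to \<open>G\<close> is a colouring of
  \<open>P\<close> by elements of \<open>G\<close>. The colouring \<open>h\<close> of
  \<open>A\<close> that it induces is a homomorphism, since each fact of \<open>A\<close> has a lift
  with the same colours. Facts of \<open>A\<close> may repeat elements, so the gluing hypergraphs
  need the full girth here.\<close>

theorem sparse_incomparability:
  assumes A: "A \<in> insts sig ar" and fG: "finite \<G>" "\<And>G. G \<in> \<G> \<Longrightarrow> finite G"
  obtains A' where "A' \<in> insts sig ar" "sparse g A'" "hom_ex A' A" "\<And>G. G \<in> \<G> \<Longrightarrow> hom_ex A' G \<Longrightarrow> hom_ex A G"
proof -
  have "finite (\<Union>G\<in>\<G>. adom G)" using fG by auto
  then obtain k0 where k0: "\<And>G v. G \<in> \<G> \<Longrightarrow> v \<in> adom G \<Longrightarrow> v < k0"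
    unfolding finite_nat_set_iff_bounded by blast
  \<comment> \<open>Elements outside \<open>adom P\<close> receive colour 0, which must be a legal
    colour even if all targets are empty; hence the \<open>Suc\<close>.\<close>
  define k where "k = Suc k0"
  obtain P \<pi> where P: "partite g k A (adom A) P \<pi>"
    using partite_exists[OF inst_finite[OF A] mono_hyp, of g g k] by blast
  have fin: "finite P" and homP: "hom \<pi> P A" using P by (auto simp: partite_def)
  show thesis
  proof (rule that)
    show "P \<in> insts sig ar" using inst_hom[OF homP A fin] .
    show "sparse g P" using P by (simp add: partite_def)
    show "hom_ex P A" using homP by (auto simp: hom_ex_iff)
    fix G assume G: "G \<in> \<G>" "hom_ex P G"
    then obtain f where f: "hom f P G" by (auto simp: hom_ex_iff)
    define c where "c y = (if y \<in> adom P then f y else 0)" for y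
    have "\<forall>y. c y < k"
    proof
      fix y show "c y < k" using hom_adom[OF f, of y] k0[OF G(1), of "f y"] by (auto simp: c_def k_def)
    qed
    from partiteD[OF P this] obtain h where h: "\<And>R t. (R, t) \<in> A \<Longrightarrow> \<exists>t'. (R, t') \<in> P \<and> map \<pi> t' = t \<and>
        (\<forall>i<length t. t ! i \<in> adom A \<longrightarrow> c (t' ! i) = h (t ! i))" by metis
    have "hom h A G" unfolding hom_def
    proof (intro allI impI)
      fix R t assume t: "(R, t) \<in> A"
      from h[OF t] obtain t' where t': "(R, t') \<in> P" "map \<pi> t' = t"
        "\<forall>i<length t. t ! i \<in> adom A \<longrightarrow> c (t' ! i) = h (t ! i)" by blast
      have "map h t = map f t'"
      proof (rule nth_equalityI)
        show "length (map h t) = length (map f t')" using t'(2) by auto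
        fix i assume "i < length (map h t)"
        then have i: "i < length t" "i < length t'" using t'(2) by auto
        have "t ! i \<in> adom A" "t' ! i \<in> adom P" using in_adom[OF t] in_adom[OF t'(1)] i by auto
        then have "c (t' ! i) = h (t ! i)" "c (t' ! i) = f (t' ! i)" using t'(3) i by (auto simp: c_def)
        then show "map h t ! i = map f t' ! i" using i by simp
      qed
      moreover have "(R, map f t') \<in> G" using f t'(1) by (simp add: hom_def)
      ultimately show "(R, map h t) \<in> G" by simp
    qed
    then show "hom_ex A G" by (auto simp: hom_ex_iff)
  qed
qed

section \<open>Tree duality\<close>

lemma nth_adom: "f \<in> A \<Longrightarrow> i < length (snd f) \<Longrightarrow> snd f ! i \<in> adom A"
  using nth_mem[of i "snd f"] unfolding adom_iff2 by blast

inductive tree :: "nat \<Rightarrow> 'r inst \<Rightarrow> bool" where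
  single: "distinct (snd f) \<Longrightarrow> r \<in> set (snd f) \<Longrightarrow> tree r {f}"
| insert: "tree r S \<Longrightarrow> f \<notin> S \<Longrightarrow> distinct (snd f) \<Longrightarrow> set (snd f) \<inter> adom S = {x} \<Longrightarrow> tree r (insert f S)"

text \<open>Equality in the inequality behind \<open>sparse\<close>: a tree has one node more than
  edges. \<open>tree_dual\<close> needs the exact number.\<close>

lemma tree_count:
  "tree r S \<Longrightarrow> finite S \<and> r \<in> adom S \<and> card (adom S) + card S = 1 + (\<Sum>f\<in>S. length (snd f))"
proof (induction rule: tree.induct)
  case (single f r)
  then show ?case by (simp add: adom_insert distinct_card)
next
  case (insert r S f x)
  have "card (set (snd f) \<union> adom S) + card (set (snd f) \<inter> adom S) = card (set (snd f)) + card (adom S)"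
    using insert by (intro card_Un_Int[symmetric]) auto
  then have "card (adom (insert f S)) + 1 = length (snd f) + card (adom S)"
    using insert by (simp add: adom_insert distinct_card)
  then show ?case using insert by (simp add: adom_insert)
qed

lemma forest_trees:
  "forest S \<Longrightarrow> (\<And>f. f \<in> S \<Longrightarrow> snd f \<noteq> []) \<Longrightarrow>
    \<exists>\<T>. finite \<T> \<and> \<Union>\<T> = S \<and> (\<forall>T\<in>\<T>. \<exists>r. tree r T) \<and>
      (\<forall>T\<in>\<T>. \<forall>T'\<in>\<T>. T \<noteq> T' \<longrightarrow> adom T \<inter> adom T' = {})"
proof (induction rule: forest.induct)
  case empty
  then show ?case by (intro exI[of _ "{}"]) simp
next
  case (insert S f)
  have "\<exists>\<T>. finite \<T> \<and> \<Union>\<T> = S \<and> (\<forall>T\<in>\<T>. \<exists>r. tree r T) \<and>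
      (\<forall>T\<in>\<T>. \<forall>T'\<in>\<T>. T \<noteq> T' \<longrightarrow> adom T \<inter> adom T' = {})"
    by (rule insert.IH, rule insert.prems) simp
  then obtain \<T> where T0: "finite \<T> \<and> \<Union>\<T> = S \<and> (\<forall>T\<in>\<T>. \<exists>r. tree r T) \<and>
      (\<forall>T\<in>\<T>. \<forall>T'\<in>\<T>. T \<noteq> T' \<longrightarrow> adom T \<inter> adom T' = {})" ..
  have T: "finite \<T>" "\<Union>\<T> = S" using T0 by simp_all
  have T3: "\<exists>r. tree r T" if "T \<in> \<T>" for T using T0 that by blast
  have T4: "adom T \<inter> adom T' = {}" if "T \<in> \<T>" "T' \<in> \<T>" "T \<noteq> T'" for T T'
    using T0[THEN conjunct2, THEN conjunct2, THEN conjunct2, rule_format, OF that] .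
  have TS: "adom T \<subseteq> adom S" if "T \<in> \<T>" for T using that T(2) by (intro adom_mono) blast
  show ?case
  proof (cases "set (snd f) \<inter> adom S = {}")
    case True
    have "tree (hd (snd f)) {f}" using insert.hyps insert.prems[of f] by (intro tree.single) auto
    then have tr: "\<exists>r. tree r {f}" ..
    have dis: "adom {f} \<inter> adom T = {}" "adom T \<inter> adom {f} = {}" if "T \<in> \<T>" for T
      using True TS[OF that] by (auto simp: adom_insert)
    show ?thesis
    proof (intro exI[of _ "insert {f} \<T>"] conjI ballI impI)
      show "finite (insert {f} \<T>)" using T(1) by simp
      show "\<Union>(insert {f} \<T>) = insert f S" using T(2) by simp
      show "\<exists>r. tree r U" if "U \<in> insert {f} \<T>" for U using that tr T3 by blast
      show "adom U \<inter> adom U' = {}" if "U \<in> insert {f} \<T>" "U' \<in> insert {f} \<T>" "U \<noteq> U'" for U U'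
      proof (cases "U = {f}")
        case True
        then have "U' \<in> \<T>" using that by blast
        then show ?thesis unfolding True by (rule dis)
      next
        case False
        then have U: "U \<in> \<T>" using that by blast
        show ?thesis
        proof (cases "U' = {f}")
          case True
          show ?thesis unfolding True using U by (rule dis)
        next
          case False
          then have "U' \<in> \<T>" using that by blast
          then show ?thesis using U that(3) by (intro T4)
        qed
      qed
    qed
  next
    case False
    then obtain x where x: "x \<in> set (snd f)" "x \<in> adom S" by blast
    then obtain g where g: "g \<in> S" "x \<in> set (snd g)" unfolding adom_iff2 by blast
    have "card (set (snd f) \<inter> adom S) \<noteq> 0" using False by simp
    then have "card (set (snd f) \<inter> adom S) = 1" using insert.hyps(4) by linarith
    then obtain y where "set (snd f) \<inter> adom S = {y}" by (rule card_1_singletonE)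
    moreover have "x \<in> set (snd f) \<inter> adom S" using x by simp
    ultimately have I: "set (snd f) \<inter> adom S = {x}" by (simp only: singleton_iff)
    obtain T where "T \<in> \<T>" "g \<in> T" using g(1) T(2) by blast
    then have TT: "T \<in> \<T>" "x \<in> adom T" using g(2) unfolding adom_iff2 by blast+
    obtain r where "tree r T" using T3[OF TT(1)] by blast
    moreover have "set (snd f) \<inter> adom T = {x}" using I TS[OF TT(1)] TT(2) by blast
    moreover have "f \<notin> T" using T(2) TT(1) insert.hyps(2) by blast
    ultimately have tr: "tree r (insert f T)" using insert.hyps(3) by (intro tree.insert)
    have dis: "adom (insert f T) \<inter> adom T' = {}" "adom T' \<inter> adom (insert f T) = {}" if "T' \<in> \<T>" "T' \<noteq> T" for T'
    proof -
      have "set (snd f) \<inter> adom T' \<subseteq> {x}" using I TS[OF that(1)] by blast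
      moreover have "adom T \<inter> adom T' = {}" using T4[OF TT(1) that(1) that(2)[symmetric]] .
      moreover from this have "x \<notin> adom T'" using TT(2) by blast
      ultimately show "adom (insert f T) \<inter> adom T' = {}" unfolding adom_insert Int_Un_distrib2 by auto
      then show "adom T' \<inter> adom (insert f T) = {}" by (simp only: Int_commute)
    qed
    show ?thesis
    proof (intro exI[of _ "insert (insert f T) (\<T> - {T})"] conjI ballI impI)
      show "finite (insert (insert f T) (\<T> - {T}))" using T(1) by simp
      show "\<Union>(insert (insert f T) (\<T> - {T})) = insert f S" using T(2) TT(1) by blast
      show "\<exists>r. tree r U" if "U \<in> insert (insert f T) (\<T> - {T})" for U using that tr T3 by blast
      show "adom U \<inter> adom U' = {}"
        if U: "U \<in> insert (insert f T) (\<T> - {T})" "U' \<in> insert (insert f T) (\<T> - {T})" "U \<noteq> U'" for U U'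
      proof -
        from U(1) consider "U = insert f T" | "U \<in> \<T>" "U \<noteq> T" by blast
        then show ?thesis
        proof cases
          case 1
          then have "U' \<in> \<T>" "U' \<noteq> T" using U(2,3) by simp_all
          then show ?thesis unfolding 1 by (rule dis)
        next
          case 2
          from U(2) consider "U' = insert f T" | "U' \<in> \<T>" by blast
          then show ?thesis
          proof cases
            case 1
            show ?thesis unfolding 1 using 2 by (rule dis)
          next
            case 2
            show ?thesis using \<open>U \<in> \<T>\<close> 2 U(3) by (rule T4)
          qed
        qed
      qed
    qed
  qed
qed

lemma hom_ex_disjoint_Union:
  assumes dis: "\<And>T T'. T \<in> \<T> \<Longrightarrow> T' \<in> \<T> \<Longrightarrow> T \<noteq> T' \<Longrightarrow> adom T \<inter> adom T' = {}"
  shows "hom_ex (\<Union>\<T>) A \<longleftrightarrow> (\<forall>T\<in>\<T>. hom_ex T A)"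
proof
  assume "hom_ex (\<Union>\<T>) A"
  then show "\<forall>T\<in>\<T>. hom_ex T A" using hom_ex_trans[OF hom_ex_subset] by blast
next
  assume "\<forall>T\<in>\<T>. hom_ex T A"
  then have "\<forall>T. \<exists>h. T \<in> \<T> \<longrightarrow> hom h T A" by (auto simp: hom_ex_iff)
  from choice[OF this] obtain h where h: "\<And>T. T \<in> \<T> \<Longrightarrow> hom (h T) T A" by blast
  define k where "k x = h (THE T. T \<in> \<T> \<and> x \<in> adom T) x" for x
  have "hom k (\<Union>\<T>) A" unfolding hom_def
  proof (intro allI impI)
    fix R t assume "(R, t) \<in> \<Union>\<T>"
    then obtain T where T: "T \<in> \<T>" "(R, t) \<in> T" by blast
    have "k x = h T x" if "x \<in> set t" for x
    proof -
      have "x \<in> adom T" using in_adom[OF T(2) that] .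
      then have "(THE T. T \<in> \<T> \<and> x \<in> adom T) = T" using T(1) dis by (intro the_equality) blast+
      then show ?thesis by (simp add: k_def)
    qed
    then have "map k t = map (h T) t" by simp
    moreover have "(R, map (h T) t) \<in> A" using h[OF T(1)] T(2) by (simp add: hom_def)
    ultimately show "(R, map k t) \<in> A" by argo
  qed
  then show "hom_ex (\<Union>\<T>) A" by (auto simp: hom_ex_iff)
qed

lemma ex_map_eq:
  fixes xs :: "nat list" and ys :: "nat list"
  shows "length xs = length ys \<Longrightarrow> distinct xs \<Longrightarrow> \<exists>h. map h xs = ys"
proof (induction xs ys rule: list_induct2)
  case (Cons x xs y ys)
  then obtain h where "map h xs = ys" by auto
  then have "map (h(x := y)) (x # xs) = y # ys" using Cons.prems by auto
  then show ?case by (intro exI[of _ "h(x := y)"])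
qed simp

text \<open>In a rooted tree, \<open>att f\<close> is the position at which the fact \<open>f\<close> is attached to its parent element.
  The greatest closed relation then relates \<open>u\<close> to the images of \<open>u\<close> under homomorphisms of the
  subtree below \<open>u\<close>.\<close>

definition locally_ok :: "('r \<times> nat list \<Rightarrow> nat) \<Rightarrow> 'r inst \<Rightarrow> (nat \<Rightarrow> nat \<Rightarrow> bool) \<Rightarrow> nat \<Rightarrow> nat \<Rightarrow> 'r \<times> nat list \<Rightarrow> bool" where
  "locally_ok att A OK u a f \<longleftrightarrow> (\<exists>as. (fst f, as) \<in> A \<and> length as = length (snd f) \<and> as ! att f = a \<and>
     (\<forall>j<length as. j \<noteq> att f \<longrightarrow> OK (snd f ! j) (as ! j)))"

definition closed_rel :: "('r \<times> nat list \<Rightarrow> nat) \<Rightarrow> 'r inst \<Rightarrow> 'r inst \<Rightarrow> (nat \<Rightarrow> nat \<Rightarrow> bool) \<Rightarrow> bool" where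
  "closed_rel att S A OK \<longleftrightarrow> (\<forall>u a f. OK u a \<longrightarrow> f \<in> S \<longrightarrow> snd f ! att f = u \<longrightarrow> locally_ok att A OK u a f)"

lemma closed_relD:
  "closed_rel att S A OK \<Longrightarrow> OK u a \<Longrightarrow> f \<in> S \<Longrightarrow> snd f ! att f = u \<Longrightarrow> locally_ok att A OK u a f"
  unfolding closed_rel_def by blast

text \<open>An interface to rooted trees: every element other than the root lies below some fact,
  and local extensions starting at the root can be assembled to a homomorphism. No order on the tree
  has to be carried along.\<close>

definition rooted_at :: "nat \<Rightarrow> 'r inst \<Rightarrow> ('r \<times> nat list \<Rightarrow> nat) \<Rightarrow> bool" where
  "rooted_at r S att \<longleftrightarrow> (\<forall>f\<in>S. distinct (snd f) \<and> att f < length (snd f)) \<and>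
     (\<forall>u\<in>adom S. u = r \<or> (\<exists>f\<in>S. \<exists>j<length (snd f). j \<noteq> att f \<and> snd f ! j = u)) \<and>
     (\<forall>A OK a. closed_rel att S A OK \<longrightarrow> OK r a \<longrightarrow> (\<exists>h. hom h S A \<and> (\<forall>u\<in>adom S. OK u (h u))))"

lemma rooted_atD:
  assumes "rooted_at r S att"
  shows "f \<in> S \<Longrightarrow> distinct (snd f) \<and> att f < length (snd f)"
    and "u \<in> adom S \<Longrightarrow> u = r \<or> (\<exists>f\<in>S. \<exists>j<length (snd f). j \<noteq> att f \<and> snd f ! j = u)"
    and "closed_rel att S A OK \<Longrightarrow> OK r a \<Longrightarrow> \<exists>h. hom h S A \<and> (\<forall>u\<in>adom S. OK u (h u))"
  using assms[unfolded rooted_at_def, THEN conjunct1, rule_format]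
    assms[unfolded rooted_at_def, THEN conjunct2, THEN conjunct1, rule_format]
    assms[unfolded rooted_at_def, THEN conjunct2, THEN conjunct2, rule_format] by blast+

text \<open>A new fact is attached at its only old element. Its other elements are new and pairwise
  distinct, so the homomorphism extends by whatever tuple closedness offers for the value at that
  element.\<close>

lemma tree_rooted: "tree r S \<Longrightarrow> \<exists>att. rooted_at r S att"
proof (induction rule: tree.induct)
  case (single f r)
  obtain p where p: "p < length (snd f)" "snd f ! p = r" using single by (auto simp: in_set_conv_nth)
  show ?case unfolding rooted_at_def
  proof (rule exI[of _ "\<lambda>_. p"], intro conjI ballI allI impI)
    fix g :: "'a \<times> nat list" assume "g \<in> {f}"
    then show "distinct (snd g)" "p < length (snd g)" using single p by auto
  next
    fix u assume "u \<in> adom {f}"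
    then obtain j where "j < length (snd f)" "snd f ! j = u" by (auto simp: adom_insert in_set_conv_nth)
    then show "u = r \<or> (\<exists>f\<in>{f}. \<exists>j<length (snd f). j \<noteq> p \<and> snd f ! j = u)" using p by auto
  next
    fix A :: "'a inst" and OK a assume OK: "closed_rel (\<lambda>_. p) {f} A OK" "OK r a"
    then have "locally_ok (\<lambda>_. p) A OK r a f" using OK(2) p by (intro closed_relD[OF OK(1)]) simp_all
    then obtain as where as: "(fst f, as) \<in> A" "length as = length (snd f)" "as ! p = a"
      "\<And>j. j < length as \<Longrightarrow> j \<noteq> p \<Longrightarrow> OK (snd f ! j) (as ! j)"
      unfolding locally_ok_def by blast
    obtain h where h: "map h (snd f) = as" using ex_map_eq[of "snd f" as] as(2) single by auto
    have hj: "h (snd f ! j) = as ! j" if "j < length (snd f)" for j using that unfolding h[symmetric] by simp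
    show "\<exists>h. hom h {f} A \<and> (\<forall>u\<in>adom {f}. OK u (h u))"
    proof (intro exI[of _ h] conjI ballI)
      show "hom h {f} A" using h as(1) by (auto simp: hom_def)
      fix u assume "u \<in> adom {f}"
      then obtain j where j: "j < length (snd f)" "snd f ! j = u" by (auto simp: adom_insert in_set_conv_nth)
      show "OK u (h u)"
      proof (cases "j = p")
        case True
        then show ?thesis using hj[OF j(1)] j p as(3) OK(2) by simp
      next
        case False
        then show ?thesis using hj[OF j(1)] j as(2) as(4)[of j] by simp
      qed
    qed
  qed
next
  case (insert r S f x)
  from insert.IH obtain att where att: "rooted_at r S att" ..
  note d = rooted_atD(1)[OF att] and par = rooted_atD(2)[OF att] and ext = rooted_atD(3)[OF att]
  have x: "x \<in> set (snd f)" "x \<in> adom S" using insert.hyps(4) by auto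
  obtain p where p: "p < length (snd f)" "snd f ! p = x" using x(1) by (auto simp: in_set_conv_nth)
  have new: "snd f ! j \<notin> adom S" if "j < length (snd f)" "j \<noteq> p" for j
  proof
    assume "snd f ! j \<in> adom S"
    then have "snd f ! j = x" using insert.hyps(4) nth_mem[OF that(1)] by blast
    then show False using p that insert.hyps(3) nth_eq_iff_index_eq[of "snd f" j p] by simp
  qed
  define att' where "att' = att(f := p)"
  have att': "att' f = p" "\<And>g. g \<in> S \<Longrightarrow> att' g = att g" using insert.hyps(2) by (auto simp: att'_def)
  show ?case unfolding rooted_at_def
  proof (rule exI[of _ att'], intro conjI ballI allI impI)
    fix g assume g: "g \<in> insert f S"
    show "distinct (snd g)" "att' g < length (snd g)"
      using g insert.hyps(3) p d[of g] att'(1) att'(2)[of g] by (cases "g = f"; simp)+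
  next
    fix u assume u: "u \<in> adom (insert f S)"
    show "u = r \<or> (\<exists>f\<in>insert f S. \<exists>j<length (snd f). j \<noteq> att' f \<and> snd f ! j = u)"
    proof (cases "u \<in> adom S")
      case True
      from par[OF this] show ?thesis
      proof
        assume "\<exists>f\<in>S. \<exists>j<length (snd f). j \<noteq> att f \<and> snd f ! j = u"
        then obtain g j where "g \<in> S" "j < length (snd g)" "j \<noteq> att g" "snd g ! j = u" by blast
        then show ?thesis using att'(2)[of g] by (intro disjI2 bexI[of _ g] exI[of _ j]) auto
      qed blast
    next
      case False
      then obtain j where j: "j < length (snd f)" "snd f ! j = u" using u by (auto simp: adom_insert in_set_conv_nth)
      then have "j \<noteq> p" using False x p by blast
      then show ?thesis using j att'(1) by (intro disjI2 bexI[of _ f] exI[of _ j]) auto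
    qed
  next
    fix A :: "'a inst" and OK a assume OK: "closed_rel att' (insert f S) A OK" "OK r a"
    have "closed_rel att S A OK" unfolding closed_rel_def
    proof (intro allI impI)
      fix u b g assume g: "OK u b" "g \<in> S" "snd g ! att g = u"
      then have "locally_ok att' A OK u b g"
        using att'(2)[of g] by (intro closed_relD[OF OK(1)]) simp_all
      then show "locally_ok att A OK u b g" using att'(2)[OF g(2)] by (simp add: locally_ok_def)
    qed
    from ext[OF this OK(2)] obtain h where h: "hom h S A" "\<And>u. u \<in> adom S \<Longrightarrow> OK u (h u)" by blast
    have "locally_ok att' A OK x (h x) f"
      using h(2)[OF x(2)] p att'(1) by (intro closed_relD[OF OK(1)]) simp_all
    then obtain as where as: "(fst f, as) \<in> A" "length as = length (snd f)" "as ! p = h x"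
      "\<And>j. j < length as \<Longrightarrow> j \<noteq> p \<Longrightarrow> OK (snd f ! j) (as ! j)"
      unfolding locally_ok_def att'(1) by blast
    obtain k where k: "map k (snd f) = as" using ex_map_eq[of "snd f" as] as(2) insert.hyps(3) by auto
    define h' where "h' u = (if u \<in> adom S then h u else k u)" for u
    have hj: "h' (snd f ! j) = as ! j" if "j < length (snd f)" for j
    proof (cases "j = p")
      case True
      then show ?thesis using p x as(3) by (simp add: h'_def)
    next
      case False
      then have "h' (snd f ! j) = k (snd f ! j)" using new that by (simp add: h'_def)
      also have "\<dots> = as ! j" using that unfolding k[symmetric] by simp
      finally show ?thesis .
    qed
    have mf: "map h' (snd f) = as" using as(2) hj by (intro nth_equalityI) auto
    show "\<exists>h. hom h (insert f S) A \<and> (\<forall>u\<in>adom (insert f S). OK u (h u))"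
    proof (intro exI[of _ h'] conjI ballI)
      have "hom h' S A" using h(1) hom_cong[of S h' h A] by (simp add: h'_def)
      then show "hom h' (insert f S) A" using mf as(1) by (auto simp: hom_def)
      fix u assume u: "u \<in> adom (insert f S)"
      show "OK u (h' u)"
      proof (cases "u \<in> adom S")
        case True
        then show ?thesis using h(2) by (simp add: h'_def)
      next
        case False
        then obtain j where j: "j < length (snd f)" "snd f ! j = u" using u by (auto simp: adom_insert in_set_conv_nth)
        then have "j \<noteq> p" using False x p by blast
        then show ?thesis using hj[OF j(1)] j as(2) as(4)[of j] by simp
      qed
    qed
  qed
qed

text \<open>The union of all closed relations is closed, and adding one locally justified pair keeps
  it so. Contrapositively, each excluded pair has a fact of the tree to blame;
  \<open>tree_dual\<close> chooses such facts.\<close>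

lemma closed_rel_greatest:
  fixes att S A
  defines "OK \<equiv> \<lambda>u a. \<exists>Rel. closed_rel att S A Rel \<and> Rel u a"
  shows "closed_rel att S A OK"
    and "(\<And>f. f \<in> S \<Longrightarrow> snd f ! att f = u \<Longrightarrow> locally_ok att A OK u a f) \<Longrightarrow> OK u a"
proof -
  have mono: "locally_ok att A Q' u a f" if "locally_ok att A Q u a f" "\<And>u a. Q u a \<Longrightarrow> Q' u a" for Q Q' u a f
    using that unfolding locally_ok_def by blast
  show c: "closed_rel att S A OK" unfolding closed_rel_def
  proof (intro allI impI)
    fix u a f assume a: "OK u a" "f \<in> S" "snd f ! att f = u"
    then obtain Rel where Rel: "closed_rel att S A Rel" "Rel u a" unfolding OK_def by blast
    then have "locally_ok att A Rel u a f" using a(2,3) by (rule closed_relD)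
    then show "locally_ok att A OK u a f" by (rule mono) (use Rel(1) in \<open>auto simp: OK_def\<close>)
  qed
  assume l: "\<And>f. f \<in> S \<Longrightarrow> snd f ! att f = u \<Longrightarrow> locally_ok att A OK u a f"
  define Q where "Q v b \<longleftrightarrow> OK v b \<or> v = u \<and> b = a" for v b
  have "closed_rel att S A Q" unfolding closed_rel_def
  proof (intro allI impI)
    fix v b f assume a: "Q v b" "f \<in> S" "snd f ! att f = v"
    have "locally_ok att A OK v b f"
    proof (cases "OK v b")
      case True
      from closed_relD[OF c this a(2,3)] show ?thesis .
    next
      case False
      then show ?thesis using a l unfolding Q_def by blast
    qed
    then show "locally_ok att A Q v b f" by (rule mono) (simp add: Q_def)
  qed
  then show "OK u a" unfolding OK_def by (intro exI[of _ Q]) (simp add: Q_def)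
qed

text \<open>The elements of the dual of a tree \<open>T\<close> are the choice functions sending each element of \<open>T\<close>
  to a fact containing it; a tuple of them is related unless they all choose the same fact at
  its respective positions.\<close>

lemma tree_dual:
  fixes T :: "'r inst"
  assumes sch: "schema sig ar" and Ti: "T \<in> insts sig ar" and tree: "tree r T"
  obtains D where "D \<in> insts sig ar" "\<And>A. A \<in> insts sig ar \<Longrightarrow> hom_ex A D \<longleftrightarrow> \<not> hom_ex T A"
proof -
  have finT: "finite T" and cnt: "card (adom T) + card T = 1 + (\<Sum>f\<in>T. length (snd f))"
    using tree_count[OF tree] by auto
  have lenT: "length (snd f) = ar (fst f)" if "f \<in> T" for f
    using inst_fact[OF Ti, of "fst f" "snd f"] that by simp
  define \<Phi> where "\<Phi> = (\<Pi>\<^sub>E u\<in>adom T. {f \<in> T. u \<in> set (snd f)})"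
  have fin\<Phi>: "finite \<Phi>" unfolding \<Phi>_def using finT by (intro finite_PiE) auto
  obtain enc :: "(nat \<Rightarrow> 'r \<times> nat list) \<Rightarrow> nat" where enc: "inj_on enc \<Phi>"
    using finite_imp_inj_to_nat_seg[OF fin\<Phi>] by blast
  define good where "good R \<phi>s \<longleftrightarrow> R \<in> sig \<and> length \<phi>s = ar R \<and> set \<phi>s \<subseteq> \<Phi> \<and>
     (\<forall>f\<in>T. fst f = R \<longrightarrow> (\<exists>i<ar R. (\<phi>s ! i) (snd f ! i) \<noteq> f))" for R \<phi>s
  define D where "D = {(R, map enc \<phi>s) | R \<phi>s. good R \<phi>s}"
  have D_iff: "(R, t) \<in> D \<longleftrightarrow> (\<exists>\<phi>s. good R \<phi>s \<and> t = map enc \<phi>s)" for R t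
    unfolding D_def by blast
  have "D \<subseteq> (\<lambda>(R, \<phi>s). (R, map enc \<phi>s)) ` (SIGMA R:sig. {\<phi>s. set \<phi>s \<subseteq> \<Phi> \<and> length \<phi>s = ar R})"
    unfolding D_def good_def by auto
  moreover have "finite (SIGMA R:sig. {\<phi>s. set \<phi>s \<subseteq> \<Phi> \<and> length \<phi>s = ar R})"
    using sch fin\<Phi> by (intro finite_SigmaI finite_lists_length_eq) (auto simp: schema_def)
  ultimately have finD: "finite D" using finite_subset finite_imageI by blast
  have Di: "D \<in> insts sig ar"
    unfolding insts_def is_inst_def using finD by (auto simp: D_def good_def)
  \<comment> \<open>Such a homomorphism would assign to each element a fact containing it, so that
    each fact is refused by one of its own elements. Then there are at most \<Sum>(length - 1)
    elements, one less than a tree has.\<close>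
  have noTD: "\<not> hom_ex T D"
  proof
    assume "hom_ex T D"
    then obtain h where h: "hom h T D" by (auto simp: hom_ex_iff)
    define e where "e u = inv_into \<Phi> enc (h u) u" for u
    have ex: "\<exists>\<phi>s. good (fst f) \<phi>s \<and> map h (snd f) = map enc \<phi>s" if "f \<in> T" for f
      using hom_fact[OF h that] unfolding D_iff .
    have e: "e (snd f ! i) = (\<phi>s ! i) (snd f ! i) \<and> \<phi>s ! i \<in> \<Phi>"
      if "good (fst f) \<phi>s" "map h (snd f) = map enc \<phi>s" "i < length (snd f)" for f \<phi>s i
    proof -
      have l: "length \<phi>s = length (snd f)" using that(2) by (metis length_map)
      then have m: "\<phi>s ! i \<in> \<Phi>" using that(1,3) unfolding good_def by (metis nth_mem subsetD)
      have "h (snd f ! i) = enc (\<phi>s ! i)" using arg_cong[OF that(2), of "\<lambda>l. l ! i"] that(3) l by simp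
      then show ?thesis using m enc by (simp add: e_def)
    qed
    have eTu: "e u \<in> T \<and> u \<in> set (snd (e u))" if "u \<in> adom T" for u
    proof -
      obtain f where f: "f \<in> T" "u \<in> set (snd f)" using \<open>u \<in> adom T\<close> unfolding adom_iff2 by blast
      then obtain i where i: "i < length (snd f)" "snd f ! i = u" by (auto simp: in_set_conv_nth)
      obtain \<phi>s where "good (fst f) \<phi>s" "map h (snd f) = map enc \<phi>s" using ex[OF f(1)] by blast
      from e[OF this i(1)] have "e u = (\<phi>s ! i) u" "\<phi>s ! i \<in> \<Phi>" using i(2) by auto
      then show ?thesis using PiE_mem[of "\<phi>s ! i" "adom T" _ u] that unfolding \<Phi>_def by auto
    qed
    then have eT: "e u \<in> T" and eu: "u \<in> set (snd (e u))" if "u \<in> adom T" for u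
      using that by blast+
    have "card {u \<in> adom T. e u = f} + 1 \<le> length (snd f)" if f: "f \<in> T" for f
    proof -
      obtain \<phi>s where \<phi>s: "good (fst f) \<phi>s" "map h (snd f) = map enc \<phi>s" using ex[OF f] by blast
      then obtain i where i: "i < ar (fst f)" "(\<phi>s ! i) (snd f ! i) \<noteq> f" using f unfolding good_def by blast
      have il: "i < length (snd f)" using i lenT[OF f] by simp
      have ne: "e (snd f ! i) \<noteq> f" using e[OF \<phi>s il] i(2) by simp
      have "{u \<in> adom T. e u = f} \<subseteq> set (snd f) - {snd f ! i}" using eu ne by blast
      then have "card {u \<in> adom T. e u = f} \<le> card (set (snd f) - {snd f ! i})" by (intro card_mono) auto
      also have "\<dots> < card (set (snd f))" using il by (intro card_Diff1_less) auto
      finally show ?thesis using card_length[of "snd f"] by linarith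
    qed
    then have "(\<Sum>f\<in>T. card {u \<in> adom T. e u = f} + 1) \<le> (\<Sum>f\<in>T. length (snd f))" by (rule sum_mono)
    moreover have "(\<Sum>f\<in>T. card {u \<in> adom T. e u = f}) = card (adom T)"
      using sum.group[of "adom T" T e "\<lambda>_. 1::nat"] finT eT by auto
    ultimately show False using cnt unfolding sum.distrib by simp
  qed
  have AD: "hom_ex A D" if Ai: "A \<in> insts sig ar" and noTA: "\<not> hom_ex T A" for A
  proof -
    obtain att where att: "rooted_at r T att" using tree_rooted[OF tree] ..
    note dT = rooted_atD(1)[OF att] and par = rooted_atD(2)[OF att] and ext = rooted_atD(3)[OF att]
    define OK where "OK u a \<longleftrightarrow> (\<exists>Rel. closed_rel att T A Rel \<and> Rel u a)" for u a
    have OK1: "closed_rel att T A OK"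
      using closed_rel_greatest(1)[of att T A] unfolding OK_def .
    have OK2: "\<exists>f\<in>T. snd f ! att f = u \<and> \<not> locally_ok att A OK u a f" if "\<not> OK u a" for u a
      using closed_rel_greatest(2)[of T att u A a] that unfolding OK_def by blast
    have nr: "\<not> OK r a" for a using ext[OF OK1] noTA unfolding hom_ex_iff by blast
    \<comment> \<open>An element points up to a parent fact if its value is acceptable, and
      otherwise down to a fact that rules the value out. Were all positions of a tuple to choose
      \<open>f\<close>, then \<open>f\<close> would rule out the value at its attachment, although
      the same tuple, with acceptable values elsewhere, justifies it. The root, having no parent,
      never has an acceptable value.\<close>
    define ch where "ch a u f \<longleftrightarrow> f \<in> T \<and> (if OK u a then \<exists>j<length (snd f). j \<noteq> att f \<and> snd f ! j = u
       else snd f ! att f = u \<and> \<not> locally_ok att A OK u a f)" for a u f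
    have ch_ex: "\<exists>f. ch a u f" if "u \<in> adom T" for a u
    proof (cases "OK u a")
      case True
      then have "u \<noteq> r" using nr by blast
      then have "\<exists>f\<in>T. \<exists>j<length (snd f). j \<noteq> att f \<and> snd f ! j = u" using par[OF that] by blast
      then show ?thesis using True unfolding ch_def Bex_def by simp
    next
      case False
      then show ?thesis using OK2[OF False] unfolding ch_def Bex_def by simp
    qed
    define \<phi> where "\<phi> a = restrict (\<lambda>u. SOME f. ch a u f) (adom T)" for a
    have \<phi>: "ch a u (\<phi> a u)" if "u \<in> adom T" for a u
      using someI_ex[OF ch_ex[OF that]] that by (simp add: \<phi>_def)
    have ch_mem: "f \<in> T \<and> u \<in> set (snd f)" if "ch a u f" for a u f
    proof (cases "OK u a")
      case True
      then have "f \<in> T" "\<exists>j<length (snd f). j \<noteq> att f \<and> snd f ! j = u" using that unfolding ch_def by simp_all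
      then show ?thesis by (metis nth_mem)
    next
      case False
      then have "f \<in> T" "snd f ! att f = u" using that unfolding ch_def by simp_all
      then show ?thesis using dT by (metis nth_mem)
    qed
    have \<phi>\<Phi>: "\<phi> a \<in> \<Phi>" for a
    proof -
      have "\<phi> a u \<in> {f \<in> T. u \<in> set (snd f)}" if "u \<in> adom T" for u using ch_mem[OF \<phi>[OF that]] by blast
      moreover have "\<phi> a \<in> extensional (adom T)" by (simp add: \<phi>_def)
      ultimately show ?thesis unfolding \<Phi>_def PiE_def by blast
    qed
    have "hom (enc \<circ> \<phi>) A D" unfolding hom_def
    proof (intro allI impI)
      fix R as assume as: "(R, as) \<in> A"
      have las: "R \<in> sig" "length as = ar R" using inst_fact[OF Ai as] by auto
      have "good R (map \<phi> as)" unfolding good_def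
      proof (intro conjI ballI impI)
        show "R \<in> sig" "length (map \<phi> as) = ar R" using las by auto
        show "set (map \<phi> as) \<subseteq> \<Phi>" using \<phi>\<Phi> by auto
        fix f assume f: "f \<in> T" "fst f = R"
        have lf: "length (snd f) = length as" using lenT[OF f(1)] f(2) las by simp
        have df: "distinct (snd f)" "att f < length (snd f)" using dT[OF f(1)] by auto
        show "\<exists>i<ar R. (map \<phi> as ! i) (snd f ! i) \<noteq> f"
        proof (rule ccontr)
          assume "\<not> ?thesis"
          then have eqf: "\<phi> (as ! i) (snd f ! i) = f" if "i < length as" for i
            using that las by auto
          have cf: "ch (as ! i) (snd f ! i) f" if "i < length as" for i
          proof -
            have "snd f ! i \<in> adom T" using f(1) that lf by (intro nth_adom) simp_all
            from \<phi>[OF this, of "as ! i"] show ?thesis using eqf[OF that] by simp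
          qed
          have 1: "\<not> OK (snd f ! att f) (as ! att f)"
          proof
            assume ok: "OK (snd f ! att f) (as ! att f)"
            then obtain j where "j < length (snd f)" "j \<noteq> att f" "snd f ! j = snd f ! att f"
              using cf[of "att f"] df lf unfolding ch_def by auto
            then show False using df nth_eq_iff_index_eq by blast
          qed
          have 2: "OK (snd f ! j) (as ! j)" if "j < length as" "j \<noteq> att f" for j
          proof (rule ccontr)
            assume "\<not> OK (snd f ! j) (as ! j)"
            then have "snd f ! att f = snd f ! j" using cf[OF that(1)] unfolding ch_def by simp
            then show False using df that lf nth_eq_iff_index_eq[of "snd f" "att f" j] by simp
          qed
          have "\<not> locally_ok att A OK (snd f ! att f) (as ! att f) f"
            using cf[of "att f"] 1 df lf unfolding ch_def by simp
          moreover have "locally_ok att A OK (snd f ! att f) (as ! att f) f"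
            unfolding locally_ok_def using as f(2) lf 2 by auto
          ultimately show False by blast
        qed
      qed
      then show "(R, map (enc \<circ> \<phi>) as) \<in> D" unfolding D_iff by (intro exI[of _ "map \<phi> as"]) simp
    qed
    then show ?thesis by (auto simp: hom_ex_iff)
  qed
  show thesis
  proof (rule that[OF Di])
    fix A assume "A \<in> insts sig ar"
    then show "hom_ex A D \<longleftrightarrow> \<not> hom_ex T A" using AD noTD hom_ex_trans by blast
  qed
qed

section \<open>Conjunctive queries and Boolean combinations\<close>

lemma sat_foldr_FEx:
  "sat D \<rho> (foldr FEx xs \<phi>) \<longleftrightarrow> (\<exists>\<sigma>. (\<forall>x\<in>set xs. \<sigma> x \<in> adom D) \<and> (\<forall>x. x \<notin> set xs \<longrightarrow> \<sigma> x = \<rho> x) \<and> sat D \<sigma> \<phi>)"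
proof (induction xs arbitrary: \<rho>)
  case Nil
  have "(\<forall>x. \<sigma> x = \<rho> x) \<longleftrightarrow> \<sigma> = \<rho>" for \<sigma> by auto
  then show ?case by simp
next
  case (Cons y xs)
  show ?case
  proof
    assume "sat D \<rho> (foldr FEx (y # xs) \<phi>)"
    then obtain a \<sigma> where "a \<in> adom D" "\<forall>x\<in>set xs. \<sigma> x \<in> adom D"
      "\<forall>x. x \<notin> set xs \<longrightarrow> \<sigma> x = (\<rho>(y := a)) x" "sat D \<sigma> \<phi>" using Cons.IH by auto
    then show "\<exists>\<sigma>. (\<forall>x\<in>set (y # xs). \<sigma> x \<in> adom D) \<and> (\<forall>x. x \<notin> set (y # xs) \<longrightarrow> \<sigma> x = \<rho> x) \<and> sat D \<sigma> \<phi>"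
      by (intro exI[of _ \<sigma>]) (cases "y \<in> set xs", auto)
  next
    assume "\<exists>\<sigma>. (\<forall>x\<in>set (y # xs). \<sigma> x \<in> adom D) \<and> (\<forall>x. x \<notin> set (y # xs) \<longrightarrow> \<sigma> x = \<rho> x) \<and> sat D \<sigma> \<phi>"
    then obtain \<sigma> where \<sigma>: "\<forall>x\<in>set (y # xs). \<sigma> x \<in> adom D" "\<forall>x. x \<notin> set (y # xs) \<longrightarrow> \<sigma> x = \<rho> x" "sat D \<sigma> \<phi>"
      by blast
    then have "sat D (\<rho>(y := \<sigma> y)) (foldr FEx xs \<phi>)" unfolding Cons.IH by (intro exI[of _ \<sigma>]) auto
    then show "sat D \<rho> (foldr FEx (y # xs) \<phi>)" using \<sigma>(1) by auto
  qed
qed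

lemma fv_foldr_FEx: "fv (foldr FEx xs \<phi>) = fv \<phi> - set xs"
  by (induction xs) auto

lemma fo_over_foldr_FEx: "fo_over sig ar (foldr FEx xs \<phi>) = fo_over sig ar \<phi>"
  by (induction xs) auto

lemma cq_vars_eq: "cq_vars q = adom (set q)"
  by (simp add: cq_vars_def adom_def)

lemma hom_insert: "hom \<sigma> (insert f S) D \<longleftrightarrow> (fst f, map \<sigma> (snd f)) \<in> D \<and> hom \<sigma> S D"
  unfolding hom_def by (cases f) auto

lemma cq_body:
  "sat D \<sigma> (foldr (\<lambda>(R, xs) \<phi>. FAnd (FAtom R xs) \<phi>) q FTrue) \<longleftrightarrow> hom \<sigma> (set q) D"
  "fv (foldr (\<lambda>(R, xs) \<phi>. FAnd (FAtom R xs) \<phi>) q FTrue) = adom (set q)"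
  "fo_over sig ar (foldr (\<lambda>(R, xs) \<phi>. FAnd (FAtom R xs) \<phi>) q FTrue) \<longleftrightarrow> cq_wf sig ar q"
proof -
  show "sat D \<sigma> (foldr (\<lambda>(R, xs) \<phi>. FAnd (FAtom R xs) \<phi>) q FTrue) \<longleftrightarrow> hom \<sigma> (set q) D"
  proof (induction q)
    case Nil show ?case by (simp add: hom_def)
  next
    case (Cons f q) then show ?case by (cases f) (simp add: hom_insert)
  qed
  show "fv (foldr (\<lambda>(R, xs) \<phi>. FAnd (FAtom R xs) \<phi>) q FTrue) = adom (set q)"
  proof (induction q)
    case (Cons f q) then show ?case by (cases f) (simp add: adom_insert)
  qed simp
  show "fo_over sig ar (foldr (\<lambda>(R, xs) \<phi>. FAnd (FAtom R xs) \<phi>) q FTrue) \<longleftrightarrow> cq_wf sig ar q"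
  proof (induction q)
    case Nil show ?case by (simp add: cq_wf_def)
  next
    case (Cons f q) then show ?case by (cases f) (simp add: cq_wf_def)
  qed
qed

lemma sat_cq: "sat D \<rho> (cq_formula q) \<longleftrightarrow> hom_ex (set q) D"
proof -
  have fin: "finite (cq_vars q)" by (simp add: cq_vars_eq)
  have "sat D \<rho> (cq_formula q) \<longleftrightarrow> (\<exists>\<sigma>. (\<forall>x\<in>adom (set q). \<sigma> x \<in> adom D) \<and>
      (\<forall>x. x \<notin> adom (set q) \<longrightarrow> \<sigma> x = \<rho> x) \<and> hom \<sigma> (set q) D)"
    unfolding cq_formula_def sat_foldr_FEx cq_body using fin by (simp add: cq_vars_eq)
  also have "\<dots> \<longleftrightarrow> (\<exists>h. hom h (set q) D)"
  proof
    assume "\<exists>h. hom h (set q) D"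
    then obtain h where h: "hom h (set q) D" by blast
    define \<sigma> where "\<sigma> x = (if x \<in> adom (set q) then h x else \<rho> x)" for x
    have "hom \<sigma> (set q) D" using h hom_cong[of "set q" \<sigma> h D] by (simp add: \<sigma>_def)
    then show "\<exists>\<sigma>. (\<forall>x\<in>adom (set q). \<sigma> x \<in> adom D) \<and> (\<forall>x. x \<notin> adom (set q) \<longrightarrow> \<sigma> x = \<rho> x) \<and> hom \<sigma> (set q) D"
      using hom_adom[of \<sigma> "set q" D] by (intro exI[of _ \<sigma>]) (simp add: \<sigma>_def)
  qed blast
  finally show ?thesis by (simp add: hom_ex_iff)
qed

lemma models_cq: "models sig ar (cq_formula q) = {D \<in> insts sig ar. hom_ex (set q) D}"
  by (simp add: models_def sat_cq)

lemma fv_cq: "fv (cq_formula q) = {}"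
  by (simp add: cq_formula_def fv_foldr_FEx cq_body cq_vars_eq)

lemma fo_over_cq: "fo_over sig ar (cq_formula q) \<longleftrightarrow> cq_wf sig ar q"
  by (simp add: cq_formula_def fo_over_foldr_FEx cq_body)

lemma cq_wf_iff: "cq_wf sig ar q \<longleftrightarrow> set q \<in> insts sig ar"
  by (simp add: cq_wf_def insts_def is_inst_def)

lemma bool_comb_trans: "X \<in> bool_comb U S \<Longrightarrow> (\<And>Y. Y \<in> S \<Longrightarrow> Y \<in> bool_comb U S') \<Longrightarrow> X \<in> bool_comb U S'"
  by (induction rule: bool_comb.induct) (auto intro: bool_comb.intros)

text \<open>\<open>bool_comb\<close> has no constants, so the full class must be obtained from some
  given member. Both families are therefore shown to contain at least one class.\<close>

lemma bool_comb_UNIV: "X \<in> bool_comb U S \<Longrightarrow> U \<in> bool_comb U S"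
proof -
  assume X: "X \<in> bool_comb U S"
  have "U - (X \<inter> (U - X)) = U" by blast
  then show ?thesis using bool_comb.compl[OF bool_comb.inter[OF X bool_comb.compl[OF X]]] by simp
qed

lemma bool_comb_INT:
  assumes "finite I" "U \<in> bool_comb U S" "\<And>i. i \<in> I \<Longrightarrow> X i \<in> bool_comb U S"
  shows "U \<inter> (\<Inter>i\<in>I. X i) \<in> bool_comb U S"
  using assms(1,3)
proof (induction I rule: finite_induct)
  case empty
  then show ?case using assms(2) by simp
next
  case (insert i I)
  have "U \<inter> (\<Inter>i\<in>insert i I. X i) = X i \<inter> (U \<inter> (\<Inter>i\<in>I. X i))" by blast
  then show ?case using insert by (auto intro: bool_comb.inter)
qed

lemma bool_comb_Un:
  assumes "X \<in> bool_comb U S" "Y \<in> bool_comb U S" "X \<subseteq> U" "Y \<subseteq> U"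
  shows "X \<union> Y \<in> bool_comb U S"
proof -
  have "X \<union> Y = U - ((U - X) \<inter> (U - Y))" using assms(3,4) by blast
  then show ?thesis using assms(1,2) by (auto intro: bool_comb.intros)
qed

text \<open>Disjunctive normal form: the \<open>X i\<close> cut \<open>U\<close> into finitely many
  cells, and by \<open>det\<close> a cell that meets \<open>C\<close> lies inside it.\<close>

lemma bool_comb_determined:
  assumes fin: "finite I" and X: "\<And>i. i \<in> I \<Longrightarrow> X i \<in> bool_comb U S" and U: "U \<in> bool_comb U S"
    and C: "C \<subseteq> U" and det: "\<And>a b. a \<in> U \<Longrightarrow> b \<in> U \<Longrightarrow> (\<And>i. i \<in> I \<Longrightarrow> a \<in> X i \<longleftrightarrow> b \<in> X i) \<Longrightarrow> a \<in> C \<longleftrightarrow> b \<in> C"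
  shows "C \<in> bool_comb U S"
proof -
  define cell where "cell P = U \<inter> (\<Inter>i\<in>I. if i \<in> P then X i else U - X i)" for P
  have cell: "cell P \<in> bool_comb U S" for P
    unfolding cell_def using X by (intro bool_comb_INT[OF fin U]) (auto intro: bool_comb.compl)
  define \<P> where "\<P> = {P \<in> Pow I. cell P \<inter> C \<noteq> {}}"
  have fP: "finite \<P>" using fin by (simp add: \<P>_def)
  have "C = \<Union>(cell ` \<P>)"
  proof (intro set_eqI iffI)
    fix a assume a: "a \<in> C"
    define P where "P = {i \<in> I. a \<in> X i}"
    have "a \<in> (if i \<in> P then X i else U - X i)" if "i \<in> I" for i using a C that unfolding P_def by auto
    then have "a \<in> cell P" using a C unfolding cell_def by blast
    moreover from this have "P \<in> \<P>" using a unfolding \<P>_def P_def by blast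
    ultimately show "a \<in> \<Union>(cell ` \<P>)" by blast
  next
    fix a assume "a \<in> \<Union>(cell ` \<P>)"
    then obtain P where P: "P \<in> \<P>" "a \<in> cell P" by blast
    then obtain b where b: "b \<in> cell P" "b \<in> C" unfolding \<P>_def by blast
    have cellD: "z \<in> U" "i \<in> I \<Longrightarrow> z \<in> X i \<longleftrightarrow> i \<in> P" if "z \<in> cell P" for z i
    proof -
      show "z \<in> U" using that unfolding cell_def by (rule IntD1)
      assume "i \<in> I"
      then have "z \<in> (if i \<in> P then X i else U - X i)" using that unfolding cell_def by blast
      then show "z \<in> X i \<longleftrightarrow> i \<in> P" by (cases "i \<in> P") simp_all
    qed
    have "a \<in> X i \<longleftrightarrow> b \<in> X i" if "i \<in> I" for i using cellD(2)[OF P(2) that] cellD(2)[OF b(1) that] by simp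
    from det[OF cellD(1)[OF P(2)] cellD(1)[OF b(1)] this] show "a \<in> C" using b(2) by blast
  qed
  moreover have "\<Union>(cell ` Q) \<in> bool_comb U S" if "finite Q" for Q
    using that
  proof (induction Q rule: finite_induct)
    case empty
    have "U - U \<in> bool_comb U S" using U by (rule bool_comb.compl)
    then show ?case by simp
  next
    case (insert P Q)
    have "\<Union>(cell ` insert P Q) = cell P \<union> \<Union>(cell ` Q)" by simp
    moreover have "cell P \<union> \<Union>(cell ` Q) \<in> bool_comb U S"
      by (rule bool_comb_Un[OF cell insert.IH]) (auto simp: cell_def)
    ultimately show ?case by simp
  qed
  ultimately show ?thesis using fP by simp
qed

text \<open>Provides the member from which \<open>bool_comb_UNIV\<close> starts. Facts are nonempty
  tuples, so only the empty instance maps to \<open>{}\<close>, and a first-order sentence can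
  express that there is no element.\<close>

lemma empty_CSP_fo:
  assumes sch: "schema sig ar"
  shows "CSP sig ar {} \<in> fo_csp_classes sig ar"
proof -
  have "hom_ex D {} \<longleftrightarrow> adom D = {}" if D: "D \<in> insts sig ar" for D
  proof -
    have "D = {}" if "adom D = {}"
    proof (rule ccontr)
      assume "D \<noteq> {}"
      then obtain f where f: "f \<in> D" by blast
      then have "snd f \<noteq> []" using inst_nonempty[OF sch D] by blast
      then show False using \<open>adom D = {}\<close> f unfolding adom_UN by auto
    qed
    moreover have "hom_ex {} {}" by (simp add: hom_ex_iff hom_def)
    moreover have "adom D = {}" if "hom_ex D {}"
      using that hom_adom[of _ D "{}"] unfolding hom_ex_iff by auto
    ultimately show ?thesis by auto
  qed
  then have "CSP sig ar {} = models sig ar (FNot (FEx 0 FTrue))"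
    by (auto simp: CSP_def models_def)
  then have "fo_definable sig ar (CSP sig ar {})"
    unfolding fo_definable_def by (intro exI[of _ "FNot (FEx 0 FTrue)"]) simp
  moreover have "{} \<in> insts sig ar" by (simp add: insts_def is_inst_def)
  ultimately show ?thesis unfolding fo_csp_classes_def by blast
qed

text \<open>The components of the query map independently, so its class is an intersection of tree
  classes. First-order definability of the CSP of a dual comes for free: the negated tree query
  defines it.\<close>

theorem berge_class_in_fo_csp_comb:
  assumes sch: "schema sig ar" and X: "X \<in> berge_cq_classes sig ar"
  shows "X \<in> bool_comb (insts sig ar) (fo_csp_classes sig ar)"
proof -
  obtain q where q: "X = models sig ar (cq_formula q)" "cq_wf sig ar q" "berge_acyclic q"
    using X unfolding berge_cq_classes_def by blast
  have qi: "set q \<in> insts sig ar" using q(2) by (simp add: cq_wf_iff)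
  have ne: "snd f \<noteq> []" if "f \<in> set q" for f using inst_nonempty[OF sch qi that] .
  have "forest (set q)"
    using q(3) ne by (intro acyclic_imp_forest) (simp_all add: berge_acyclic_def canonical_def)
  then have "\<exists>\<T>. finite \<T> \<and> \<Union>\<T> = set q \<and> (\<forall>T\<in>\<T>. \<exists>r. tree r T) \<and>
      (\<forall>T\<in>\<T>. \<forall>T'\<in>\<T>. T \<noteq> T' \<longrightarrow> adom T \<inter> adom T' = {})"
    by (rule forest_trees) (rule ne)
  then obtain \<T> where T0: "finite \<T> \<and> \<Union>\<T> = set q \<and> (\<forall>T\<in>\<T>. \<exists>r. tree r T) \<and>
      (\<forall>T\<in>\<T>. \<forall>T'\<in>\<T>. T \<noteq> T' \<longrightarrow> adom T \<inter> adom T' = {})" ..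
  have T: "finite \<T>" "\<Union>\<T> = set q" using T0 by simp_all
  have T3: "\<exists>r. tree r T" if "T \<in> \<T>" for T using T0 that by blast
  have T4: "adom T \<inter> adom T' = {}" if "T \<in> \<T>" "T' \<in> \<T>" "T \<noteq> T'" for T T'
    using T0[THEN conjunct2, THEN conjunct2, THEN conjunct2, rule_format, OF that] .
  define Y where "Y T = {D \<in> insts sig ar. hom_ex T D}" for T
  have U: "insts sig ar \<in> bool_comb (insts sig ar) (fo_csp_classes sig ar)"
    using bool_comb_UNIV[OF bool_comb.base[OF empty_CSP_fo[OF sch]]] .
  have Yb: "Y T \<in> bool_comb (insts sig ar) (fo_csp_classes sig ar)" if TT: "T \<in> \<T>" for T
  proof -
    obtain r where tr: "tree r T" using T3[OF TT] ..
    have "T \<subseteq> set q" unfolding T(2)[symmetric] using TT by (rule Union_upper)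
    then have Ti: "T \<in> insts sig ar" using qi by (rule inst_subset)
    from tree_dual[OF sch Ti tr] obtain D
      where D: "D \<in> insts sig ar" "\<And>A. A \<in> insts sig ar \<Longrightarrow> hom_ex A D \<longleftrightarrow> \<not> hom_ex T A" by blast
    have c: "CSP sig ar D = insts sig ar - Y T" unfolding CSP_def Y_def using D(2) by blast
    obtain qT where qT: "set qT = T" using finite_list[OF inst_finite[OF Ti]] by blast
    have "CSP sig ar D = models sig ar (FNot (cq_formula qT))"
      unfolding CSP_def models_def sat.simps sat_cq qT using D(2) by blast
    then have "fo_definable sig ar (CSP sig ar D)"
      unfolding fo_definable_def using Ti qT
      by (intro exI[of _ "FNot (cq_formula qT)"]) (simp add: fv_cq fo_over_cq cq_wf_iff)
    then have "CSP sig ar D \<in> fo_csp_classes sig ar" using D(1) unfolding fo_csp_classes_def by blast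
    from bool_comb.compl[OF bool_comb.base[OF this]]
    have "insts sig ar - CSP sig ar D \<in> bool_comb (insts sig ar) (fo_csp_classes sig ar)" .
    moreover have "insts sig ar - CSP sig ar D = Y T" unfolding c Y_def by blast
    ultimately show ?thesis by simp
  qed
  have "X = insts sig ar \<inter> (\<Inter>T\<in>\<T>. Y T)"
  proof -
    have "hom_ex (set q) D \<longleftrightarrow> (\<forall>T\<in>\<T>. hom_ex T D)" for D
      unfolding T(2)[symmetric] by (rule hom_ex_disjoint_Union) (rule T4)
    then show ?thesis unfolding q(1) models_cq Y_def by auto
  qed
  then show ?thesis using bool_comb_INT[OF T(1) U Yb] by simp
qed

section \<open>Isomorphism and small instances\<close>

lemma iso_iff: "iso A B \<longleftrightarrow> (\<exists>f. inj_on f (adom A) \<and> B = rename f A)"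
  unfolding iso_def rename_def ..

lemma iso_refl: "iso A A"
  unfolding iso_iff by (intro exI[of _ id]) (simp add: rename_id)

lemma iso_sym: assumes "iso A B" shows "iso B A"
proof -
  obtain f where f: "inj_on f (adom A)" "B = rename f A" using assms iso_iff by blast
  define g where "g = inv_into (adom A) f"
  have "rename g B = A" unfolding f(2) rename_comp using f(1) by (intro rename_id) (simp add: g_def)
  moreover have "inj_on g (adom B)" unfolding f(2) adom_rename g_def by (rule inj_on_inv_into) simp
  ultimately show ?thesis unfolding iso_iff by (intro exI[of _ g]) simp
qed

lemma iso_trans: assumes "iso A B" "iso B C" shows "iso A C"
proof -
  obtain f where f: "inj_on f (adom A)" "B = rename f A" using assms iso_iff by blast
  obtain g where g: "inj_on g (adom B)" "C = rename g B" using assms iso_iff by blast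
  have "inj_on (g \<circ> f) (adom A)" using f g by (intro comp_inj_on) (simp_all add: adom_rename)
  moreover have "C = rename (g \<circ> f) A" using f g by (simp add: rename_comp)
  ultimately show ?thesis unfolding iso_iff by blast
qed

lemma inj_facts:
  assumes "inj_on f (adom A)" shows "inj_on (\<lambda>(R, t). (R, map f t)) A"
proof (rule inj_onI)
  fix p q assume pq: "p \<in> A" "q \<in> A" "(case p of (R, t) \<Rightarrow> (R, map f t)) = (case q of (R, t) \<Rightarrow> (R, map f t))"
  obtain R t where p: "p = (R, t)" by (cases p)
  obtain R' t' where q: "q = (R', t')" by (cases q)
  have e: "R = R'" "map f t = map f t'" using pq(3) p q by simp_all
  have "set t \<union> set t' \<subseteq> adom A" using pq(1,2) p q in_adom[of R t A] in_adom[of R' t' A] by blast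
  then have "inj_on f (set t \<union> set t')" using assms by (rule inj_on_subset[rotated])
  from inj_on_map_eq_map[OF this] show "p = q" using e p q by simp
qed

lemma card_rename: "inj_on f (adom A) \<Longrightarrow> card (rename f A) = card A"
  unfolding rename_def by (rule card_image) (rule inj_facts)

lemma iso_card: "iso A B \<Longrightarrow> card B = card A"
  unfolding iso_iff using card_rename by blast

lemma iso_hom_ex: "iso A B \<Longrightarrow> hom_ex A B"
  unfolding iso_iff hom_ex_iff using hom_rename by blast

lemma card_rename_le: "finite A \<Longrightarrow> card (rename f A) \<le> card A"
  unfolding rename_def by (rule card_image_le)

lemma sparse_rename:
  assumes "inj_on f (adom A)" "sparse g A" "finite A"
  shows "sparse g (rename f A)"
  unfolding sparse_def
proof (intro allI impI)
  fix S assume S: "S \<subseteq> rename f A" "S \<noteq> {}" "card S \<le> g"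
  obtain S0 where S0: "S0 \<subseteq> A" "S = (\<lambda>(R, t). (R, map f t)) ` S0"
    using S(1) unfolding rename_def by (rule subset_imageE)
  then have SS: "S = rename f S0" unfolding rename_def by blast
  have inj: "inj_on f (adom S0)" using assms(1) adom_mono[OF S0(1)] by (rule inj_on_subset)
  have c: "card S = card S0" unfolding SS using inj by (rule card_rename)
  have a: "card (adom S) = card (adom S0)" unfolding SS adom_rename using inj by (rule card_image)
  have "(\<Sum>p\<in>S. length (snd p)) = (\<Sum>p\<in>S0. length (snd p))"
    unfolding S0(2) sum.reindex[OF inj_facts[OF inj]] by (simp add: case_prod_beta)
  moreover have "S0 \<noteq> {}" using S(2) SS by (auto simp: rename_def)
  then have "(\<Sum>p\<in>S0. length (snd p)) < card (adom S0) + card S0"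
    using assms(2) S0(1) S(3) c unfolding sparse_def by simp
  ultimately show "(\<Sum>p\<in>S. length (snd p)) < card (adom S) + card S" using a c by simp
qed

lemma sparse_disjoint_Un:
  assumes fin: "finite A" "finite B" and sp: "sparse g A" "sparse g B" and dis: "adom A \<inter> adom B = {}"
  shows "sparse g (A \<union> B)"
  unfolding sparse_def
proof (intro allI impI)
  fix S assume S: "S \<subseteq> A \<union> B" "S \<noteq> {}" "card S \<le> g"
  define S1 where "S1 = S \<inter> A"
  define S2 where "S2 = S - A"
  have S12: "S = S1 \<union> S2" "S1 \<inter> S2 = {}" "S1 \<subseteq> A" "S2 \<subseteq> B" using S(1) by (auto simp: S1_def S2_def)
  have f12: "finite S1" "finite S2" using S12(3,4) fin finite_subset by blast+
  have c: "card S = card S1 + card S2" unfolding S12(1) using f12 S12(2) by (rule card_Un_disjoint)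
  have s: "(\<Sum>p\<in>S. length (snd p)) = (\<Sum>p\<in>S1. length (snd p)) + (\<Sum>p\<in>S2. length (snd p))"
    unfolding S12(1) using f12 S12(2) by (rule sum.union_disjoint)
  have "adom S1 \<inter> adom S2 = {}" using dis adom_mono[OF S12(3)] adom_mono[OF S12(4)] by blast
  then have a: "card (adom S) = card (adom S1) + card (adom S2)"
    unfolding S12(1) adom_Un using f12 by (intro card_Un_disjoint) simp_all
  have 1: "(\<Sum>p\<in>S1. length (snd p)) < card (adom S1) + card S1" if "S1 \<noteq> {}"
    using sp(1) S12(3) that S(3) c unfolding sparse_def by simp
  have 2: "(\<Sum>p\<in>S2. length (snd p)) < card (adom S2) + card S2" if "S2 \<noteq> {}"
    using sp(2) S12(4) that S(3) c unfolding sparse_def by simp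
  show "(\<Sum>p\<in>S. length (snd p)) < card (adom S) + card S"
  proof (cases "S1 = {}")
    case True
    then have "S2 \<noteq> {}" using S(2) S12(1) by blast
    then show ?thesis using 2 True s a c by simp
  next
    case False
    then show ?thesis using 1 2 s a c by (cases "S2 = {}") simp_all
  qed
qed

text \<open>At most \<open>n\<close> facts of arity at most \<open>m\<close> involve at most
  \<open>n * m\<close> elements. So small instances have representatives in a fixed finite set,
  which turns statements about all of them into finite ones.\<close>

lemma canonical_copy:
  assumes A: "A \<in> insts sig ar" and c: "card A \<le> n" and m: "\<And>R. R \<in> sig \<Longrightarrow> ar R \<le> m"
  obtains I where "I \<in> insts sig ar" "iso A I" "adom I \<subseteq> {..<n * m}"
proof -
  have fin: "finite A" using inst_finite[OF A] .
  have "card (adom A) \<le> (\<Sum>f\<in>A. length (snd f))" using fin by (rule card_adom_le)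
  also have "\<dots> \<le> (\<Sum>f\<in>A. m)"
  proof (rule sum_mono)
    fix f assume "f \<in> A"
    then show "length (snd f) \<le> m" using inst_fact[OF A, of "fst f" "snd f"] m[of "fst f"] by simp
  qed
  also have "\<dots> \<le> n * m" using c by simp
  finally have le: "card (adom A) \<le> n * m" .
  obtain f where f: "bij_betw f (adom A) {0..<card (adom A)}"
    using ex_bij_betw_finite_nat[of "adom A"] fin by auto
  have "iso A (rename f A)" unfolding iso_iff using f by (auto simp: bij_betw_def)
  moreover have "adom (rename f A) \<subseteq> {..<n * m}" using f le unfolding adom_rename bij_betw_def by auto
  ultimately show thesis using that inst_rename[OF A] by blast
qed

lemma arity_bound: "schema sig ar \<Longrightarrow> \<exists>m. \<forall>R\<in>sig. ar R \<le> m"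
  unfolding schema_def using finite_nat_set_iff_bounded_le[of "ar ` sig"] by auto

lemma finite_small_insts:
  assumes "schema sig ar" shows "finite {I \<in> insts sig ar. adom I \<subseteq> {..<M}}"
proof -
  define K where "K = (SIGMA R:sig. {t. set t \<subseteq> {..<M} \<and> length t = ar R})"
  have "finite K" using assms unfolding K_def schema_def
    by (intro finite_SigmaI finite_lists_length_eq) simp_all
  moreover have "{I \<in> insts sig ar. adom I \<subseteq> {..<M}} \<subseteq> Pow K"
  proof
    fix I assume I: "I \<in> {I \<in> insts sig ar. adom I \<subseteq> {..<M}}"
    have "f \<in> K" if "f \<in> I" for f
    proof -
      have "fst f \<in> sig \<and> length (snd f) = ar (fst f)" using inst_fact[of I sig ar "fst f" "snd f"] I that by simp
      moreover have "set (snd f) \<subseteq> {..<M}" using I that unfolding adom_UN by blast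
      ultimately show ?thesis unfolding K_def by (cases f) simp
    qed
    then show "I \<in> Pow K" by blast
  qed
  ultimately show ?thesis using finite_subset finite_Pow_iff by blast
qed

text \<open>With at most \<open>N\<close> facts, \<open>sparse N\<close> forces acyclicity. Stating
  it as sparsity makes the condition automatic for substructures of \<open>N\<close>-sparse
  instances.\<close>

definition same_profile :: "nat \<Rightarrow> 'r set \<Rightarrow> ('r \<Rightarrow> nat) \<Rightarrow> 'r inst \<Rightarrow> 'r inst \<Rightarrow> bool" where
  "same_profile N sig ar D D' \<longleftrightarrow>
     (\<forall>T\<in>insts sig ar. sparse N T \<longrightarrow> card T \<le> N \<longrightarrow> (hom_ex T D \<longleftrightarrow> hom_ex T D'))"

theorem profile_determined_in_berge_comb:
  assumes sch: "schema sig ar" and C: "C \<subseteq> insts sig ar"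
    and det: "\<And>D D'. D \<in> insts sig ar \<Longrightarrow> D' \<in> insts sig ar \<Longrightarrow> same_profile N sig ar D D' \<Longrightarrow> D \<in> C \<longleftrightarrow> D' \<in> C"
  shows "C \<in> bool_comb (insts sig ar) (berge_cq_classes sig ar)"
proof -
  obtain m where m: "\<And>R. R \<in> sig \<Longrightarrow> ar R \<le> m" using arity_bound[OF sch] by blast
  define \<I> where "\<I> = {I \<in> {I \<in> insts sig ar. adom I \<subseteq> {..<N * m}}. sparse N I \<and> card I \<le> N}"
  define X where "X I = {D \<in> insts sig ar. hom_ex I D}" for I
  have berge: "X I \<in> berge_cq_classes sig ar" if I: "I \<in> insts sig ar" "acyclic_inst I" for I
  proof -
    obtain q where q: "set q = I" using finite_list[OF inst_finite[OF I(1)]] by blast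
    have "X I = models sig ar (cq_formula q)" unfolding models_cq q X_def ..
    moreover have "cq_wf sig ar q" using I(1) q by (simp add: cq_wf_iff)
    moreover have "berge_acyclic q" using I(2) q by (simp add: berge_acyclic_def canonical_def)
    ultimately show ?thesis unfolding berge_cq_classes_def by blast
  qed
  show ?thesis
  proof (rule bool_comb_determined[where I = \<I> and X = X, OF _ _ _ C])
    show "finite \<I>" unfolding \<I>_def using finite_small_insts[OF sch, of "N * m"] by (rule finite_subset[rotated]) blast
    show "X I \<in> bool_comb (insts sig ar) (berge_cq_classes sig ar)" if "I \<in> \<I>" for I
    proof (rule bool_comb.base, rule berge)
      show Ii: "I \<in> insts sig ar" using that unfolding \<I>_def by blast
      have "sparse (card I) I" using that sparse_subset[of N I I "card I"] unfolding \<I>_def by blast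
      then show "acyclic_inst I" using sparse_imp_acyclic inst_finite[OF Ii] by blast
    qed
    have "{} \<in> insts sig ar" by (simp add: insts_def is_inst_def)
    moreover have "acyclic_inst {}" by (rule forest_imp_acyclic) (rule forest.empty)
    ultimately have "X {} \<in> berge_cq_classes sig ar" by (rule berge)
    from bool_comb_UNIV[OF bool_comb.base[OF this]]
    show "insts sig ar \<in> bool_comb (insts sig ar) (berge_cq_classes sig ar)" .
    fix D D' assume D: "D \<in> insts sig ar" "D' \<in> insts sig ar" "\<And>I. I \<in> \<I> \<Longrightarrow> D \<in> X I \<longleftrightarrow> D' \<in> X I"
    have "hom_ex T D \<longleftrightarrow> hom_ex T D'" if T: "T \<in> insts sig ar" "sparse N T" "card T \<le> N" for T
    proof -
      obtain I where I: "I \<in> insts sig ar" "iso T I" "adom I \<subseteq> {..<N * m}"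
        using canonical_copy[OF T(1,3) m] by blast
      have "sparse N I" using I(2) sparse_rename T(2) inst_finite[OF T(1)] unfolding iso_iff by blast
      then have "I \<in> \<I>" using I(1,3) iso_card[OF I(2)] T(3) by (simp add: \<I>_def)
      then have "hom_ex I D \<longleftrightarrow> hom_ex I D'" using D by (simp add: X_def)
      moreover have "hom_ex T E \<longleftrightarrow> hom_ex I E" for E
        using iso_hom_ex[OF I(2)] iso_hom_ex[OF iso_sym[OF I(2)]] hom_ex_trans by blast
      ultimately show ?thesis by simp
    qed
    then show "D \<in> C \<longleftrightarrow> D' \<in> C" using det[OF D(1,2)] unfolding same_profile_def by blast
  qed
qed

section \<open>Query algorithms from Boolean combinations\<close>

text \<open>The function \<open>q\<close> leaves open on which side \<open>F\<close> stands, so that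
  left and right algorithms are covered at once. For intersections the lists of queries are
  concatenated.\<close>

lemma bool_comb_query:
  assumes X: "X \<in> bool_comb (insts sig ar) S"
    and base: "\<And>Y. Y \<in> S \<Longrightarrow> \<exists>F\<in>insts sig ar. Y = {D \<in> insts sig ar. q F D = (1::nat)}"
  shows "\<exists>Fs Z. Fs \<noteq> [] \<and> set Fs \<subseteq> insts sig ar \<and> (\<forall>D\<in>insts sig ar. D \<in> X \<longleftrightarrow> map (\<lambda>F. q F D) Fs \<in> Z)"
  using X
proof (induction rule: bool_comb.induct)
  case (base Y)
  obtain F where F: "F \<in> insts sig ar" "Y = {D \<in> insts sig ar. q F D = 1}" using assms(2)[OF base] by blast
  then show ?case by (intro exI[of _ "[F]"] exI[of _ "{[1]}"]) simp
next
  case (compl Y)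
  then obtain Fs Z where FZ: "Fs \<noteq> []" "set Fs \<subseteq> insts sig ar" "\<forall>D\<in>insts sig ar. D \<in> Y \<longleftrightarrow> map (\<lambda>F. q F D) Fs \<in> Z"
    by blast
  then show ?case by (intro exI[of _ Fs] exI[of _ "- Z"]) simp
next
  case (inter Y Y')
  from inter.IH(1) obtain Fs Z where FZ: "Fs \<noteq> []" "set Fs \<subseteq> insts sig ar" "\<forall>D\<in>insts sig ar. D \<in> Y \<longleftrightarrow> map (\<lambda>F. q F D) Fs \<in> Z"
    by blast
  from inter.IH(2) obtain Gs W where GW: "Gs \<noteq> []" "set Gs \<subseteq> insts sig ar" "\<forall>D\<in>insts sig ar. D \<in> Y' \<longleftrightarrow> map (\<lambda>F. q F D) Gs \<in> W"
    by blast
  define V where "V = {w. take (length Fs) w \<in> Z \<and> drop (length Fs) w \<in> W}"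
  show ?case
    using FZ GW by (intro exI[of _ "Fs @ Gs"] exI[of _ V]) (simp add: V_def)
qed

lemma berge_comb_left_qa:
  assumes "C \<in> bool_comb (insts sig ar) (berge_cq_classes sig ar)"
  shows "left_qa KB sig ar C"
  unfolding left_qa_def
proof (rule bool_comb_query[OF assms])
  fix Y assume "Y \<in> berge_cq_classes sig ar"
  then obtain p where p: "Y = models sig ar (cq_formula p)" "cq_wf sig ar p" unfolding berge_cq_classes_def by blast
  then show "\<exists>F\<in>insts sig ar. Y = {D \<in> insts sig ar. homK KB F D = 1}"
    by (intro bexI[of _ "set p"]) (auto simp: models_cq cq_wf_iff homK_def)
qed

lemma fo_csp_comb_right_qa:
  assumes "C \<in> bool_comb (insts sig ar) (fo_csp_classes sig ar)"
  shows "right_qa KB sig ar C"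
  unfolding right_qa_def
proof (rule bool_comb_query[OF assms])
  fix Y assume "Y \<in> fo_csp_classes sig ar"
  then obtain B where B: "Y = CSP sig ar B" "B \<in> insts sig ar" unfolding fo_csp_classes_def by blast
  then show "\<exists>F\<in>insts sig ar. Y = {D \<in> insts sig ar. homK KB D F = 1}"
    by (intro bexI[of _ B]) (auto simp: CSP_def homK_def)
qed

text \<open>A count is zero exactly if there is no homomorphism; finiteness of
  \<open>homs F D\<close> matters, as \<open>card\<close> is also 0 on infinite sets.\<close>

lemma left_qa_KB_imp_KN: "left_qa KB sig ar C \<Longrightarrow> left_qa KN sig ar C"
proof -
  assume "left_qa KB sig ar C"
  then obtain Fs X where F: "Fs \<noteq> []" "set Fs \<subseteq> insts sig ar"
    "\<forall>D\<in>insts sig ar. D \<in> C \<longleftrightarrow> map (\<lambda>F. homK KB F D) Fs \<in> X" unfolding left_qa_def by blast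
  define Y where "Y = {w. map (\<lambda>n::nat. if n = 0 then 0 else 1) w \<in> X}"
  have "map (\<lambda>F. homK KB F D) Fs \<in> X \<longleftrightarrow> map (\<lambda>F. homK KN F D) Fs \<in> Y" if D: "D \<in> insts sig ar" for D
  proof -
    have "homK KB F D = (if homK KN F D = 0 then 0 else 1)" if "F \<in> set Fs" for F
    proof -
      have "finite (homs F D)" using that F(2) D inst_finite by (intro finite_homs) blast+
      then show ?thesis by (simp add: homK_def hom_ex_def)
    qed
    then have "map (\<lambda>F. homK KB F D) Fs = map (\<lambda>n. if n = 0 then 0 else 1) (map (\<lambda>F. homK KN F D) Fs)"
      by simp
    then show ?thesis unfolding Y_def mem_Collect_eq by argo
  qed
  then show ?thesis unfolding left_qa_def using F by (intro exI[of _ Fs] exI[of _ Y]) simp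
qed

section \<open>Equalizing homomorphism counts\<close>

definition connected_inst :: "'r inst \<Rightarrow> bool" where
  "connected_inst F \<longleftrightarrow> F \<noteq> {} \<and>
     (\<forall>F1 F2. F = F1 \<union> F2 \<longrightarrow> adom F1 \<inter> adom F2 = {} \<longrightarrow> F1 = {} \<or> F2 = {})"

lemma connected_instD: "connected_inst F \<Longrightarrow> F = F1 \<union> F2 \<Longrightarrow> adom F1 \<inter> adom F2 = {} \<Longrightarrow> F1 = {} \<or> F2 = {}"
  unfolding connected_inst_def by blast

lemma connected_rename: assumes "connected_inst F" shows "connected_inst (rename h F)"
  unfolding connected_inst_def
proof (intro conjI allI impI)
  show "rename h F \<noteq> {}" using assms by (simp add: connected_inst_def rename_def)
  fix G1 G2 assume G: "rename h F = G1 \<union> G2" "adom G1 \<inter> adom G2 = {}"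
  define rn where "rn p = (fst p, map h (snd p))" for p :: "'a \<times> nat list"
  have rF: "rename h F = rn ` F" unfolding rename_def rn_def case_prod_beta ..
  define F1 where "F1 = {p \<in> F. rn p \<in> G1}"
  define F2 where "F2 = {p \<in> F. rn p \<in> G2}"
  have mem: "z \<in> rn ` F \<longleftrightarrow> z \<in> G1 \<or> z \<in> G2" for z using G(1) unfolding rF by simp
  have "F \<subseteq> F1 \<union> F2"
  proof
    fix p assume p: "p \<in> F"
    then have "rn p \<in> G1 \<or> rn p \<in> G2" unfolding mem[symmetric] by (rule imageI)
    then show "p \<in> F1 \<union> F2" using p unfolding F1_def F2_def by simp
  qed
  then have "F = F1 \<union> F2" unfolding F1_def F2_def by blast
  moreover have "adom F1 \<inter> adom F2 = {}"
  proof (rule ccontr)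
    assume "adom F1 \<inter> adom F2 \<noteq> {}"
    then obtain x where x: "x \<in> adom F1" "x \<in> adom F2" by blast
    obtain p where p: "p \<in> F1" "x \<in> set (snd p)" using x(1) unfolding adom_iff2 by blast
    obtain q where q: "q \<in> F2" "x \<in> set (snd q)" using x(2) unfolding adom_iff2 by blast
    have "rn p \<in> G1" "h x \<in> set (snd (rn p))" using p by (simp_all add: F1_def rn_def)
    then have 1: "h x \<in> adom G1" unfolding adom_iff2 by blast
    have "rn q \<in> G2" "h x \<in> set (snd (rn q))" using q by (simp_all add: F2_def rn_def)
    then have 2: "h x \<in> adom G2" unfolding adom_iff2 by blast
    show False using 1 2 G(2) by blast
  qed
  ultimately have "F1 = {} \<or> F2 = {}" by (rule connected_instD[OF assms])
  then show "G1 = {} \<or> G2 = {}"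
  proof
    assume "F1 = {}"
    have "z \<notin> G1" for z
    proof
      assume "z \<in> G1"
      then obtain p where "p \<in> F" "z = rn p" using mem[of z] by blast
      then have "p \<in> F1" using \<open>z \<in> G1\<close> unfolding F1_def by simp
      then show False using \<open>F1 = {}\<close> by simp
    qed
    then show ?thesis by blast
  next
    assume "F2 = {}"
    have "z \<notin> G2" for z
    proof
      assume "z \<in> G2"
      then obtain p where "p \<in> F" "z = rn p" using mem[of z] by blast
      then have "p \<in> F2" using \<open>z \<in> G2\<close> unfolding F2_def by simp
      then show False using \<open>F2 = {}\<close> by simp
    qed
    then show ?thesis by blast
  qed
qed

lemma iso_connected: "iso A B \<Longrightarrow> connected_inst A \<Longrightarrow> connected_inst B"
  unfolding iso_iff using connected_rename by blast

lemma connected_subset_Un: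
  assumes "connected_inst S" "S \<subseteq> E1 \<union> E2" "adom E1 \<inter> adom E2 = {}"
  shows "S \<subseteq> E1 \<or> S \<subseteq> E2"
proof -
  have "S = (S \<inter> E1) \<union> (S \<inter> E2)" using assms(2) by blast
  moreover have "adom (S \<inter> E1) \<inter> adom (S \<inter> E2) = {}"
    using assms(3) adom_mono[of "S \<inter> E1" E1] adom_mono[of "S \<inter> E2" E2] by blast
  ultimately have "S \<inter> E1 = {} \<or> S \<inter> E2 = {}" by (rule connected_instD[OF assms(1)])
  then show ?thesis using assms(2) by blast
qed

section \<open>Counting connected substructures\<close>

text \<open>Substructures are arbitrary sets of facts, not induced ones, because homomorphic images
  are of this kind.\<close>

definition copies :: "'r inst \<Rightarrow> 'r inst \<Rightarrow> 'r inst set" where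
  "copies I E = {S. S \<subseteq> E \<and> iso I S}"

lemma finite_copies: "finite E \<Longrightarrow> finite (copies I E)"
  by (rule finite_subset[of _ "Pow E"]) (auto simp: copies_def)

lemma copies_iso: "iso I J \<Longrightarrow> copies I E = copies J E"
  unfolding copies_def using iso_trans iso_sym by blast

text \<open>A connected substructure cannot straddle a disjoint union, and as its facts are nonempty
  tuples it cannot lie in both parts.\<close>

lemma card_copies_Un:
  assumes "connected_inst I" "finite E1" "finite E2" "adom E1 \<inter> adom E2 = {}" "\<And>f. f \<in> E1 \<Longrightarrow> snd f \<noteq> []"
  shows "card (copies I (E1 \<union> E2)) = card (copies I E1) + card (copies I E2)"
proof -
  have "copies I (E1 \<union> E2) = copies I E1 \<union> copies I E2"
  proof (intro set_eqI iffI)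
    fix S assume "S \<in> copies I (E1 \<union> E2)"
    then have S: "S \<subseteq> E1 \<union> E2" "iso I S" by (simp_all add: copies_def)
    then show "S \<in> copies I E1 \<union> copies I E2"
      using connected_subset_Un[OF iso_connected[OF S(2) assms(1)] S(1) assms(4)] by (simp add: copies_def)
  next
    fix S assume "S \<in> copies I E1 \<union> copies I E2"
    then show "S \<in> copies I (E1 \<union> E2)" unfolding copies_def by blast
  qed
  moreover have "copies I E1 \<inter> copies I E2 = {}"
  proof (rule ccontr)
    assume "copies I E1 \<inter> copies I E2 \<noteq> {}"
    then obtain S where S: "S \<subseteq> E1" "S \<subseteq> E2" "iso I S" by (auto simp: copies_def)
    have "S \<noteq> {}" using iso_connected[OF S(3) assms(1)] by (simp add: connected_inst_def)
    then obtain f where f: "f \<in> S" by blast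
    then have "snd f \<noteq> []" using assms(5) S(1) by blast
    then have "snd f ! 0 \<in> adom E1" "snd f ! 0 \<in> adom E2" using f S by (auto intro!: nth_adom)
    then show False using assms(4) by blast
  qed
  ultimately show ?thesis using card_Un_disjoint[OF finite_copies finite_copies] assms(2,3) by metis
qed

text \<open>A substructure with at least as many facts as the whole is the whole. So a fresh copy of
  \<open>I\<close> affects the number of copies of a type at least as large only if that type is
  \<open>I\<close> itself.\<close>

lemma card_copies_large:
  assumes "finite I" "iso I I'" "card I \<le> card J"
  shows "card (copies J I') = (if iso J I then 1 else 0)"
proof -
  have I': "finite I'" "card I' = card I" using assms(1,2) iso_card unfolding iso_iff by auto
  have eq: "S = I'" if "S \<subseteq> I'" "iso J S" for S
    using that I' assms(3) iso_card[OF that(2)] by (intro card_seteq) simp_all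
  show ?thesis
  proof (cases "iso J I")
    case True
    then have "copies J I' = {I'}" unfolding copies_def using eq iso_trans[OF True assms(2)] by blast
    then show ?thesis using True by simp
  next
    case False
    then have "\<not> iso J I'" using iso_trans iso_sym[OF assms(2)] by blast
    then have "copies J I' = {}" unfolding copies_def using eq by blast
    then show ?thesis using False by simp
  qed
qed

lemma fresh_copy:
  assumes "finite E" "finite I"
  obtains I' where "iso I I'" "adom E \<inter> adom I' = {}"
proof -
  obtain n where n: "\<forall>x\<in>adom E. x < n" using finite_nat_set_iff_bounded assms(1) finite_adom by blast
  have "adom E \<inter> adom (rename (\<lambda>x. x + n) I) = {}" using n unfolding adom_rename by fastforce
  moreover have "iso I (rename (\<lambda>x. x + n) I)" unfolding iso_iff by (intro exI[of _ "\<lambda>x. x + n"]) (simp add: inj_on_def)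
  ultimately show thesis using that by blast
qed

text \<open>The homomorphisms on both sides keep the right-hand answers fixed once \<open>D0\<close>
  and \<open>D\<close> agree on them; sparsity makes the small substructures of \<open>E\<close>
  acyclic.\<close>

definition variant :: "nat \<Rightarrow> 'r set \<Rightarrow> ('r \<Rightarrow> nat) \<Rightarrow> 'r inst \<Rightarrow> 'r inst \<Rightarrow> 'r inst \<Rightarrow> bool" where
  "variant g sig ar D0 D E \<longleftrightarrow> E \<in> insts sig ar \<and> hom_ex D0 E \<and> hom_ex E D \<and> sparse g E"

lemma add_copy:
  assumes sch: "schema sig ar" and E: "variant g sig ar D0 D E"
    and I: "I \<in> insts sig ar" "hom_ex I D" "sparse g I"
  obtains E' where "variant g sig ar D0 D E'"
    "\<And>J. connected_inst J \<Longrightarrow> card I \<le> card J \<Longrightarrow> card (copies J E') = card (copies J E) + (if iso J I then 1 else 0)"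
proof -
  have Ei: "E \<in> insts sig ar" and E2: "hom_ex D0 E" "hom_ex E D" "sparse g E" using E by (simp_all add: variant_def)
  have fE: "finite E" and fI: "finite I" using inst_finite Ei I(1) by blast+
  obtain I' where I': "iso I I'" "adom E \<inter> adom I' = {}" using fresh_copy[OF fE fI] by blast
  have I'i: "I' \<in> insts sig ar" using I'(1) inst_rename[OF I(1)] unfolding iso_iff by blast
  have fI': "finite I'" using inst_finite[OF I'i] .
  have hI': "hom_ex I' D" using hom_ex_trans[OF iso_hom_ex[OF iso_sym[OF I'(1)]] I(2)] .
  have sI': "sparse g I'" using I'(1) sparse_rename I(3) fI unfolding iso_iff by blast
  have "hom_ex (\<Union>{E, I'}) D"
    by (subst hom_ex_disjoint_Union) (use I'(2) E2(2) hI' in auto)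
  then have hD: "hom_ex (E \<union> I') D" by simp
  have "variant g sig ar D0 D (E \<union> I')" unfolding variant_def
  proof (intro conjI)
    show "E \<union> I' \<in> insts sig ar" using Ei I'i by (rule inst_Un)
    show "hom_ex D0 (E \<union> I')" using hom_ex_trans[OF E2(1) hom_ex_subset] by blast
    show "sparse g (E \<union> I')" using fE fI' E2(3) sI' I'(2) by (rule sparse_disjoint_Un)
  qed (rule hD)
  moreover have "card (copies J (E \<union> I')) = card (copies J E) + (if iso J I then 1 else 0)"
    if "connected_inst J" "card I \<le> card J" for J
    using card_copies_Un[OF that(1) fE fI' I'(2) inst_nonempty[OF sch Ei]] card_copies_large[OF fI I'(1) that(2)]
    by simp
  ultimately show thesis using that by blast
qed

lemma add_copies:
  assumes sch: "schema sig ar" and I: "I \<in> insts sig ar" "hom_ex I D" "sparse g I"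
  shows "variant g sig ar D0 D E \<Longrightarrow> \<exists>E'. variant g sig ar D0 D E' \<and>
    (\<forall>J. connected_inst J \<longrightarrow> card I \<le> card J \<longrightarrow> card (copies J E') = card (copies J E) + (if iso J I then d else 0))"
proof (induction d)
  case 0
  then show ?case by (intro exI[of _ E]) simp
next
  case (Suc d)
  then obtain E1 where E1: "variant g sig ar D0 D E1"
    "\<And>J. connected_inst J \<Longrightarrow> card I \<le> card J \<Longrightarrow> card (copies J E1) = card (copies J E) + (if iso J I then d else 0)"
    by blast
  obtain E2 where E2: "variant g sig ar D0 D E2"
    "\<And>J. connected_inst J \<Longrightarrow> card I \<le> card J \<Longrightarrow> card (copies J E2) = card (copies J E1) + (if iso J I then 1 else 0)"
    using add_copy[OF sch E1(1) I] by blast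
  show ?case
  proof (intro exI[of _ E2] conjI allI impI)
    show "variant g sig ar D0 D E2" by (rule E2(1))
    fix J :: "'a inst" assume "connected_inst J" "card I \<le> card J"
    then show "card (copies J E2) = card (copies J E) + (if iso J I then Suc d else 0)"
      using E1(2)[of J] E2(2)[of J] by simp
  qed
qed

text \<open>If \<open>E\<close> lacks copies of \<open>I\<close>, then \<open>E'\<close> contains
  one. So \<open>I\<close> is sparse and maps to \<open>D'\<close>, hence by the profile to
  \<open>D\<close>, and this is what makes it legitimate to add copies of \<open>I\<close> to
  \<open>E\<close>.\<close>

lemma raise_copies:
  assumes sch: "schema sig ar" and pr: "same_profile g sig ar D D'"
    and E: "variant g sig ar D0 D E" and E': "variant g sig ar D0' D' E'"
    and I: "I \<in> insts sig ar" "connected_inst I" "card I \<le> g"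
    and le: "card (copies I E) \<le> card (copies I E')"
    and \<S>: "\<And>J. J \<in> \<S> \<Longrightarrow> connected_inst J \<and> card I \<le> card J \<and> card (copies J E) = card (copies J E')"
  shows "\<exists>E2. variant g sig ar D0 D E2 \<and> (\<forall>J\<in>insert I \<S>. card (copies J E2) = card (copies J E'))"
proof (cases "card (copies I E) = card (copies I E')")
  case True
  then show ?thesis using E \<S> by (intro exI[of _ E]) simp
next
  case False
  then have "copies I E' \<noteq> {}" using le by (intro notI) simp
  then obtain S where S: "S \<subseteq> E'" "iso I S" unfolding copies_def by blast
  have E'D: "hom_ex E' D'" "sparse g E'" "E' \<in> insts sig ar" using E' by (simp_all add: variant_def)
  have fS: "finite S" using finite_subset[OF S(1) inst_finite[OF E'D(3)]] .
  have "sparse g S" using sparse_subset[OF E'D(2) S(1)] by simp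
  then have sI: "sparse g I" using iso_sym[OF S(2)] sparse_rename fS unfolding iso_iff by blast
  have "hom_ex I D'" using hom_ex_trans[OF iso_hom_ex[OF S(2)] hom_ex_trans[OF hom_ex_subset[OF S(1)] E'D(1)]] .
  then have hI: "hom_ex I D" using pr I(1,3) sI unfolding same_profile_def by blast
  define d where "d = card (copies I E') - card (copies I E)"
  obtain E2 where E2: "variant g sig ar D0 D E2"
    "\<And>J. connected_inst J \<Longrightarrow> card I \<le> card J \<Longrightarrow> card (copies J E2) = card (copies J E) + (if iso J I then d else 0)"
    using add_copies[OF sch I(1) hI sI E, of d] by blast
  have "card (copies J E2) = card (copies J E')" if J: "J \<in> insert I \<S>" for J
  proof (cases "J = I")
    case True
    then show ?thesis using E2(2)[OF I(2)] iso_refl[of I] le by (simp add: d_def)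
  next
    case JI: False
    then have JS: "connected_inst J" "card I \<le> card J" "card (copies J E) = card (copies J E')" using J \<S> by blast+
    have "\<not> iso J I" using JS(3) False copies_iso by metis
    then show ?thesis using E2(2)[OF JS(1,2)] JS(3) by simp
  qed
  then show ?thesis using E2(1) by blast
qed

lemma same_profile_sym: "same_profile g sig ar D D' \<Longrightarrow> same_profile g sig ar D' D"
  unfolding same_profile_def by blast

text \<open>The types are treated by decreasing size, as adding copies of \<open>I\<close> does not change the number of
  copies of other types that are at least as large.\<close>

lemma equalize_copies:
  assumes sch: "schema sig ar" and pr: "same_profile g sig ar D D'"
    and E0: "variant g sig ar D0 D E0" and E0': "variant g sig ar D0' D' E0'" and fin: "finite \<S>"
  shows "(\<forall>I\<in>\<S>. I \<in> insts sig ar \<and> connected_inst I \<and> card I \<le> g) \<Longrightarrow> \<exists>E E'. variant g sig ar D0 D E \<and> variant g sig ar D0' D' E' \<and>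
    (\<forall>I\<in>\<S>. card (copies I E) = card (copies I E'))"
  using fin
\<comment> \<open>The rank \<open>g - card I\<close> grows as types shrink, so the type inserted
  last is the smallest. All sizes are at most \<open>g\<close>, so the truncated subtraction loses
  nothing.\<close>
proof (induction \<S> rule: finite_ranking_induct[where f = "\<lambda>I. g - card I"])
  case empty
  then show ?case using E0 E0' by blast
next
  case (insert I \<S>)
  then obtain E E' where E: "variant g sig ar D0 D E" "variant g sig ar D0' D' E'"
    "\<And>J. J \<in> \<S> \<Longrightarrow> card (copies J E) = card (copies J E')" by blast
  have I: "I \<in> insts sig ar" "connected_inst I" "card I \<le> g" using insert.prems by simp_all
  have JS: "connected_inst J \<and> card I \<le> card J" if "J \<in> \<S>" for J
  proof -
    have "g - card J \<le> g - card I" using insert.hyps(2)[OF that] .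
    moreover have "connected_inst J" "card J \<le> g" using insert.prems that by simp_all
    ultimately show ?thesis using I(3) by linarith
  qed
  show ?case
  proof (cases "card (copies I E) \<le> card (copies I E')")
    case True
    have "\<exists>E2. variant g sig ar D0 D E2 \<and> (\<forall>J\<in>insert I \<S>. card (copies J E2) = card (copies J E'))"
      by (rule raise_copies[OF sch pr E(1,2) I True]) (use JS E(3) in simp)
    then show ?thesis using E(2) by blast
  next
    case False
    then have le: "card (copies I E') \<le> card (copies I E)" by simp
    have "\<exists>E2. variant g sig ar D0' D' E2 \<and> (\<forall>J\<in>insert I \<S>. card (copies J E2) = card (copies J E))"
      by (rule raise_copies[OF sch same_profile_sym[OF pr] E(2,1) I le]) (use JS E(3) in simp)
    then show ?thesis using E(1) by metis
  qed
qed

section \<open>Homomorphism counts from substructure counts\<close>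

definition onto_homs :: "'r inst \<Rightarrow> 'r inst \<Rightarrow> (nat \<Rightarrow> nat) set" where
  "onto_homs F S = {h \<in> extensional (adom F). rename h F = S}"

lemma finite_onto_homs: "finite F \<Longrightarrow> finite S \<Longrightarrow> finite (onto_homs F S)"
  by (rule finite_subset[of _ "homs F S"]) (auto simp: onto_homs_def homs_iff hom_rename_iff)

lemma card_homs_onto:
  assumes "finite F" "finite E"
  shows "card (homs F E) = (\<Sum>S\<in>Pow E. card (onto_homs F S))"
proof -
  have "(\<Sum>S\<in>Pow E. \<Sum>h\<in>{h \<in> homs F E. rename h F = S}. 1) = (\<Sum>h\<in>homs F E. 1::nat)"
    by (rule sum.group) (use assms in \<open>auto simp: homs_iff hom_rename_iff\<close>)
  moreover have "{h \<in> homs F E. rename h F = S} = onto_homs F S" if "S \<in> Pow E" for S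
    using that by (auto simp: onto_homs_def homs_iff hom_rename_iff)
  ultimately show ?thesis by simp
qed

lemma card_onto_homs_le:
  assumes "finite F" "finite S" "iso S S'"
  shows "card (onto_homs F S) \<le> card (onto_homs F S')"
proof -
  obtain f where f: "inj_on f (adom S)" "S' = rename f S" using assms(3) iso_iff by blast
  have maps: "h x \<in> adom S" if "h \<in> onto_homs F S" "x \<in> adom F" for h x
    using that adom_rename[of h F] unfolding onto_homs_def by blast
  show ?thesis
  proof (rule card_inj_on_le[of "\<lambda>h. restrict (f \<circ> h) (adom F)"])
    show "finite (onto_homs F S')" using assms(1,2) f(2) by (simp add: finite_onto_homs)
    show "(\<lambda>h. restrict (f \<circ> h) (adom F)) ` onto_homs F S \<subseteq> onto_homs F S'"
    proof
      fix k assume "k \<in> (\<lambda>h. restrict (f \<circ> h) (adom F)) ` onto_homs F S"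
      then obtain h where h: "h \<in> onto_homs F S" "k = restrict (f \<circ> h) (adom F)" by blast
      have "rename k F = rename (f \<circ> h) F" unfolding h(2) by (rule rename_cong) simp
      also have "\<dots> = rename f S" using h(1) by (simp add: onto_homs_def flip: rename_comp)
      finally show "k \<in> onto_homs F S'" using h(2) f(2) by (simp add: onto_homs_def)
    qed
    show "inj_on (\<lambda>h. restrict (f \<circ> h) (adom F)) (onto_homs F S)"
    proof (rule inj_onI)
      fix h h' assume h: "h \<in> onto_homs F S" "h' \<in> onto_homs F S"
        "restrict (f \<circ> h) (adom F) = restrict (f \<circ> h') (adom F)"
      show "h = h'"
      proof (rule extensionalityI[of _ "adom F"])
        show "h \<in> extensional (adom F)" "h' \<in> extensional (adom F)" using h(1,2) by (simp_all add: onto_homs_def)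
        fix x assume x: "x \<in> adom F"
        then have "f (h x) = f (h' x)" using fun_cong[OF h(3), of x] by simp
        from inj_onD[OF f(1) this maps[OF h(1) x] maps[OF h(2) x]] show "h x = h' x" .
      qed
    qed
  qed
qed

lemma card_onto_homs_iso:
  assumes "finite F" "finite S" "iso S S'"
  shows "card (onto_homs F S) = card (onto_homs F S')"
proof (rule antisym)
  have "finite S'" using assms(2,3) unfolding iso_iff by auto
  then show "card (onto_homs F S') \<le> card (onto_homs F S)"
    using card_onto_homs_le[OF assms(1) _ iso_sym[OF assms(3)]] by blast
qed (rule card_onto_homs_le[OF assms])

lemma sum_by_class:
  fixes w :: "'a \<Rightarrow> nat"
  assumes fin: "finite A" "finite B"
    and c: "\<And>S. S \<in> A \<union> B \<Longrightarrow> card {S' \<in> A. r S' = r S} = card {S' \<in> B. r S' = r S}"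
    and w: "\<And>S S'. S \<in> A \<union> B \<Longrightarrow> S' \<in> A \<union> B \<Longrightarrow> r S = r S' \<Longrightarrow> w S = w S'"
  shows "sum w A = sum w B"
proof -
  define Z where "Z = r ` (A \<union> B)"
  have fZ: "finite Z" using fin by (simp add: Z_def)
  have "sum w A = (\<Sum>z\<in>Z. sum w {S \<in> A. r S = z})"
    by (rule sum.group[symmetric]) (use fin fZ in \<open>auto simp: Z_def\<close>)
  also have "\<dots> = (\<Sum>z\<in>Z. sum w {S \<in> B. r S = z})"
  proof (rule sum.cong[OF refl])
    fix z assume "z \<in> Z"
    then obtain S where S: "S \<in> A \<union> B" "z = r S" unfolding Z_def by blast
    have "sum w {S' \<in> A. r S' = z} = (\<Sum>S'\<in>{S' \<in> A. r S' = z}. w S)"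
      by (rule sum.cong[OF refl], rule w) (use S in auto)
    moreover have "sum w {S' \<in> B. r S' = z} = (\<Sum>S'\<in>{S' \<in> B. r S' = z}. w S)"
      by (rule sum.cong[OF refl], rule w) (use S in auto)
    ultimately show "sum w {S' \<in> A. r S' = z} = sum w {S' \<in> B. r S' = z}" using c[OF S(1)] S(2) by simp
  qed
  also have "\<dots> = sum w B"
    by (rule sum.group) (use fin fZ in \<open>auto simp: Z_def\<close>)
  finally show ?thesis .
qed

text \<open>Homomorphisms are sorted by their image. The image of \<open>F\<close> is connected with
  at most \<open>n\<close> facts, and the number of maps onto it depends only on its isomorphism
  type, so equal numbers of copies give equal sums.\<close>

lemma card_homs_connected:
  assumes F: "finite F" "connected_inst F" "card F \<le> n" and E: "finite E" "finite E'"
    and c: "\<And>S. S \<subseteq> E \<or> S \<subseteq> E' \<Longrightarrow> connected_inst S \<Longrightarrow> card S \<le> n \<Longrightarrow> card (copies S E) = card (copies S E')"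
  shows "card (homs F E) = card (homs F E')"
proof -
  define \<A> where "\<A> X = {S \<in> Pow X. connected_inst S \<and> card S \<le> n}" for X :: "'a inst"
  have red: "card (homs F X) = (\<Sum>S\<in>\<A> X. card (onto_homs F S))" if X: "finite X" for X
    unfolding card_homs_onto[OF F(1) X]
  proof (rule sum.mono_neutral_right)
    show "\<forall>S\<in>Pow X - \<A> X. card (onto_homs F S) = 0"
    proof
      fix S assume S: "S \<in> Pow X - \<A> X"
      have "onto_homs F S = {}"
      proof (rule ccontr)
        assume "onto_homs F S \<noteq> {}"
        then obtain h where h: "rename h F = S" by (auto simp: onto_homs_def)
        have "connected_inst S" using connected_rename[OF F(2), of h] h by simp
        moreover have "card S \<le> n" using card_rename_le[OF F(1), of h] h F(3) by simp
        ultimately show False using S by (simp add: \<A>_def)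
      qed
      then show "card (onto_homs F S) = 0" by simp
    qed
  qed (use X in \<open>auto simp: \<A>_def\<close>)
  define r where "r S = Collect (iso S)" for S :: "'a inst"
  have r: "r S = r S' \<longleftrightarrow> iso S S'" for S S'
  proof
    assume "r S = r S'"
    then have "S' \<in> r S" using iso_refl by (simp add: r_def)
    then show "iso S S'" by (simp add: r_def)
  next
    assume "iso S S'"
    then show "r S = r S'" unfolding r_def using iso_trans iso_sym by blast
  qed
  have rcop: "{S' \<in> \<A> X. r S' = r S} = copies S X" if "connected_inst S" "card S \<le> n" for S X
  proof -
    have "S' \<in> \<A> X" if "S' \<subseteq> X" "iso S S'" for S'
      using that(1) iso_connected[OF that(2) \<open>connected_inst S\<close>] iso_card[OF that(2)] \<open>card S \<le> n\<close> unfolding \<A>_def by simp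
    moreover have "S' \<subseteq> X" if "S' \<in> \<A> X" for S' using that by (simp add: \<A>_def)
    ultimately show ?thesis unfolding copies_def r using iso_sym by blast
  qed
  have "(\<Sum>S\<in>\<A> E. card (onto_homs F S)) = (\<Sum>S\<in>\<A> E'. card (onto_homs F S))"
  proof (rule sum_by_class[where r = r])
    show "finite (\<A> E)" "finite (\<A> E')" using E by (simp_all add: \<A>_def)
    fix S assume S: "S \<in> \<A> E \<union> \<A> E'"
    then have S2: "S \<subseteq> E \<or> S \<subseteq> E'" "connected_inst S" "card S \<le> n" unfolding \<A>_def by blast+
    show "card {S' \<in> \<A> E. r S' = r S} = card {S' \<in> \<A> E'. r S' = r S}"
      unfolding rcop[OF S2(2,3)] by (rule c[OF S2])
    fix S' assume "S' \<in> \<A> E \<union> \<A> E'" "r S = r S'"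
    moreover have "finite S" using S2(1) E finite_subset by blast
    ultimately show "card (onto_homs F S) = card (onto_homs F S')"
      unfolding r using card_onto_homs_iso[OF F(1)] by blast
  qed
  then show ?thesis using red E by simp
qed

lemma card_homs_disjoint:
  assumes dis: "adom F1 \<inter> adom F2 = {}"
  shows "card (homs (F1 \<union> F2) E) = card (homs F1 E) * card (homs F2 E)"
proof -
  have h12: "hom h (F1 \<union> F2) E \<longleftrightarrow> hom h F1 E \<and> hom h F2 E" for h unfolding hom_def by blast
  have "bij_betw (\<lambda>h. (restrict h (adom F1), restrict h (adom F2))) (homs (F1 \<union> F2) E) (homs F1 E \<times> homs F2 E)"
  proof (rule bij_betw_byWitness[where f' = "\<lambda>(h1, h2) x. if x \<in> adom F1 then h1 x else h2 x"])
    show "\<forall>h\<in>homs (F1 \<union> F2) E. (case (restrict h (adom F1), restrict h (adom F2)) of (h1, h2) \<Rightarrow>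
        \<lambda>x. if x \<in> adom F1 then h1 x else h2 x) = h"
    proof
      fix h assume "h \<in> homs (F1 \<union> F2) E"
      then have "h \<in> extensional (adom F1 \<union> adom F2)" by (simp add: homs_iff adom_Un)
      then show "(case (restrict h (adom F1), restrict h (adom F2)) of (h1, h2) \<Rightarrow>
        \<lambda>x. if x \<in> adom F1 then h1 x else h2 x) = h" by (auto simp: extensional_def fun_eq_iff)
    qed
    show "\<forall>p\<in>homs F1 E \<times> homs F2 E. (restrict (case p of (h1, h2) \<Rightarrow> \<lambda>x. if x \<in> adom F1 then h1 x else h2 x) (adom F1),
        restrict (case p of (h1, h2) \<Rightarrow> \<lambda>x. if x \<in> adom F1 then h1 x else h2 x) (adom F2)) = p"
    proof
      fix p assume p: "p \<in> homs F1 E \<times> homs F2 E"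
      obtain h1 h2 where p2: "p = (h1, h2)" by (cases p)
      have e: "h1 \<in> extensional (adom F1)" "h2 \<in> extensional (adom F2)" using p p2 by (simp_all add: homs_iff)
      have "restrict (\<lambda>x. if x \<in> adom F1 then h1 x else h2 x) (adom F1) = h1"
        using e(1) by (auto simp: extensional_def fun_eq_iff)
      moreover have "restrict (\<lambda>x. if x \<in> adom F1 then h1 x else h2 x) (adom F2) = h2"
        using e(2) dis by (auto simp: extensional_def fun_eq_iff)
      ultimately show "(restrict (case p of (h1, h2) \<Rightarrow> \<lambda>x. if x \<in> adom F1 then h1 x else h2 x) (adom F1),
        restrict (case p of (h1, h2) \<Rightarrow> \<lambda>x. if x \<in> adom F1 then h1 x else h2 x) (adom F2)) = p" unfolding p2 by simp
    qed
    show "(\<lambda>h. (restrict h (adom F1), restrict h (adom F2))) ` homs (F1 \<union> F2) E \<subseteq> homs F1 E \<times> homs F2 E"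
    proof
      fix p assume "p \<in> (\<lambda>h. (restrict h (adom F1), restrict h (adom F2))) ` homs (F1 \<union> F2) E"
      then obtain h where h0: "h \<in> homs (F1 \<union> F2) E" "p = (restrict h (adom F1), restrict h (adom F2))" by (rule imageE)
      then have h: "hom h F1 E" "hom h F2 E" "p = (restrict h (adom F1), restrict h (adom F2))"
        unfolding homs_iff h12 by simp_all
      have "hom (restrict h (adom F1)) F1 E" using h(1) hom_cong[of F1 "restrict h (adom F1)" h E] by simp
      moreover have "hom (restrict h (adom F2)) F2 E" using h(2) hom_cong[of F2 "restrict h (adom F2)" h E] by simp
      ultimately show "p \<in> homs F1 E \<times> homs F2 E" unfolding h(3) by (simp add: homs_iff)
    qed
    show "(\<lambda>(h1, h2) x. if x \<in> adom F1 then h1 x else h2 x) ` (homs F1 E \<times> homs F2 E) \<subseteq> homs (F1 \<union> F2) E"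
    proof
      fix k assume "k \<in> (\<lambda>(h1, h2) x. if x \<in> adom F1 then h1 x else h2 x) ` (homs F1 E \<times> homs F2 E)"
      then obtain p where p: "p \<in> homs F1 E \<times> homs F2 E" "k = (case p of (h1, h2) \<Rightarrow> \<lambda>x. if x \<in> adom F1 then h1 x else h2 x)"
        by (rule imageE)
      obtain h1 h2 where "p = (h1, h2)" by (cases p)
      then have h: "h1 \<in> homs F1 E" "h2 \<in> homs F2 E" "k = (\<lambda>x. if x \<in> adom F1 then h1 x else h2 x)"
        using p by simp_all
      have "hom k F1 E" using h(1) hom_cong[of F1 k h1 E] by (simp add: h(3) homs_iff)
      moreover have "k x = h2 x" if "x \<in> adom F2" for x using that dis unfolding h(3) by auto
      then have "hom k F2 E" using h(2) hom_cong[of F2 k h2 E] by (simp add: homs_iff)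
      moreover have "k \<in> extensional (adom (F1 \<union> F2))"
        using h(1,2) unfolding h(3) homs_iff adom_Un extensional_def by simp
      ultimately show "k \<in> homs (F1 \<union> F2) E" unfolding homs_iff h12 by simp
    qed
  qed
  from bij_betw_same_card[OF this] show ?thesis by (simp only: card_cartesian_product)
qed

text \<open>Counts multiply over disjoint parts, which reduces the claim to connected
  \<open>F\<close>. Nonempty tuples ensure that both parts are proper.\<close>

lemma card_homs_eq:
  assumes E: "finite E" "finite E'"
    and c: "\<And>S. S \<subseteq> E \<or> S \<subseteq> E' \<Longrightarrow> connected_inst S \<Longrightarrow> card S \<le> n \<Longrightarrow> card (copies S E) = card (copies S E')"
  shows "finite F \<Longrightarrow> (\<forall>f\<in>F. snd f \<noteq> []) \<Longrightarrow> card F \<le> n \<Longrightarrow> card (homs F E) = card (homs F E')"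
proof (induction F rule: finite_psubset_induct)
  case (psubset F)
  consider "F = {}" | "connected_inst F" | F1 F2 where "F = F1 \<union> F2" "adom F1 \<inter> adom F2 = {}" "F1 \<noteq> {}" "F2 \<noteq> {}"
    unfolding connected_inst_def by blast
  then show ?case
  proof cases
    case 1
    then have "homs F E = homs F E'" by (auto simp: homs_iff hom_def)
    then show ?thesis by simp
  next
    case 2
    show ?thesis by (rule card_homs_connected[OF psubset.hyps(1) 2 psubset.prems(2) E]) (rule c)
  next
    case 3
    have "F1 \<inter> F2 = {}"
    proof (rule ccontr)
      assume "F1 \<inter> F2 \<noteq> {}"
      then obtain f where f: "f \<in> F1" "f \<in> F2" by blast
      then have "0 < length (snd f)" using psubset.prems(1) 3(1) by blast
      then have "snd f ! 0 \<in> adom F1" "snd f ! 0 \<in> adom F2" using f by (auto intro!: nth_adom)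
      then show False using 3(2) by blast
    qed
    then have ps: "F1 \<subset> F" "F2 \<subset> F" using 3 by blast+
    have le: "card F1 \<le> n" "card F2 \<le> n"
      using ps psubset.prems(2) psubset_card_mono[OF psubset.hyps(1)] by (meson less_imp_le order_trans)+
    have "card (homs F1 E) = card (homs F1 E')" "card (homs F2 E) = card (homs F2 E')"
      using psubset.IH[OF ps(1)] psubset.IH[OF ps(2)] psubset.prems(1) ps le by blast+
    then show ?thesis unfolding 3(1) card_homs_disjoint[OF 3(2)] by simp
  qed
qed

text \<open>Membership is passed along \<open>D\<close>, \<open>E\<close>, \<open>E'\<close>,
  \<open>D'\<close>: the outer steps leave the right-hand answers unchanged, the middle one the
  left-hand counts.\<close>

theorem left_KN_right_KB_profile:
  assumes sch: "schema sig ar" and L: "left_qa KN sig ar C" and R: "right_qa KB sig ar C"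
  obtains N where "\<And>D D'. D \<in> insts sig ar \<Longrightarrow> D' \<in> insts sig ar \<Longrightarrow> same_profile N sig ar D D' \<Longrightarrow> D \<in> C \<longleftrightarrow> D' \<in> C"
proof -
  obtain Fs X where F: "set Fs \<subseteq> insts sig ar"
    "\<And>D. D \<in> insts sig ar \<Longrightarrow> D \<in> C \<longleftrightarrow> map (\<lambda>F. homK KN F D) Fs \<in> X" using L unfolding left_qa_def by blast
  obtain Gs Y where G: "set Gs \<subseteq> insts sig ar"
    "\<And>D. D \<in> insts sig ar \<Longrightarrow> D \<in> C \<longleftrightarrow> map (\<lambda>F. homK KB D F) Gs \<in> Y" using R unfolding right_qa_def by blast
  \<comment> \<open>Any bound on the sizes of the left queries will do, since images have no more
    facts than the query.\<close>
  define N where "N = sum_list (map card Fs)"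
  have N: "card F \<le> N" if "F \<in> set Fs" for F
    unfolding N_def using that by (intro member_le_sum_list) simp_all
  have right: "D \<in> C \<longleftrightarrow> E \<in> C" if D: "D \<in> insts sig ar" and E: "E \<in> insts sig ar" "hom_ex E D"
    "\<And>G. G \<in> set Gs \<Longrightarrow> hom_ex E G \<Longrightarrow> hom_ex D G" for D E
  proof -
    have "homK KB D G = homK KB E G" if "G \<in> set Gs" for G
      using E(3)[OF that] hom_ex_trans[OF E(2)] by (auto simp: homK_def)
    then have "map (\<lambda>F. homK KB D F) Gs = map (\<lambda>F. homK KB E F) Gs" by simp
    then show ?thesis unfolding G(2)[OF D] G(2)[OF E(1)] by (simp only:)
  qed
  obtain m where m: "\<And>R. R \<in> sig \<Longrightarrow> ar R \<le> m" using arity_bound[OF sch] by blast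
  define \<S> where "\<S> = {I \<in> {I \<in> insts sig ar. adom I \<subseteq> {..<N * m}}. connected_inst I \<and> card I \<le> N}"
  have f\<S>: "finite \<S>" unfolding \<S>_def using finite_small_insts[OF sch, of "N * m"] by (rule finite_subset[rotated]) blast
  have fG: "\<And>G. G \<in> set Gs \<Longrightarrow> finite G" using G(1) inst_finite by blast
  show thesis
  proof (rule that)
    fix D D' assume D: "D \<in> insts sig ar" "D' \<in> insts sig ar" and pr: "same_profile N sig ar D D'"
    obtain D0 where D0: "D0 \<in> insts sig ar" "sparse N D0" "hom_ex D0 D"
      "\<And>G. G \<in> set Gs \<Longrightarrow> hom_ex D0 G \<Longrightarrow> hom_ex D G"
      using sparse_incomparability[OF D(1) finite_set fG] by blast
    obtain D0' where D0': "D0' \<in> insts sig ar" "sparse N D0'" "hom_ex D0' D'"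
      "\<And>G. G \<in> set Gs \<Longrightarrow> hom_ex D0' G \<Longrightarrow> hom_ex D' G"
      using sparse_incomparability[OF D(2) finite_set fG] by blast
    have v: "variant N sig ar D0 D D0" "variant N sig ar D0' D' D0'"
      unfolding variant_def using D0 D0' hom_ex_subset by blast+
    have "\<forall>I\<in>\<S>. I \<in> insts sig ar \<and> connected_inst I \<and> card I \<le> N" by (simp add: \<S>_def)
    from equalize_copies[OF sch pr v f\<S> this] obtain E E' where E: "variant N sig ar D0 D E" "variant N sig ar D0' D' E'"
      and eq: "\<forall>I\<in>\<S>. card (copies I E) = card (copies I E')" by blast
    have Ei: "E \<in> insts sig ar" "E' \<in> insts sig ar" using E by (simp_all add: variant_def)
    have cop: "card (copies S E) = card (copies S E')" if S: "S \<subseteq> E \<or> S \<subseteq> E'" "connected_inst S" "card S \<le> N" for S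
    proof -
      have Si: "S \<in> insts sig ar" using S(1) Ei inst_subset by blast
      obtain I where I: "I \<in> insts sig ar" "iso S I" "adom I \<subseteq> {..<N * m}"
        using canonical_copy[OF Si S(3) m] by blast
      have "I \<in> \<S>" using I iso_connected[OF I(2) S(2)] iso_card[OF I(2)] S(3) by (simp add: \<S>_def)
      then show ?thesis using eq copies_iso[OF I(2)] by simp
    qed
    have "homK KN F E = homK KN F E'" if "F \<in> set Fs" for F
    proof -
      have Fi: "F \<in> insts sig ar" using that F(1) by blast
      have ne: "\<forall>f\<in>F. snd f \<noteq> []" using inst_nonempty[OF sch Fi] by blast
      have "card (homs F E) = card (homs F E')"
        by (rule card_homs_eq[OF inst_finite[OF Ei(1)] inst_finite[OF Ei(2)] cop inst_finite[OF Fi] ne N[OF that]])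
      then show ?thesis by (simp add: homK_def)
    qed
    then have "map (\<lambda>F. homK KN F E) Fs = map (\<lambda>F. homK KN F E') Fs" by simp
    then have "E \<in> C \<longleftrightarrow> E' \<in> C" unfolding F(2)[OF Ei(1)] F(2)[OF Ei(2)] by (simp only:)
    moreover have "D \<in> C \<longleftrightarrow> E \<in> C"
      using E(1) D0(4) hom_ex_trans unfolding variant_def by (intro right[OF D(1) Ei(1)]) blast+
    moreover have "D' \<in> C \<longleftrightarrow> E' \<in> C"
      using E(2) D0'(4) hom_ex_trans unfolding variant_def by (intro right[OF D(2) Ei(2)]) blast+
    ultimately show "D \<in> C \<longleftrightarrow> D' \<in> C" by simp
  qed
qed

section \<open>Locality of first-order sentences on disjoint unions\<close>

definition adj :: "'r inst \<Rightarrow> nat \<Rightarrow> nat \<Rightarrow> bool" where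
  "adj A x y \<longleftrightarrow> x = y \<or> (\<exists>f\<in>A. x \<in> set (snd f) \<and> y \<in> set (snd f))"

primrec near :: "'r inst \<Rightarrow> nat \<Rightarrow> nat \<Rightarrow> nat \<Rightarrow> bool" where
  "near A 0 x y \<longleftrightarrow> x = y"
| "near A (Suc n) x y \<longleftrightarrow> (\<exists>z. near A n x z \<and> adj A z y)"

lemma near_refl: "near A n x x"
  by (induction n) (auto simp: adj_def)

lemma near_add: "near A n x y \<Longrightarrow> near A m y z \<Longrightarrow> near A (n + m) x z"
proof (induction m arbitrary: z)
  case (Suc m)
  then obtain w where "near A m y w" "adj A w z" by auto
  then show ?case using Suc.IH[OF Suc.prems(1)] by auto
qed simp

lemma near_1: "near A 1 x y \<longleftrightarrow> adj A x y"
  by simp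

lemma adj_sym: "adj A x y \<Longrightarrow> adj A y x"
  unfolding adj_def by blast

lemma near_sym: "near A n x y \<Longrightarrow> near A n y x"
proof (induction n arbitrary: y)
  case (Suc n)
  then obtain z where z: "near A n x z" "adj A z y" by auto
  have "near A 1 y z" using adj_sym[OF z(2)] near_1 by blast
  from near_add[OF this Suc.IH[OF z(1)]] show ?case by simp
qed simp

lemma near_mono: "near A n x y \<Longrightarrow> n \<le> m \<Longrightarrow> near A m x y"
  using near_add[OF _ near_refl, of A n x y "m - n"] by simp

text \<open>\<open>r\<close> is the fact missing from a copy, and \<open>None\<close> an intact
  copy, whose defect counts as infinitely far away.\<close>

definition far :: "'r inst \<Rightarrow> nat \<Rightarrow> nat \<Rightarrow> ('r \<times> nat list) option \<Rightarrow> bool" where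
  "far A n x r \<longleftrightarrow> (\<forall>f. r = Some f \<longrightarrow> (\<forall>y\<in>set (snd f). \<not> near A n x y))"

lemma far_None: "far A n x None"
  by (simp add: far_def)

lemma far_shift: "far A (n + m) x r \<Longrightarrow> near A n x y \<Longrightarrow> far A m y r"
  unfolding far_def using near_add by blast

lemma far_mono: "far A m x r \<Longrightarrow> n \<le> m \<Longrightarrow> far A n x r"
  unfolding far_def using near_mono by blast

lemma far_notin_near: "far A n x (Some f) \<Longrightarrow> near A n x y \<Longrightarrow> y \<notin> set (snd f)"
  unfolding far_def by blast

text \<open>The disjoint union, over the indices \<open>c \<in> K\<close>, of copies of \<open>A\<close> from which the fact
  \<open>rem c\<close> (if any) is removed; the element \<open>x\<close> of the copy with index \<open>c\<close> is \<open>prod_encode (c, x)\<close>.\<close>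

definition clones :: "'r inst \<Rightarrow> (nat \<Rightarrow> ('r \<times> nat list) option) \<Rightarrow> nat set \<Rightarrow> 'r inst" where
  "clones A rem K = (\<Union>c\<in>K. rename (\<lambda>x. prod_encode (c, x)) {f \<in> A. rem c \<noteq> Some f})"

definition co :: "nat \<Rightarrow> nat" where "co z = fst (prod_decode z)"
definition el :: "nat \<Rightarrow> nat" where "el z = snd (prod_decode z)"

lemma co_el [simp]: "co (prod_encode (c, x)) = c" "el (prod_encode (c, x)) = x" "prod_encode (co z, el z) = z"
  by (simp_all add: co_def el_def)

lemma clones_iff: "(R, t) \<in> clones A rem K \<longleftrightarrow>
   (\<exists>c\<in>K. \<exists>s. (R, s) \<in> A \<and> rem c \<noteq> Some (R, s) \<and> t = map (\<lambda>x. prod_encode (c, x)) s)"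
  unfolding clones_def UN_iff rename_iff by blast

lemma adom_clones: "z \<in> adom (clones A rem K) \<longleftrightarrow>
   co z \<in> K \<and> (\<exists>f\<in>A. rem (co z) \<noteq> Some f \<and> el z \<in> set (snd f))"
proof
  assume "z \<in> adom (clones A rem K)"
  then obtain R t where t: "(R, t) \<in> clones A rem K" "z \<in> set t" unfolding adom_iff by blast
  then obtain c s where s: "c \<in> K" "(R, s) \<in> A" "rem c \<noteq> Some (R, s)" "t = map (\<lambda>x. prod_encode (c, x)) s"
    unfolding clones_iff by blast
  then obtain x where x: "x \<in> set s" "z = prod_encode (c, x)" using t(2) by auto
  show "co z \<in> K \<and> (\<exists>f\<in>A. rem (co z) \<noteq> Some f \<and> el z \<in> set (snd f))"
    unfolding x(2) co_el using s x(1) by (intro conjI bexI[of _ "(R, s)"]) simp_all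
next
  assume a: "co z \<in> K \<and> (\<exists>f\<in>A. rem (co z) \<noteq> Some f \<and> el z \<in> set (snd f))"
  then obtain f where f: "f \<in> A" "rem (co z) \<noteq> Some f" "el z \<in> set (snd f)" by blast
  have "(fst f, map (\<lambda>x. prod_encode (co z, x)) (snd f)) \<in> clones A rem K"
    unfolding clones_iff using a f(1,2) by (intro bexI[of _ "co z"] exI[of _ "snd f"]) simp_all
  moreover have "prod_encode (co z, el z) \<in> set (map (\<lambda>x. prod_encode (co z, x)) (snd f))"
    using f(3) unfolding set_map by (rule imageI)
  ultimately show "z \<in> adom (clones A rem K)" unfolding co_el by (rule in_adom)
qed

primrec qr :: "'r fo \<Rightarrow> nat" where
  "qr FTrue = 0"
| "qr (FAtom R xs) = 0"
| "qr (FEq x y) = 0"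
| "qr (FNot \<phi>) = qr \<phi>"
| "qr (FAnd \<phi> \<psi>) = max (qr \<phi>) (qr \<psi>)"
| "qr (FEx x \<phi>) = Suc (qr \<phi>)"

text \<open>\<open>spread\<close> is the failure of bounded radius, to be refuted later. It allows
  an intact copy to be imitated near any of its elements by a copy whose missing fact is out of
  sight.\<close>

locale clone_game =
  fixes A :: "'r inst" and rem :: "nat \<Rightarrow> ('r \<times> nat list) option" and q :: nat
  assumes ne: "\<And>f. f \<in> A \<Longrightarrow> snd f \<noteq> []"
    and rem: "\<And>c f. rem c = Some f \<Longrightarrow> f \<in> A"
    and spread: "\<And>x. x \<in> adom A \<Longrightarrow> \<exists>f\<in>A. far A (2 ^ q) x (Some f)"
begin

text \<open>Each fact is missing from at least \<open>q\<close> of the copies. It is phrased by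
  avoidance because the game asks for a copy that none of the fewer than \<open>q\<close> earlier
  moves has touched.\<close>

definition rich :: "nat set \<Rightarrow> bool" where
  "rich K \<longleftrightarrow> (\<forall>f\<in>A. \<forall>U. finite U \<longrightarrow> card U < q \<longrightarrow> (\<exists>c\<in>K - U. rem c = Some f))"

definition alike :: "nat \<Rightarrow> nat \<Rightarrow> nat \<Rightarrow> nat \<Rightarrow> bool" where
  "alike n x c c' \<longleftrightarrow> rem c = rem c' \<or> far A (2 ^ n) x (rem c) \<and> far A (2 ^ n) x (rem c')"

text \<open>The invariant of the Ehrenfeucht-Fraisse game with \<open>n\<close> rounds left: corresponding elements
  are copies of the same element of \<open>A\<close>, no difference between their components is visible
  within distance \<open>2 ^ n\<close>, and within this distance the components match.\<close>

definition inv :: "nat \<Rightarrow> nat set \<Rightarrow> (nat \<Rightarrow> nat) \<Rightarrow> (nat \<Rightarrow> nat) \<Rightarrow> nat set \<Rightarrow> nat set \<Rightarrow> bool" where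
  "inv n V \<rho> \<rho>' K K' \<longleftrightarrow> finite V \<and> card V + n \<le> q \<and>
     (\<forall>v\<in>V. el (\<rho> v) = el (\<rho>' v) \<and> co (\<rho> v) \<in> K \<and> co (\<rho>' v) \<in> K' \<and> alike n (el (\<rho> v)) (co (\<rho> v)) (co (\<rho>' v))) \<and>
     (\<forall>u\<in>V. \<forall>v\<in>V. near A (2 ^ n) (el (\<rho> u)) (el (\<rho> v)) \<longrightarrow> (co (\<rho> u) = co (\<rho> v) \<longleftrightarrow> co (\<rho>' u) = co (\<rho>' v)))"

lemma alike_sym: "alike n x c c' \<Longrightarrow> alike n x c' c"
  unfolding alike_def by auto

lemma alike_mono: "alike m x c c' \<Longrightarrow> n \<le> m \<Longrightarrow> alike n x c c'"
  unfolding alike_def using far_mono[of A "2 ^ m" x _ "2 ^ n"] by auto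

lemma alike_fact:
  assumes "alike n x c c'" "f \<in> A" "rem c \<noteq> Some f" "near A (2 ^ n) x y" "y \<in> set (snd f)"
  shows "rem c' \<noteq> Some f"
  using assms far_notin_near[of A "2 ^ n" x f y] unfolding alike_def by auto

lemma invD:
  assumes "inv n V \<rho> \<rho>' K K'"
  shows "finite V" "card V + n \<le> q"
    and "v \<in> V \<Longrightarrow> el (\<rho> v) = el (\<rho>' v)" "v \<in> V \<Longrightarrow> co (\<rho> v) \<in> K" "v \<in> V \<Longrightarrow> co (\<rho>' v) \<in> K'"
    and "v \<in> V \<Longrightarrow> alike n (el (\<rho> v)) (co (\<rho> v)) (co (\<rho>' v))"
    and "u \<in> V \<Longrightarrow> v \<in> V \<Longrightarrow> near A (2 ^ n) (el (\<rho> u)) (el (\<rho> v)) \<Longrightarrow> (co (\<rho> u) = co (\<rho> v) \<longleftrightarrow> co (\<rho>' u) = co (\<rho>' v))"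
  using assms unfolding inv_def by blast+

lemma inv_sym: assumes i: "inv n V \<rho> \<rho>' K K'" shows "inv n V \<rho>' \<rho> K' K"
  unfolding inv_def
proof (intro conjI ballI impI)
  show "finite V" "card V + n \<le> q" using invD(1,2)[OF i] .
  fix v assume v: "v \<in> V"
  show "el (\<rho>' v) = el (\<rho> v)" "co (\<rho>' v) \<in> K'" "co (\<rho> v) \<in> K"
    using invD(3-5)[OF i v] by simp_all
  show "alike n (el (\<rho>' v)) (co (\<rho>' v)) (co (\<rho> v))"
    using alike_sym[OF invD(6)[OF i v]] invD(3)[OF i v] by simp
next
  fix u v assume uv: "u \<in> V" "v \<in> V" "near A (2 ^ n) (el (\<rho>' u)) (el (\<rho>' v))"
  then show "co (\<rho>' u) = co (\<rho>' v) \<longleftrightarrow> co (\<rho> u) = co (\<rho> v)"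
    using invD(7)[OF i uv(1,2)] invD(3)[OF i] by simp
qed

lemma inv_extend:
  assumes i: "inv (Suc n) V \<rho> \<rho>' K K'"
    and a: "co a \<in> K" "co a' \<in> K'" "el a = el a'" "alike n (el a) (co a) (co a')"
    and p: "\<And>u. u \<in> V - {x} \<Longrightarrow> near A (2 ^ n) (el a) (el (\<rho> u)) \<Longrightarrow> (co a = co (\<rho> u) \<longleftrightarrow> co a' = co (\<rho>' u))"
  shows "inv n (insert x V) (\<rho>(x := a)) (\<rho>'(x := a')) K K'"
  unfolding inv_def
proof (intro conjI ballI impI)
  show "finite (insert x V)" using invD(1)[OF i] by simp
  have "card (insert x V) \<le> Suc (card V)" by (rule card_insert_le_m1) simp_all
  then show "card (insert x V) + n \<le> q" using invD(2)[OF i] by simp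
  fix v assume v: "v \<in> insert x V"
  show "el ((\<rho>(x := a)) v) = el ((\<rho>'(x := a')) v)" "co ((\<rho>(x := a)) v) \<in> K" "co ((\<rho>'(x := a')) v) \<in> K'"
    using v a(1-3) invD(3-5)[OF i, of v] by (cases "v = x"; simp)+
  show "alike n (el ((\<rho>(x := a)) v)) (co ((\<rho>(x := a)) v)) (co ((\<rho>'(x := a')) v))"
    using v a(4) alike_mono[OF invD(6)[OF i, of v], of n] by (cases "v = x") simp_all
next
  fix u v assume uv: "u \<in> insert x V" "v \<in> insert x V" "near A (2 ^ n) (el ((\<rho>(x := a)) u)) (el ((\<rho>(x := a)) v))"
  have nm: "near A (2 ^ Suc n) y z" if "near A (2 ^ n) y z" for y z by (rule near_mono[OF that]) simp
  show "(co ((\<rho>(x := a)) u) = co ((\<rho>(x := a)) v)) = (co ((\<rho>'(x := a')) u) = co ((\<rho>'(x := a')) v))"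
  proof (cases "u = x"; cases "v = x")
    assume "u = x" "v = x" then show ?thesis by simp
  next
    assume "u = x" "v \<noteq> x" then show ?thesis using p[of v] uv by simp
  next
    assume h: "u \<noteq> x" "v = x"
    then have "near A (2 ^ n) (el a) (el (\<rho> u))" using uv(3) near_sym by simp
    then have "co a = co (\<rho> u) \<longleftrightarrow> co a' = co (\<rho>' u)" using p[of u] uv(1) h by simp
    then show ?thesis using h by auto
  next
    assume h: "u \<noteq> x" "v \<noteq> x"
    then show ?thesis using invD(7)[OF i, of u v] uv nm by simp
  qed
qed

lemma inv_step:
  assumes i: "inv (Suc n) V \<rho> \<rho>' K K'" and rich: "rich K'" and a: "a \<in> adom (clones A rem K)"
  shows "\<exists>a'\<in>adom (clones A rem K'). inv n (insert x V) (\<rho>(x := a)) (\<rho>'(x := a')) K K'"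
proof -
  obtain g where aK: "co a \<in> K" and g: "g \<in> A" "rem (co a) \<noteq> Some g" "el a \<in> set (snd g)"
    using a unfolding adom_clones by blast
  have two: "(2::nat) ^ Suc n = 2 ^ n + 2 ^ n" by simp
  have al_in: "prod_encode (c', el a) \<in> adom (clones A rem K')" if "c' \<in> K'" "alike n (el a) (co a) c'" for c'
    unfolding adom_clones co_el using that(1) g alike_fact[OF that(2) g(1,2) near_refl g(3)] by blast
  show ?thesis
  \<comment> \<open>An element within \<open>2 ^ n\<close> of an earlier one in the same copy must
    be answered in the partner's copy, and then \<open>2 ^ n + 2 ^ n\<close> is the old radius.
    Otherwise a fresh copy is free to use. The variable \<open>x\<close> is left out since its old
    value is overwritten.\<close>
  proof (cases "\<exists>v\<in>V - {x}. co (\<rho> v) = co a \<and> near A (2 ^ n) (el (\<rho> v)) (el a)")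
    case True
    then obtain v where v: "v \<in> V" "v \<noteq> x" "co (\<rho> v) = co a" "near A (2 ^ n) (el (\<rho> v)) (el a)" by blast
    define c' where "c' = co (\<rho>' v)"
    have c'K: "c' \<in> K'" using invD(5)[OF i v(1)] by (simp add: c'_def)
    have "alike (Suc n) (el (\<rho> v)) (co a) c'" using invD(6)[OF i v(1)] v(3) by (simp add: c'_def)
    then have al: "alike n (el a) (co a) c'"
      using far_shift[OF _ v(4)] unfolding alike_def two by blast
    show ?thesis
    proof (intro bexI[OF _ al_in[OF c'K al]] inv_extend[OF i aK])
      show "co (prod_encode (c', el a)) \<in> K'" "el a = el (prod_encode (c', el a))"
        "alike n (el a) (co a) (co (prod_encode (c', el a)))" using c'K al by simp_all
      fix u assume u: "u \<in> V - {x}" "near A (2 ^ n) (el a) (el (\<rho> u))"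
      have "near A (2 ^ Suc n) (el (\<rho> v)) (el (\<rho> u))" unfolding two using v(4) u(2) by (rule near_add)
      then have "co (\<rho> v) = co (\<rho> u) \<longleftrightarrow> co (\<rho>' v) = co (\<rho>' u)" using invD(7)[OF i v(1)] u(1) by blast
      then show "co a = co (\<rho> u) \<longleftrightarrow> co (prod_encode (c', el a)) = co (\<rho>' u)" using v(3) by (simp add: c'_def)
    qed
  next
    case False
    define U where "U = (\<lambda>v. co (\<rho>' v)) ` V"
    have fU: "finite U" using invD(1)[OF i] by (simp add: U_def)
    have "card U \<le> card V" unfolding U_def using invD(1)[OF i] by (rule card_image_le)
    then have cU: "card U < q" using invD(2)[OF i] by simp
    have "\<exists>c'\<in>K' - U. alike n (el a) (co a) c'"
    proof (cases "rem (co a)")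
      case (Some f)
      then obtain c' where "c' \<in> K' - U" "rem c' = Some f" using rich rem[OF Some] fU cU unfolding rich_def by blast
      then show ?thesis using Some by (intro bexI[of _ c']) (simp_all add: alike_def)
    next
      \<comment> \<open>An intact copy is answered by a damaged one whose missing fact is too far
        away to be noticed in the remaining rounds.\<close>
      case None
      have "el a \<in> adom A" using g(1,3) unfolding adom_iff2 by blast
      then obtain f where f: "f \<in> A" "far A (2 ^ q) (el a) (Some f)" using spread by blast
      then obtain c' where c': "c' \<in> K' - U" "rem c' = Some f" using rich fU cU unfolding rich_def by blast
      have "(2::nat) ^ n \<le> 2 ^ q" using invD(2)[OF i] by (intro power_increasing) simp_all
      then have "far A (2 ^ n) (el a) (rem c')" unfolding c'(2) by (rule far_mono[OF f(2)])
      then show ?thesis using c'(1) None by (intro bexI[of _ c']) (simp_all add: alike_def far_None)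
    qed
    then obtain c' where c': "c' \<in> K'" "c' \<notin> U" "alike n (el a) (co a) c'" by blast
    show ?thesis
    proof (intro bexI[OF _ al_in[OF c'(1,3)]] inv_extend[OF i aK])
      show "co (prod_encode (c', el a)) \<in> K'" "el a = el (prod_encode (c', el a))"
        "alike n (el a) (co a) (co (prod_encode (c', el a)))" using c' by simp_all
      fix u assume u: "u \<in> V - {x}" "near A (2 ^ n) (el a) (el (\<rho> u))"
      have "co a \<noteq> co (\<rho> u)" using False u near_sym[OF u(2)] by auto
      moreover have "c' \<noteq> co (\<rho>' u)" using c'(2) u(1) unfolding U_def by blast
      ultimately show "co a = co (\<rho> u) \<longleftrightarrow> co (prod_encode (c', el a)) = co (\<rho>' u)" by simp
    qed
  qed
qed

text \<open>The elements of a fact are within distance 1 of its first one, so their partners lie in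
  one copy. The fact is present there, because a missing fact through this element would not be
  far.\<close>

lemma inv_atom:
  assumes i: "inv n V \<rho> \<rho>' K K'" and xs: "set xs \<subseteq> V" and at: "(R, map \<rho> xs) \<in> clones A rem K"
  shows "(R, map \<rho>' xs) \<in> clones A rem K'"
proof -
  obtain c s where s: "c \<in> K" "(R, s) \<in> A" "rem c \<noteq> Some (R, s)" "map \<rho> xs = map (\<lambda>x. prod_encode (c, x)) s"
    using at unfolding clones_iff by blast
  have len: "length xs = length s" using s(4) by (metis length_map)
  have \<rho>: "\<rho> (xs ! j) = prod_encode (c, s ! j)" if "j < length xs" for j
    using arg_cong[OF s(4), of "\<lambda>l. l ! j"] that len by simp
  have l0: "0 < length xs" using ne[OF s(2)] len by simp
  define v where "v = xs ! 0"
  have vV: "v \<in> V" using xs l0 nth_mem[of 0 xs] by (auto simp: v_def)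
  have v: "co (\<rho> v) = c" "el (\<rho> v) = s ! 0" using \<rho>[OF l0] by (simp_all add: v_def)
  have nr: "near A (2 ^ n) (s ! 0) (s ! j)" if "j < length s" for j
  proof -
    have "adj A (s ! 0) (s ! j)" unfolding adj_def using s(2) that nth_mem[of 0 s] nth_mem[of j s] l0 len
      by (intro disjI2 bexI[of _ "(R, s)"]) simp_all
    then have "near A 1 (s ! 0) (s ! j)" unfolding near_1 .
    then show ?thesis by (rule near_mono) simp
  qed
  have co': "co (\<rho>' (xs ! j)) = co (\<rho>' v)" "el (\<rho>' (xs ! j)) = s ! j" if j: "j < length xs" for j
  proof -
    have xV: "xs ! j \<in> V" using xs nth_mem[OF j] by blast
    have "co (\<rho> v) = co (\<rho> (xs ! j))" using v(1) \<rho>[OF j] by simp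
    moreover have "near A (2 ^ n) (el (\<rho> v)) (el (\<rho> (xs ! j)))" using nr[of j] j len v(2) \<rho>[OF j] by simp
    ultimately show "co (\<rho>' (xs ! j)) = co (\<rho>' v)" using invD(7)[OF i vV xV] by simp
    show "el (\<rho>' (xs ! j)) = s ! j" using invD(3)[OF i xV] \<rho>[OF j] by simp
  qed
  have m: "map \<rho>' xs = map (\<lambda>x. prod_encode (co (\<rho>' v), x)) s"
  proof (rule nth_equalityI)
    show "length (map \<rho>' xs) = length (map (\<lambda>x. prod_encode (co (\<rho>' v), x)) s)" using len by simp
    fix j assume "j < length (map \<rho>' xs)"
    then have j: "j < length xs" by simp
    have "\<rho>' (xs ! j) = prod_encode (co (\<rho>' (xs ! j)), el (\<rho>' (xs ! j)))" by simp
    also have "\<dots> = prod_encode (co (\<rho>' v), s ! j)" unfolding co'[OF j] ..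
    finally show "map \<rho>' xs ! j = map (\<lambda>x. prod_encode (co (\<rho>' v), x)) s ! j" using j len by simp
  qed
  have "alike n (s ! 0) c (co (\<rho>' v))" using invD(6)[OF i vV] v by simp
  then have "rem (co (\<rho>' v)) \<noteq> Some (R, s)"
    using alike_fact[OF _ s(2,3) near_refl, of n "s ! 0" "co (\<rho>' v)"] l0 len by simp
  then show ?thesis unfolding m clones_iff using invD(5)[OF i vV] s(2) by blast
qed

lemma inv_sat:
  assumes "rich K" "rich K'"
  shows "inv n V \<rho> \<rho>' K K' \<Longrightarrow> qr \<phi> \<le> n \<Longrightarrow> fv \<phi> \<subseteq> V \<Longrightarrow> sat (clones A rem K) \<rho> \<phi> \<longleftrightarrow> sat (clones A rem K') \<rho>' \<phi>"
proof (induction \<phi> arbitrary: n V \<rho> \<rho>')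
  case FTrue
  then show ?case by simp
next
  case (FAtom R xs)
  have x: "set xs \<subseteq> V" using FAtom.prems(3) by simp
  show ?case using inv_atom[OF FAtom.prems(1) x] inv_atom[OF inv_sym[OF FAtom.prems(1)] x] by auto
next
  case (FEq x y)
  have xy: "x \<in> V" "y \<in> V" using FEq.prems(3) by simp_all
  have d: "z = z' \<longleftrightarrow> el z = el z' \<and> co z = co z'" for z z' using co_el(3) by metis
  have e: "el (\<rho> x) = el (\<rho>' x)" "el (\<rho> y) = el (\<rho>' y)" using invD(3)[OF FEq.prems(1)] xy by blast+
  have "co (\<rho> x) = co (\<rho> y) \<longleftrightarrow> co (\<rho>' x) = co (\<rho>' y)" if "el (\<rho> x) = el (\<rho> y)"
    using invD(7)[OF FEq.prems(1) xy] that near_refl[of A "2 ^ n" "el (\<rho> y)"] by simp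
  then show ?case using e unfolding sat.simps d[of "\<rho> x" "\<rho> y"] d[of "\<rho>' x" "\<rho>' y"] by auto
next
  case (FNot \<phi>)
  have "sat (clones A rem K) \<rho> \<phi> \<longleftrightarrow> sat (clones A rem K') \<rho>' \<phi>"
    by (rule FNot.IH[OF FNot.prems(1)]) (use FNot.prems(2,3) in simp_all)
  then show ?case by simp
next
  case (FAnd \<phi> \<psi>)
  have "sat (clones A rem K) \<rho> \<phi> \<longleftrightarrow> sat (clones A rem K') \<rho>' \<phi>"
    by (rule FAnd.IH(1)[OF FAnd.prems(1)]) (use FAnd.prems(2,3) in simp_all)
  moreover have "sat (clones A rem K) \<rho> \<psi> \<longleftrightarrow> sat (clones A rem K') \<rho>' \<psi>"
    by (rule FAnd.IH(2)[OF FAnd.prems(1)]) (use FAnd.prems(2,3) in simp_all)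
  ultimately show ?case by simp
next
  case (FEx x \<phi>)
  obtain m where n: "n = Suc m" "qr \<phi> \<le> m" using FEx.prems(2) by (cases n) simp_all
  have V: "fv \<phi> \<subseteq> insert x V" using FEx.prems(3) by auto
  have i: "inv (Suc m) V \<rho> \<rho>' K K'" using FEx.prems(1) n(1) by simp
  show ?case
  proof
    assume "sat (clones A rem K) \<rho> (FEx x \<phi>)"
    then obtain a where a: "a \<in> adom (clones A rem K)" "sat (clones A rem K) (\<rho>(x := a)) \<phi>" by auto
    obtain a' where a': "a' \<in> adom (clones A rem K')" "inv m (insert x V) (\<rho>(x := a)) (\<rho>'(x := a')) K K'"
      using inv_step[OF i assms(2) a(1)] by blast
    then show "sat (clones A rem K') \<rho>' (FEx x \<phi>)" unfolding sat.simps using FEx.IH[OF a'(2) n(2) V] a(2) a'(1) by blast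
  next
    assume "sat (clones A rem K') \<rho>' (FEx x \<phi>)"
    then obtain a where a: "a \<in> adom (clones A rem K')" "sat (clones A rem K') (\<rho>'(x := a)) \<phi>" by auto
    obtain a' where a': "a' \<in> adom (clones A rem K)" "inv m (insert x V) (\<rho>'(x := a)) (\<rho>(x := a')) K' K"
      using inv_step[OF inv_sym[OF i] assms(1) a(1)] by blast
    then show "sat (clones A rem K) \<rho> (FEx x \<phi>)" unfolding sat.simps using FEx.IH[OF inv_sym[OF a'(2)] n(2) V] a(2) a'(1) by blast
  qed
qed

lemma sat_clones:
  assumes "rich K" "rich K'" "qr \<phi> \<le> q" "fv \<phi> = {}"
  shows "sat (clones A rem K) \<rho> \<phi> \<longleftrightarrow> sat (clones A rem K') \<rho> \<phi>"
proof (rule inv_sat[OF assms(1,2) _ assms(3)])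
  show "inv q {} \<rho> \<rho> K K'" by (simp add: inv_def)
qed (simp add: assms(4))

end

lemma clones_inst: "A \<in> insts sig ar \<Longrightarrow> finite K \<Longrightarrow> clones A rem K \<in> insts sig ar"
  unfolding clones_def insts_def is_inst_def rename_def by auto

text \<open>Otherwise a large number of copies of all the instances \<open>A - {f}\<close> maps to \<open>B\<close>, but
  satisfies \<open>\<phi>\<close> if and only if it does so together with a copy of \<open>A\<close>.\<close>

lemma critical_obstruction_radius:
  assumes sch: "schema sig ar" and A: "A \<in> insts sig ar"
    and \<phi>: "fv \<phi> = {}" "\<And>D. D \<in> insts sig ar \<Longrightarrow> hom_ex D B \<longleftrightarrow> sat D (\<lambda>_. 0) \<phi>"
    and AB: "\<not> hom_ex A B" and crit: "\<And>f. f \<in> A \<Longrightarrow> hom_ex (A - {f}) B"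
  obtains x where "x \<in> adom A" "\<And>f. f \<in> A \<Longrightarrow> \<exists>y\<in>set (snd f). near A (2 ^ qr \<phi>) x y"
proof -
  define q where "q = qr \<phi>"
  have "\<exists>x\<in>adom A. \<forall>f\<in>A. \<exists>y\<in>set (snd f). near A (2 ^ q) x y"
  proof (rule ccontr)
    assume no: "\<not> ?thesis"
    have spread: "\<exists>f\<in>A. far A (2 ^ q) x (Some f)" if "x \<in> adom A" for x
      using no that unfolding far_def by auto
    obtain fs where fs: "set fs = A" using finite_list[OF inst_finite[OF A]] by blast
    define m where "m = length fs"
    have "A \<noteq> {}" using AB by (auto simp: hom_ex_iff hom_def)
    then have m: "m > 0" using fs by (auto simp: m_def)
    \<comment> \<open>The indices below \<open>q * m\<close> run \<open>q\<close> times through the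
      list of facts, so every fact is missing from at least \<open>q\<close> copies. The index
      \<open>q * m\<close> is reserved for the intact copy.\<close>
    define rem where "rem c = (if c < q * m then Some (fs ! (c mod m)) else None)" for c
    have remA: "f \<in> A" if "rem c = Some f" for c f
    proof -
      have "f = fs ! (c mod m)" using that by (simp add: rem_def split: if_splits)
      moreover have "c mod m < length fs" using m by (simp add: m_def)
      ultimately show ?thesis using fs nth_mem by blast
    qed
    interpret clone_game A rem q
      using inst_nonempty[OF sch A] remA spread by unfold_locales
    have rich: "rich K" if K: "{..<q * m} \<subseteq> K" for K
      unfolding rich_def
    proof (intro ballI allI impI)
      fix f and U :: "nat set" assume f: "f \<in> A" and U: "finite U" "card U < q"
      obtain j where j: "j < m" "fs ! j = f" using f fs unfolding m_def by (metis in_set_conv_nth)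
      define J where "J = (\<lambda>i. j + i * m) ` {..<q}"
      have "card J = q" unfolding J_def using m by (subst card_image) (auto simp: inj_on_def)
      then have "\<not> J \<subseteq> U" using card_mono[OF U(1), of J] U(2) by auto
      then obtain i where i: "i < q" "j + i * m \<notin> U" unfolding J_def by blast
      have lt: "j + i * m < q * m"
      proof -
        have "j + i * m < Suc i * m" using j(1) by simp
        also have "\<dots> \<le> q * m" using i(1) by (intro mult_le_mono1) simp
        finally show ?thesis .
      qed
      have "rem (j + i * m) = Some f" using lt j by (simp add: rem_def)
      moreover have "j + i * m \<in> K - U" using lt K i(2) by blast
      ultimately show "\<exists>c\<in>K - U. rem c = Some f" by blast
    qed
    define W where "W = clones A rem {..<q * m}"
    define E where "E = clones A rem {..q * m}"
    have WE: "W \<in> insts sig ar" "E \<in> insts sig ar" using clones_inst[OF A] by (simp_all add: W_def E_def)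
    have "sat W (\<lambda>_. 0) \<phi> \<longleftrightarrow> sat E (\<lambda>_. 0) \<phi>"
      unfolding W_def E_def by (rule sat_clones[OF rich rich _ \<phi>(1)]) (auto simp: q_def)
    then have eq: "hom_ex W B \<longleftrightarrow> hom_ex E B" using \<phi>(2) WE by simp
    have "hom_ex W B"
    proof -
      have "\<forall>c. \<exists>h. c < q * m \<longrightarrow> hom h {f \<in> A. rem c \<noteq> Some f} B"
      proof
        fix c
        show "\<exists>h. c < q * m \<longrightarrow> hom h {f \<in> A. rem c \<noteq> Some f} B"
        proof (cases "c < q * m")
          case True
          then have r: "rem c = Some (fs ! (c mod m))" by (simp add: rem_def)
          then have "hom_ex (A - {fs ! (c mod m)}) B" using crit remA by blast
          moreover have "{f \<in> A. rem c \<noteq> Some f} = A - {fs ! (c mod m)}" unfolding r by blast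
          ultimately show ?thesis unfolding hom_ex_iff by auto
        qed simp
      qed
      from choice[OF this] obtain h where h: "\<forall>c. c < q * m \<longrightarrow> hom (h c) {f \<in> A. rem c \<noteq> Some f} B" ..
      have "hom (\<lambda>z. h (co z) (el z)) W B" unfolding hom_def
      proof (intro allI impI)
        fix R t assume "(R, t) \<in> W"
        then obtain c s where s: "c < q * m" "(R, s) \<in> A" "rem c \<noteq> Some (R, s)" "t = map (\<lambda>x. prod_encode (c, x)) s"
          unfolding W_def clones_iff by blast
        have "map (\<lambda>z. h (co z) (el z)) t = map (h c) s" unfolding s(4) by simp
        moreover have "(R, map (h c) s) \<in> B" using h s unfolding hom_def by blast
        ultimately show "(R, map (\<lambda>z. h (co z) (el z)) t) \<in> B" by simp
      qed
      then show ?thesis unfolding hom_ex_iff by blast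
    qed
    then have "hom_ex E B" using eq by simp
    moreover have "hom (\<lambda>x. prod_encode (q * m, x)) A E" unfolding hom_def E_def clones_iff
    proof (intro allI impI)
      fix R t assume "(R, t) \<in> A"
      then show "\<exists>c\<in>{..q * m}. \<exists>s. (R, s) \<in> A \<and> rem c \<noteq> Some (R, s) \<and> map (\<lambda>x. prod_encode (q * m, x)) t = map (\<lambda>x. prod_encode (c, x)) s"
        by (intro bexI[of _ "q * m"] exI[of _ t]) (simp_all add: rem_def)
    qed
    ultimately have "hom_ex A B" using hom_ex_trans unfolding hom_ex_iff by blast
    then show False using AB by blast
  qed
  then show thesis using that unfolding q_def by blast
qed

section \<open>Finite tree duality for first-order definable CSPs\<close>

inductive grown :: "nat \<Rightarrow> 'r inst \<Rightarrow> bool" for a where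
  empty: "grown a {}"
| insert: "grown a Q \<Longrightarrow> f \<notin> Q \<Longrightarrow> set (snd f) \<inter> insert a (adom Q) \<noteq> {} \<Longrightarrow> grown a (insert f Q)"

lemma grown_insert: "grown a Q \<Longrightarrow> x \<in> set (snd f) \<Longrightarrow> x \<in> insert a (adom Q) \<Longrightarrow> grown a (insert f Q)"
proof (cases "f \<in> Q")
  case False
  assume "grown a Q" "x \<in> set (snd f)" "x \<in> insert a (adom Q)"
  then show ?thesis using False by (intro grown.insert) auto
qed (simp add: insert_absorb)

lemma grown_finite: "grown a Q \<Longrightarrow> finite Q"
  by (induction rule: grown.induct) auto

lemma grown_Un: "grown a Q' \<Longrightarrow> grown a Q \<Longrightarrow> grown a (Q \<union> Q')"
proof (induction rule: grown.induct)
  case (insert Q' f)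
  obtain x where "x \<in> set (snd f)" "x \<in> insert a (adom Q')" using insert.hyps(3) by blast
  then have "grown a (insert f (Q \<union> Q'))" using insert.IH[OF insert.prems]
    by (intro grown_insert) (auto simp: adom_Un)
  then show ?case by simp
qed simp

text \<open>A bound in the direction opposite to sparsity: each fact added shares at least one
  element with \<open>a\<close> or the earlier facts. Only a slack of one is left between the two,
  so one surplus incidence is contradictory.\<close>

lemma grown_bound: "grown a Q \<Longrightarrow> card (insert a (adom Q)) + card Q \<le> 1 + (\<Sum>f\<in>Q. length (snd f))"
proof (induction rule: grown.induct)
  case (insert Q f)
  have fQ: "finite Q" using grown_finite[OF insert.hyps(1)] .
  let ?I = "insert a (adom Q)"
  have "card (set (snd f) \<inter> ?I) \<noteq> 0" using insert.hyps(3) fQ by simp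
  moreover have "card (set (snd f) \<union> ?I) + card (set (snd f) \<inter> ?I) = card (set (snd f)) + card ?I"
    using fQ by (intro card_Un_Int[symmetric]) simp_all
  moreover have eq: "insert a (adom (insert f Q)) = set (snd f) \<union> ?I" by (auto simp: adom_insert)
  ultimately have "card (insert a (adom (insert f Q))) + 1 \<le> length (snd f) + card ?I"
    unfolding eq using card_length[of "snd f"] by linarith
  then show ?case using insert.IH insert.hyps(2) fQ by simp
qed simp

lemma grown_prefix:
  "grown a Q \<Longrightarrow> f \<in> Q \<Longrightarrow> \<exists>Q'. Q' \<subseteq> Q - {f} \<and> grown a Q' \<and> set (snd f) \<inter> insert a (adom Q') \<noteq> {}"
proof (induction rule: grown.induct)
  case (insert Q g)
  show ?case
  proof (cases "f = g")
    case True
    then show ?thesis using insert.hyps by (intro exI[of _ Q]) auto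
  next
    case False
    then obtain Q' where "Q' \<subseteq> Q - {f}" "grown a Q'" "set (snd f) \<inter> insert a (adom Q') \<noteq> {}"
      using insert.IH insert.prems by blast
    then show ?thesis by (intro exI[of _ Q']) auto
  qed
qed simp

text \<open>Distance from \<open>a\<close>, measured by sets of facts instead of paths: such sets
  are closed under union and can be counted directly by \<open>grown_bound\<close>.\<close>

definition reach :: "'r inst \<Rightarrow> nat \<Rightarrow> nat \<Rightarrow> nat \<Rightarrow> bool" where
  "reach A a n y \<longleftrightarrow> (\<exists>Q\<subseteq>A. grown a Q \<and> card Q \<le> n \<and> y \<in> insert a (adom Q))"

lemma near_reach: "near A n a y \<Longrightarrow> reach A a n y"
proof (induction n arbitrary: y)
  case 0
  then show ?case unfolding reach_def by (intro exI[of _ "{}"]) (simp add: grown.empty)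
next
  case (Suc n)
  then obtain z where z: "near A n a z" "adj A z y" by auto
  obtain Q where Q: "Q \<subseteq> A" "grown a Q" "card Q \<le> n" "z \<in> insert a (adom Q)"
    using Suc.IH[OF z(1)] unfolding reach_def by blast
  show ?case
  proof (cases "z = y")
    case True
    then show ?thesis using Q unfolding reach_def by (intro exI[of _ Q]) simp
  next
    case False
    then obtain f where f: "f \<in> A" "z \<in> set (snd f)" "y \<in> set (snd f)" using z(2) unfolding adj_def by blast
    have "grown a (insert f Q)" using grown_insert[OF Q(2) f(2) Q(4)] .
    moreover have "card (insert f Q) \<le> Suc n" using Q(3) card_insert_le_m1[of "Suc n" Q f] by simp
    moreover have "y \<in> adom (insert f Q)" using f(3) by (simp add: adom_insert)
    ultimately show ?thesis using f(1) Q(1) unfolding reach_def by (intro exI[of _ "insert f Q"]) simp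
  qed
qed

section \<open>Arc consistency and its witnesses\<close>

text \<open>The values left for \<open>x\<close> after \<open>n\<close> rounds of arc consistency.
  Starting from \<open>UNIV\<close> is harmless, as one round confines every element of
  \<open>adom A\<close> to \<open>adom B\<close>.\<close>

primrec arc_list :: "'r inst \<Rightarrow> 'r inst \<Rightarrow> nat \<Rightarrow> nat \<Rightarrow> nat set" where
  "arc_list A B 0 x = UNIV"
| "arc_list A B (Suc n) x = {b. \<forall>f\<in>A. \<forall>p<length (snd f). snd f ! p = x \<longrightarrow>
     (\<exists>bs. (fst f, bs) \<in> B \<and> length bs = length (snd f) \<and> bs ! p = b \<and>
        (\<forall>j<length (snd f). j \<noteq> p \<longrightarrow> bs ! j \<in> arc_list A B n (snd f ! j)))}"

text \<open>One fact places \<open>x\<close> in \<open>adom B\<close>; each of at most \<beta>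
  deleted values costs one more fact and at most \<open>m\<close> witness sets of the previous
  round.\<close>

primrec witness_bound :: "nat \<Rightarrow> nat \<Rightarrow> nat \<Rightarrow> nat" where
  "witness_bound \<beta> m 0 = 0"
| "witness_bound \<beta> m (Suc n) = 1 + \<beta> * (1 + m * witness_bound \<beta> m n)"

text \<open>Deleting \<open>b\<close> from the list of \<open>x\<close> needs only one fact at \<open>x\<close> and the reasons why the
  elements at its other positions have the lists they have.\<close>

lemma arc_list_witness:
  assumes finB: "finite B" and m: "\<And>f. f \<in> A \<Longrightarrow> length (snd f) \<le> m"
  shows "x \<in> adom A \<Longrightarrow> \<exists>T\<subseteq>A. finite T \<and> card T \<le> witness_bound (card (adom B)) m n \<and> (\<forall>h. hom h T B \<longrightarrow> h x \<in> arc_list A B n x)"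
proof (induction n arbitrary: x)
  case 0
  then show ?case by (intro exI[of _ "{}"]) simp
next
  case (Suc n)
  let ?s = "witness_bound (card (adom B)) m n"
  have "\<forall>y. \<exists>T. y \<in> adom A \<longrightarrow> T \<subseteq> A \<and> finite T \<and> card T \<le> ?s \<and> (\<forall>h. hom h T B \<longrightarrow> h y \<in> arc_list A B n y)"
    using Suc.IH by blast
  from choice[OF this] obtain T where T: "\<forall>y. y \<in> adom A \<longrightarrow> T y \<subseteq> A \<and> finite (T y) \<and> card (T y) \<le> ?s \<and>
      (\<forall>h. hom h (T y) B \<longrightarrow> h y \<in> arc_list A B n y)" ..
  have T1: "T y \<subseteq> A" "finite (T y)" "card (T y) \<le> ?s" if "y \<in> adom A" for y using T that by simp_all
  have T2: "h y \<in> arc_list A B n y" if "y \<in> adom A" "hom h (T y) B" for h y using T that by blast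
  \<comment> \<open>Including \<open>f0\<close> forces \<open>h x\<close> into
    \<open>adom B\<close>, so that reasons are needed only for finitely many values.\<close>
  obtain f0 where f0: "f0 \<in> A" "x \<in> set (snd f0)" using Suc.prems unfolding adom_iff2 by blast
  define bad where "bad = adom B - arc_list A B (Suc n) x"
  have fbad: "finite bad" "card bad \<le> card (adom B)"
    using finB by (auto simp: bad_def intro: card_mono)
  define fails where "fails b fp \<longleftrightarrow> fst fp \<in> A \<and> snd fp < length (snd (fst fp)) \<and> snd (fst fp) ! snd fp = x \<and>
     \<not> (\<exists>bs. (fst (fst fp), bs) \<in> B \<and> length bs = length (snd (fst fp)) \<and> bs ! snd fp = b \<and>
        (\<forall>j<length (snd (fst fp)). j \<noteq> snd fp \<longrightarrow> bs ! j \<in> arc_list A B n (snd (fst fp) ! j)))" for b fp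
  have "\<forall>b. \<exists>fp. b \<in> bad \<longrightarrow> fails b fp"
  proof (intro allI)
    fix b
    show "\<exists>fp. b \<in> bad \<longrightarrow> fails b fp"
    proof (cases "b \<in> bad")
      case True
      then have "b \<notin> arc_list A B (Suc n) x" by (simp add: bad_def)
      then obtain f p where "f \<in> A" "p < length (snd f)" "snd f ! p = x"
        "\<not> (\<exists>bs. (fst f, bs) \<in> B \<and> length bs = length (snd f) \<and> bs ! p = b \<and>
        (\<forall>j<length (snd f). j \<noteq> p \<longrightarrow> bs ! j \<in> arc_list A B n (snd f ! j)))"
        unfolding arc_list.simps mem_Collect_eq by blast
      then have "fails b (f, p)" by (simp add: fails_def)
      then show ?thesis by blast
    qed simp
  qed
  from choice[OF this] obtain fp where fp: "\<And>b. b \<in> bad \<Longrightarrow> fails b (fp b)" by blast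
  define F where "F b = fst (fp b)" for b
  have FA: "F b \<in> A" if "b \<in> bad" for b using fp[OF that] by (simp add: fails_def F_def)
  define S where "S b = insert (F b) (\<Union>j<length (snd (F b)). T (snd (F b) ! j))" for b
  define TT where "TT = insert f0 (\<Union>b\<in>bad. S b)"
  have SA: "S b \<subseteq> A" "finite (S b)" "card (S b) \<le> 1 + m * ?s" if b: "b \<in> bad" for b
  proof -
    have e: "snd (F b) ! j \<in> adom A" if "j < length (snd (F b))" for j using nth_adom[OF FA[OF b] that] .
    show "S b \<subseteq> A" unfolding S_def using FA[OF b] T1(1)[OF e] by blast
    show "finite (S b)" unfolding S_def using T1(2)[OF e] by simp
    have "card (\<Union>j<length (snd (F b)). T (snd (F b) ! j)) \<le> (\<Sum>j<length (snd (F b)). card (T (snd (F b) ! j)))"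
      by (rule card_UN_le) simp
    also have "\<dots> \<le> (\<Sum>j<length (snd (F b)). ?s)" by (rule sum_mono) (use T1(3)[OF e] in simp)
    also have "\<dots> \<le> m * ?s" using m[OF FA[OF b]] by simp
    finally show "card (S b) \<le> 1 + m * ?s"
      unfolding S_def using card_insert_le_m1[of "1 + m * ?s" _ "F b"] by simp
  qed
  show ?case
  proof (intro exI[of _ TT] conjI allI impI)
    show "TT \<subseteq> A" unfolding TT_def using f0(1) SA(1) by blast
    show "finite TT" unfolding TT_def using fbad(1) SA(2) by simp
    have "card (\<Union>b\<in>bad. S b) \<le> (\<Sum>b\<in>bad. card (S b))" using fbad(1) by (rule card_UN_le)
    also have "\<dots> \<le> (\<Sum>b\<in>bad. 1 + m * ?s)" by (rule sum_mono) (rule SA(3))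
    also have "\<dots> = card bad * (1 + m * ?s)" by simp
    also have "\<dots> \<le> card (adom B) * (1 + m * ?s)" using fbad(2) by (rule mult_le_mono1)
    finally show "card TT \<le> witness_bound (card (adom B)) m (Suc n)"
      unfolding TT_def using card_insert_le_m1[of "1 + card (adom B) * (1 + m * ?s)" _ f0] by simp
    fix h assume h: "hom h TT B"
    have "hom h {f0} B" by (rule hom_mono[OF h]) (simp_all add: TT_def)
    then have "(fst f0, map h (snd f0)) \<in> B" by (rule hom_fact) simp
    then have hx: "h x \<in> adom B" using in_adom[of "fst f0" "map h (snd f0)" B "h x"] f0(2) by simp
    show "h x \<in> arc_list A B (Suc n) x"
    proof (rule ccontr)
      assume "h x \<notin> arc_list A B (Suc n) x"
      then have b: "h x \<in> bad" using hx unfolding bad_def by blast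
      define p where "p = snd (fp (h x))"
      have p: "p < length (snd (F (h x)))" "snd (F (h x)) ! p = x"
        and nb: "\<And>bs. (fst (F (h x)), bs) \<in> B \<Longrightarrow> length bs = length (snd (F (h x))) \<Longrightarrow> bs ! p = h x \<Longrightarrow>
          (\<And>j. j < length (snd (F (h x))) \<Longrightarrow> j \<noteq> p \<Longrightarrow> bs ! j \<in> arc_list A B n (snd (F (h x)) ! j)) \<Longrightarrow> False"
        using fp[OF b] unfolding fails_def F_def p_def by blast+
      have hS: "hom h (S (h x)) B" by (rule hom_mono[OF h]) (use b in \<open>auto simp: TT_def\<close>)
      have "(fst (F (h x)), map h (snd (F (h x)))) \<in> B" using hS by (rule hom_fact) (simp add: S_def)
      then show False
      proof (rule nb)
        show "map h (snd (F (h x))) ! p = h x" using p by simp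
        fix j assume j: "j < length (snd (F (h x)))" "j \<noteq> p"
        have "T (snd (F (h x)) ! j) \<subseteq> S (h x)" unfolding S_def using j(1) by blast
        then have "hom h (T (snd (F (h x)) ! j)) B" using hom_mono[OF hS] by blast
        then have "h (snd (F (h x)) ! j) \<in> arc_list A B n (snd (F (h x)) ! j)" by (rule T2[OF nth_adom[OF FA[OF b] j(1)]])
        then show "map h (snd (F (h x))) ! j \<in> arc_list A B n (snd (F (h x)) ! j)" using j(1) by simp
      qed simp
    qed
  qed
qed

text \<open>An instance of radius \<open>r\<close> and large girth is a tree: the facts at distance \<open>i\<close> from the
  centre have a single element at distance \<open>i\<close>, and an element at distance \<open>i + 1\<close> lies on a
  single fact at distance \<open>i\<close>.\<close>

locale layered =
  fixes A :: "'r inst" and a r g :: nat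
  assumes ne: "\<And>f. f \<in> A \<Longrightarrow> snd f \<noteq> []"
    and sparse: "sparse g A" and g: "2 * r + 2 \<le> g"
    and radius: "\<And>f. f \<in> A \<Longrightarrow> \<exists>y\<in>set (snd f). reach A a r y"
begin

definition lev :: "nat \<Rightarrow> nat" where "lev y = (LEAST n. reach A a n y)"

definition flev :: "'r \<times> nat list \<Rightarrow> nat" where "flev f = Min (lev ` set (snd f))"

lemma lev_le: "reach A a n y \<Longrightarrow> lev y \<le> n"
  unfolding lev_def by (rule Least_le)

lemma reach_lev: "reach A a n y \<Longrightarrow> reach A a (lev y) y"
  unfolding lev_def by (rule LeastI)

lemma reach_step:
  assumes "reach A a n y" "f \<in> A" "y \<in> set (snd f)" "z \<in> set (snd f)"
  shows "reach A a (Suc n) z"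
proof -
  obtain Q where Q: "Q \<subseteq> A" "grown a Q" "card Q \<le> n" "y \<in> insert a (adom Q)"
    using assms(1) unfolding reach_def by blast
  have "grown a (insert f Q)" using grown_insert[OF Q(2) assms(3) Q(4)] .
  moreover have "card (insert f Q) \<le> Suc n" using Q(3) card_insert_le_m1[of "Suc n" Q f] by simp
  moreover have "z \<in> adom (insert f Q)" using assms(4) by (simp add: adom_insert)
  ultimately show ?thesis using assms(2) Q(1) unfolding reach_def by (intro exI[of _ "insert f Q"]) simp
qed

lemma reach_fact: assumes "f \<in> A" "z \<in> set (snd f)" shows "reach A a (Suc r) z"
  using radius[OF assms(1)] reach_step assms by blast

lemma flev_le_lev: "z \<in> set (snd f) \<Longrightarrow> flev f \<le> lev z"
  unfolding flev_def by simp

lemma flev_ex: assumes "f \<in> A" shows "\<exists>z\<in>set (snd f). lev z = flev f"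
proof -
  have "flev f \<in> lev ` set (snd f)" unfolding flev_def using ne[OF assms] by (intro Min_in) simp_all
  then show ?thesis by auto
qed

lemma flev_le: assumes "f \<in> A" shows "flev f \<le> r"
proof -
  obtain y where y: "y \<in> set (snd f)" "reach A a r y" using radius[OF assms] by blast
  show ?thesis using flev_le_lev[OF y(1)] lev_le[OF y(2)] by simp
qed

lemma lev_le_flev: assumes "f \<in> A" "z \<in> set (snd f)" shows "lev z \<le> Suc (flev f)"
proof -
  obtain y where y: "y \<in> set (snd f)" "lev y = flev f" using flev_ex[OF assms(1)] by blast
  have "reach A a (lev y) y" using reach_lev[OF reach_fact[OF assms(1) y(1)]] .
  from reach_step[OF this assms(1) y(1) assms(2)] show ?thesis using lev_le y(2) by simp
qed

text \<open>Some element of \<open>f\<close> is already reached by a smaller grown subset. Hence a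
  set of \<open>i\<close> facts that reaches an element of level \<open>i\<close> contains no fact
  of level \<open>i\<close> or more.\<close>

lemma grown_flev:
  assumes "Q \<subseteq> A" "grown a Q" "f \<in> Q" shows "flev f < card Q"
proof -
  obtain Q' where Q': "Q' \<subseteq> Q - {f}" "grown a Q'" "set (snd f) \<inter> insert a (adom Q') \<noteq> {}"
    using grown_prefix[OF assms(2,3)] by blast
  have fQ: "finite Q" using grown_finite[OF assms(2)] .
  have "Q' \<subset> Q" using Q'(1) assms(3) by blast
  then have c: "card Q' < card Q" by (rule psubset_card_mono[OF fQ])
  obtain w where w: "w \<in> set (snd f)" "w \<in> insert a (adom Q')" using Q'(3) by blast
  have "reach A a (card Q') w" unfolding reach_def using Q' w(2) assms(1) by blast
  then show ?thesis using c flev_le_lev[OF w(1)] lev_le by (meson le_less_trans order_trans)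
qed

text \<open>A fact attached at two positions adds at most length minus two elements, which together
  with \<open>grown_bound\<close> violates sparsity. Counting positions also covers a fact that
  repeats an element.\<close>

lemma no_double_attachment:
  assumes Q: "Q \<subseteq> A" "grown a Q" "card Q < g" and f: "f \<in> A" "f \<notin> Q"
    and p: "p < length (snd f)" "p' < length (snd f)" "p \<noteq> p'"
      "snd f ! p \<in> insert a (adom Q)" "snd f ! p' \<in> insert a (adom Q)"
  shows False
proof -
  let ?I = "insert a (adom Q)"
  have fQ: "finite Q" using grown_finite[OF Q(2)] .
  have sub: "set (snd f) - ?I \<subseteq> (\<lambda>i. snd f ! i) ` ({..<length (snd f)} - {p, p'})"
  proof
    fix x assume x: "x \<in> set (snd f) - ?I"
    then obtain i where i: "i < length (snd f)" "snd f ! i = x" by (auto simp: in_set_conv_nth)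
    then have "i \<noteq> p" "i \<noteq> p'" using x p(4,5) by blast+
    then show "x \<in> (\<lambda>i. snd f ! i) ` ({..<length (snd f)} - {p, p'})" using i by blast
  qed
  have "card (set (snd f) - ?I) \<le> card ((\<lambda>i. snd f ! i) ` ({..<length (snd f)} - {p, p'}))"
    by (rule card_mono[OF _ sub]) simp
  also have "\<dots> \<le> card ({..<length (snd f)} - {p, p'})" by (rule card_image_le) simp
  also have "\<dots> = length (snd f) - 2" using p by (subst card_Diff_subset) auto
  finally have 1: "card (set (snd f) - ?I) \<le> length (snd f) - 2" .
  have "adom (insert f Q) \<subseteq> (set (snd f) - ?I) \<union> ?I" by (auto simp: adom_insert)
  then have "card (adom (insert f Q)) \<le> card ((set (snd f) - ?I) \<union> ?I)" using fQ by (intro card_mono) simp_all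
  also have "\<dots> \<le> card (set (snd f) - ?I) + card ?I" by (rule card_Un_le)
  finally have 2: "card (adom (insert f Q)) \<le> length (snd f) - 2 + card ?I" using 1 by simp
  have c: "card (insert f Q) = Suc (card Q)" using fQ f(2) by simp
  have "insert f Q \<subseteq> A" "insert f Q \<noteq> {}" "card (insert f Q) \<le> g" using Q f(1) c by auto
  then have "(\<Sum>p\<in>insert f Q. length (snd p)) < card (adom (insert f Q)) + card (insert f Q)"
    using sparse unfolding sparse_def by blast
  then have "length (snd f) + (\<Sum>p\<in>Q. length (snd p)) < card (adom (insert f Q)) + Suc (card Q)"
    using fQ f(2) c by simp
  moreover have "2 \<le> length (snd f)" using p(1-3) by linarith
  ultimately show False using 2 grown_bound[OF Q(2)] by linarith
qed

lemma distinct_fact: assumes "f \<in> A" shows "distinct (snd f)"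
proof -
  have "{f} \<subseteq> A" "{f} \<noteq> {}" "card {f} \<le> g" using assms g by simp_all
  then have "(\<Sum>p\<in>{f}. length (snd p)) < card (adom {f}) + card {f}" using sparse unfolding sparse_def by blast
  then have "length (snd f) \<le> card (set (snd f))" by (simp add: adom_insert)
  then show ?thesis using card_length[of "snd f"] by (intro card_distinct) linarith
qed

lemma lev_path: assumes "f \<in> A" "z \<in> set (snd f)"
  obtains Q where "Q \<subseteq> A" "grown a Q" "card Q \<le> lev z" "z \<in> insert a (adom Q)"
  using reach_lev[OF reach_fact[OF assms]] unfolding reach_def by blast

text \<open>The union of two shortest connections to the centre; by \<open>grown_flev\<close> it
  avoids the facts of level at least \<open>i\<close> that are about to be attached to it.\<close>

lemma two_paths:
  assumes f: "f \<in> A" "y \<in> set (snd f)" "lev y = i" and f': "f' \<in> A" "y' \<in> set (snd f')" "lev y' = i"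
  obtains Q where "Q \<subseteq> A" "grown a Q" "card Q \<le> 2 * i" "y \<in> insert a (adom Q)" "y' \<in> insert a (adom Q)"
    "\<And>e. i \<le> flev e \<Longrightarrow> e \<notin> Q"
proof -
  obtain Q1 where Q1: "Q1 \<subseteq> A" "grown a Q1" "card Q1 \<le> i" "y \<in> insert a (adom Q1)"
    using lev_path[OF f(1,2)] f(3) by metis
  obtain Q2 where Q2: "Q2 \<subseteq> A" "grown a Q2" "card Q2 \<le> i" "y' \<in> insert a (adom Q2)"
    using lev_path[OF f'(1,2)] f'(3) by metis
  show thesis
  proof (rule that)
    show "Q1 \<union> Q2 \<subseteq> A" using Q1 Q2 by blast
    show "grown a (Q1 \<union> Q2)" using Q2(2) Q1(2) by (rule grown_Un)
    show "card (Q1 \<union> Q2) \<le> 2 * i" using card_Un_le[of Q1 Q2] Q1(3) Q2(3) by simp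
    show "y \<in> insert a (adom (Q1 \<union> Q2))" "y' \<in> insert a (adom (Q1 \<union> Q2))"
      using Q1(4) Q2(4) by (auto simp: adom_Un)
    fix e assume e: "i \<le> flev e"
    have "e \<notin> Q1" using grown_flev[OF Q1(1,2), of e] Q1(3) e by linarith
    moreover have "e \<notin> Q2" using grown_flev[OF Q2(1,2), of e] Q2(3) e by linarith
    ultimately show "e \<notin> Q1 \<union> Q2" by blast
  qed
qed

lemma unique_centre:
  assumes f: "f \<in> A" and p: "p < length (snd f)" "p' < length (snd f)" "lev (snd f ! p) = flev f" "lev (snd f ! p') = flev f"
  shows "p = p'"
proof (rule ccontr)
  assume n: "p \<noteq> p'"
  obtain Q where Q: "Q \<subseteq> A" "grown a Q" "card Q \<le> 2 * flev f" "snd f ! p \<in> insert a (adom Q)"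
    "snd f ! p' \<in> insert a (adom Q)" "\<And>e. flev f \<le> flev e \<Longrightarrow> e \<notin> Q"
    using two_paths[OF f nth_mem[OF p(1)] p(3) f nth_mem[OF p(2)] p(4)] by metis
  have "card Q < g" using Q(3) flev_le[OF f] g by linarith
  then show False using no_double_attachment[OF Q(1,2) _ f Q(6) p(1,2) n Q(4,5)] by simp
qed

text \<open>If \<open>x\<close> had two parents, the second would be attached both to the paths and,
  through \<open>x\<close>, to the first. Paths and parents comprise at most
  \<open>2 * r + 2\<close> facts, whence the girth required in the locale.\<close>

lemma unique_parent:
  assumes f: "f \<in> A" "f' \<in> A" "flev f = flev f'" and x: "x \<in> set (snd f)" "x \<in> set (snd f')" "lev x = Suc (flev f)"
  shows "f = f'"
proof (rule ccontr)
  assume n: "f \<noteq> f'"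
  obtain y where y: "y \<in> set (snd f)" "lev y = flev f" using flev_ex[OF f(1)] by blast
  obtain y' where y': "y' \<in> set (snd f')" "lev y' = flev f" using flev_ex[OF f(2)] f(3) by auto
  obtain Q where Q: "Q \<subseteq> A" "grown a Q" "card Q \<le> 2 * flev f" "y \<in> insert a (adom Q)"
    "y' \<in> insert a (adom Q)" "\<And>e. flev f \<le> flev e \<Longrightarrow> e \<notin> Q"
    using two_paths[OF f(1) y f(2) y'] by metis
  have gr: "grown a (insert f Q)" using Q(2) y(1) Q(4) by (rule grown_insert)
  have "card (insert f Q) \<le> Suc (2 * flev f)" using Q(3) card_insert_le_m1[of "Suc (2 * flev f)" Q f] by simp
  then have c: "card (insert f Q) < g" using flev_le[OF f(1)] g by linarith
  have f'Q: "f' \<notin> insert f Q" using n Q(6)[of f'] f(3) by simp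
  obtain p where p: "p < length (snd f')" "snd f' ! p = y'" using y'(1) by (auto simp: in_set_conv_nth)
  obtain p' where p': "p' < length (snd f')" "snd f' ! p' = x" using x(2) by (auto simp: in_set_conv_nth)
  have "p \<noteq> p'" using p(2) p'(2) y'(2) x(3) by auto
  moreover have "snd f' ! p \<in> insert a (adom (insert f Q))" unfolding p(2) using Q(5) by (auto simp: adom_insert)
  moreover have "snd f' ! p' \<in> insert a (adom (insert f Q))" unfolding p'(2) using x(1) by (simp add: adom_insert)
  moreover have "insert f Q \<subseteq> A" using Q(1) f(1) by simp
  ultimately show False using no_double_attachment[OF _ gr c f(2) f'Q p(1) p'(1)] by blast
qed

lemma lev_zero: "reach A a n y \<Longrightarrow> lev y = 0 \<Longrightarrow> y = a"
proof -
  assume r: "reach A a n y" "lev y = 0"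
  then have "reach A a 0 y" using reach_lev[OF r(1)] by simp
  then obtain Q where Q: "grown a Q" "card Q \<le> 0" "y \<in> insert a (adom Q)" "Q \<subseteq> A"
    unfolding reach_def by blast
  then show "y = a" using grown_finite[OF Q(1)] by simp
qed

lemma lev_a: "lev a = 0"
proof -
  have "reach A a 0 a" unfolding reach_def by (intro exI[of _ "{}"]) (simp add: grown.empty)
  then show ?thesis using lev_le by blast
qed

lemma parent_ex:
  assumes x: "x \<in> adom A" "lev x = Suc i"
  obtains f j where "f \<in> A" "flev f = i" "j < length (snd f)" "snd f ! j = x"
proof -
  obtain e where e: "e \<in> A" "x \<in> set (snd e)" using x(1) unfolding adom_iff2 by blast
  obtain Q where Q: "Q \<subseteq> A" "grown a Q" "card Q \<le> lev x" "x \<in> insert a (adom Q)" using lev_path[OF e] by blast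
  have "x \<noteq> a" using x(2) lev_a by auto
  then obtain f where f: "f \<in> Q" "x \<in> set (snd f)" using Q(4) unfolding adom_UN by auto
  have fA: "f \<in> A" using f(1) Q(1) by blast
  have "flev f < Suc i" using grown_flev[OF Q(1,2) f(1)] Q(3) x(2) by linarith
  moreover have "Suc i \<le> Suc (flev f)" using lev_le_flev[OF fA f(2)] x(2) by simp
  ultimately have "flev f = i" by linarith
  then show thesis using that fA f(2) by (metis in_set_conv_nth)
qed

text \<open>Values are chosen level by level away from the centre, each level using up one round.
  Facts have level at most \<open>r\<close>, so \<open>Suc r\<close> rounds leave one for the last
  of them.\<close>

lemma hom_from_lists:
  assumes b: "b \<in> arc_list A B (Suc r) a"
  shows "hom_ex A B"
proof -
  have "\<exists>h. (\<forall>x. x = a \<or> x \<in> adom A \<longrightarrow> lev x \<le> i \<longrightarrow> h x \<in> arc_list A B (Suc r - lev x) x) \<and>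
      (\<forall>f\<in>A. flev f < i \<longrightarrow> (fst f, map h (snd f)) \<in> B)" if "i \<le> Suc r" for i
    using that
  proof (induction i)
    case 0
    show ?case
    proof (intro exI[of _ "\<lambda>_. b"] conjI allI impI ballI)
      fix x assume x: "x = a \<or> x \<in> adom A" "lev x \<le> 0"
      have "x = a"
      proof (cases "x = a")
        case False
        then obtain e where "e \<in> A" "x \<in> set (snd e)" using x(1) unfolding adom_iff2 by blast
        then show ?thesis using lev_zero[OF reach_fact] x(2) by blast
      qed
      then show "b \<in> arc_list A B (Suc r - lev x) x" using b lev_a by simp
    qed simp
  next
    case (Suc i)
    then obtain h where h: "\<And>x. x = a \<or> x \<in> adom A \<Longrightarrow> lev x \<le> i \<Longrightarrow> h x \<in> arc_list A B (Suc r - lev x) x"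
      "\<And>f. f \<in> A \<Longrightarrow> flev f < i \<Longrightarrow> (fst f, map h (snd f)) \<in> B" by auto
    have ir: "Suc r - i = Suc (r - i)" using Suc.prems by simp
    define ext where "ext f bs \<longleftrightarrow> (fst f, bs) \<in> B \<and> length bs = length (snd f) \<and>
       (\<forall>j<length (snd f). if lev (snd f ! j) = i then bs ! j = h (snd f ! j) else bs ! j \<in> arc_list A B (r - i) (snd f ! j))" for f bs
    have "\<forall>f. \<exists>bs. f \<in> A \<and> flev f = i \<longrightarrow> ext f bs"
    proof
      fix f
      show "\<exists>bs. f \<in> A \<and> flev f = i \<longrightarrow> ext f bs"
      proof (cases "f \<in> A \<and> flev f = i")
        case True
        then have fA: "f \<in> A" and fi: "flev f = i" by simp_all
        obtain p where p: "p < length (snd f)" "lev (snd f ! p) = i" using flev_ex[OF fA] fi by (metis in_set_conv_nth)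
        have "h (snd f ! p) \<in> arc_list A B (Suc (r - i)) (snd f ! p)"
          using h(1)[of "snd f ! p"] nth_adom[OF fA p(1)] p(2) ir by simp
        then obtain bs where bs: "(fst f, bs) \<in> B" "length bs = length (snd f)" "bs ! p = h (snd f ! p)"
          "\<And>j. j < length (snd f) \<Longrightarrow> j \<noteq> p \<Longrightarrow> bs ! j \<in> arc_list A B (r - i) (snd f ! j)"
          using fA p(1) unfolding arc_list.simps mem_Collect_eq by blast
        have "ext f bs" unfolding ext_def
        proof (intro conjI allI impI bs(1,2))
          fix j assume j: "j < length (snd f)"
          have "j = p" if "lev (snd f ! j) = i" using unique_centre[OF fA j p(1)] that p(2) fi by simp
          then show "if lev (snd f ! j) = i then bs ! j = h (snd f ! j) else bs ! j \<in> arc_list A B (r - i) (snd f ! j)"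
            using bs(3) bs(4)[OF j] p(2) by auto
        qed
        then show ?thesis by blast
      qed blast
    qed
    from choice[OF this] obtain bs where bs: "\<And>f. f \<in> A \<Longrightarrow> flev f = i \<Longrightarrow> ext f (bs f)" by blast
    define pos where "pos x fj \<longleftrightarrow> fst fj \<in> A \<and> flev (fst fj) = i \<and> snd fj < length (snd (fst fj)) \<and> snd (fst fj) ! snd fj = x" for x fj
    \<comment> \<open>A new element takes the value prescribed at its parent fact. The choice does
      not depend on \<open>SOME\<close>: the parent is unique, and the element has a single position
      in it.\<close>
    define h' where "h' x = (if lev x = Suc i then bs (fst (SOME fj. pos x fj)) ! snd (SOME fj. pos x fj) else h x)" for x
    have new: "h' (snd f ! j) = bs f ! j" if f: "f \<in> A" "flev f = i" and j: "j < length (snd f)" and l: "lev (snd f ! j) = Suc i" for f j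
    proof -
      have "pos (snd f ! j) (f, j)" using f j by (simp add: pos_def)
      then have s: "pos (snd f ! j) (SOME fj. pos (snd f ! j) fj)" by (rule someI)
      obtain f' j' where e: "(SOME fj. pos (snd f ! j) fj) = (f', j')" by (cases "SOME fj. pos (snd f ! j) fj")
      have "pos (snd f ! j) (f', j')" using s unfolding e .
      then have f': "f' \<in> A" "flev f' = i" "j' < length (snd f')" "snd f' ! j' = snd f ! j" unfolding pos_def by simp_all
      have "snd f ! j \<in> set (snd f')" using nth_mem[OF f'(3)] f'(4) by simp
      then have ff: "f = f'" using unique_parent[OF f(1) f'(1)] f(2) f'(2) nth_mem[OF j] l by simp
      then have "j = j'" using f'(3,4) j distinct_fact[OF f(1)] nth_eq_iff_index_eq[of "snd f" j j'] by simp
      then show ?thesis using l ff e by (simp add: h'_def)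
    qed
    show ?case
    proof (intro exI[of _ h'] conjI allI impI ballI)
      fix x assume x: "x = a \<or> x \<in> adom A" "lev x \<le> Suc i"
      show "h' x \<in> arc_list A B (Suc r - lev x) x"
      proof (cases "lev x = Suc i")
        case True
        then have "x \<in> adom A" using x(1) lev_a by auto
        then obtain f j where f: "f \<in> A" "flev f = i" "j < length (snd f)" "snd f ! j = x"
          using parent_ex[OF _ True] by blast
        have "bs f ! j \<in> arc_list A B (r - i) x" using bs[OF f(1,2)] f(3,4) True unfolding ext_def by auto
        then show ?thesis using new[OF f(1,2,3)] f(4) True by simp
      next
        case False
        then show ?thesis using h(1)[OF x(1)] x(2) by (simp add: h'_def)
      qed
    next
      fix f assume f: "f \<in> A" "flev f < Suc i"
      show "(fst f, map h' (snd f)) \<in> B"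
      proof (cases "flev f = i")
        case True
        have e: "ext f (bs f)" using bs[OF f(1) True] .
        have "map h' (snd f) = bs f"
        proof (rule nth_equalityI)
          show "length (map h' (snd f)) = length (bs f)" using e by (simp add: ext_def)
          fix j assume "j < length (map h' (snd f))"
          then have j: "j < length (snd f)" by simp
          have "i \<le> lev (snd f ! j)" "lev (snd f ! j) \<le> Suc i"
            using flev_le_lev[OF nth_mem[OF j]] lev_le_flev[OF f(1) nth_mem[OF j]] True by simp_all
          then consider "lev (snd f ! j) = i" | "lev (snd f ! j) = Suc i" by linarith
          then have "h' (snd f ! j) = bs f ! j"
          proof cases
            case 1
            then show ?thesis using e j by (simp add: ext_def h'_def)
          next
            case 2
            then show ?thesis using new[OF f(1) True j] by simp
          qed
          then show "map h' (snd f) ! j = bs f ! j" using j by simp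
        qed
        then show ?thesis using e by (simp add: ext_def)
      next
        case False
        then have fi: "flev f < i" using f(2) by simp
        have "h' x = h x" if "x \<in> set (snd f)" for x
          using lev_le_flev[OF f(1) that] fi by (simp add: h'_def)
        then have "map h' (snd f) = map h (snd f)" by simp
        then show ?thesis using h(2)[OF f(1) fi] by (simp only:)
      qed
    qed
  qed
  from this[of "Suc r"] obtain h where h: "\<And>f. f \<in> A \<Longrightarrow> flev f < Suc r \<Longrightarrow> (fst f, map h (snd f)) \<in> B"
    by blast
  have "hom h A B" unfolding hom_def
  proof (intro allI impI)
    fix R t assume "(R, t) \<in> A"
    then show "(R, map h t) \<in> B" using h[of "(R, t)"] flev_le[of "(R, t)"] by simp
  qed
  then show ?thesis unfolding hom_ex_iff by blast
qed

end

theorem fo_csp_finite_duality: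
  assumes sch: "schema sig ar" and B: "B \<in> insts sig ar" and fo: "fo_definable sig ar (CSP sig ar B)"
  obtains N where "\<And>A. A \<in> insts sig ar \<Longrightarrow> \<not> hom_ex A B \<Longrightarrow>
    \<exists>T\<in>insts sig ar. sparse N T \<and> card T \<le> N \<and> hom_ex T A \<and> \<not> hom_ex T B"
proof -
  obtain \<phi> where \<phi>: "fv \<phi> = {}" "CSP sig ar B = models sig ar \<phi>" using fo unfolding fo_definable_def by blast
  have \<phi>sat: "hom_ex D B \<longleftrightarrow> sat D (\<lambda>_. 0) \<phi>" if "D \<in> insts sig ar" for D
    using \<phi>(2) that unfolding CSP_def models_def by blast
  obtain m where m: "\<And>R. R \<in> sig \<Longrightarrow> ar R \<le> m" using arity_bound[OF sch] by blast
  define r where "r = (2::nat) ^ qr \<phi>"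
  \<comment> \<open>The first summands give the girth required by \<open>layered\<close>, the last
    one the size of the witness.\<close>
  define N where "N = 2 * r + 2 + witness_bound (card (adom B)) m (Suc r)"
  show thesis
  proof (rule that)
    fix A assume A: "A \<in> insts sig ar" "\<not> hom_ex A B"
    have finB: "finite G" if "G \<in> {B}" for G using that inst_finite[OF B] by simp
    obtain A0 where A0: "A0 \<in> insts sig ar" "sparse N A0" "hom_ex A0 A" "\<And>G. G \<in> {B} \<Longrightarrow> hom_ex A0 G \<Longrightarrow> hom_ex A G"
      using sparse_incomparability[OF A(1) finite.insertI[OF finite.emptyI] finB] by blast
    have A0B: "\<not> hom_ex A0 B" using A0(4)[OF singletonI] A(2) by blast
    define P where "P = {S \<in> Pow A0. \<not> hom_ex S B}"
    have "finite P" using inst_finite[OF A0(1)] by (simp add: P_def)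
    moreover have "P \<noteq> {}" using A0B unfolding P_def by blast
    \<comment> \<open>Minimality is imposed after sparsity: sub-instances of a sparse instance are
      sparse, whereas a sparse cover of a minimal obstruction need not be minimal.\<close>
    ultimately obtain A1 where A1P: "A1 \<in> P" "\<forall>S\<in>P. S \<subseteq> A1 \<longrightarrow> A1 = S" using finite_has_minimal[of P] by blast
    have A1: "A1 \<subseteq> A0" "\<not> hom_ex A1 B" using A1P(1) by (simp_all add: P_def)
    have A1min: "hom_ex S B" if S: "S \<subseteq> A1" "S \<noteq> A1" for S
    proof (rule ccontr)
      assume "\<not> hom_ex S B"
      moreover have "S \<subseteq> A0" using S(1) A1(1) by (rule order_trans)
      ultimately have "S \<in> P" by (simp add: P_def)
      then have "A1 = S" using A1P(2) S(1) by blast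
      then show False using S(2) by blast
    qed
    have A1i: "A1 \<in> insts sig ar" using A1(1) A0(1) by (rule inst_subset)
    have sp: "sparse N A1" using sparse_subset[OF A0(2) A1(1)] by simp
    have crit: "hom_ex (A1 - {f}) B" if "f \<in> A1" for f using that by (intro A1min) auto
    obtain x where x0: "x \<in> adom A1" "\<And>f. f \<in> A1 \<Longrightarrow> \<exists>y\<in>set (snd f). near A1 (2 ^ qr \<phi>) x y"
      by (rule critical_obstruction_radius[OF sch A1i \<phi>(1) \<phi>sat A1(2) crit]) blast+
    note x = x0[folded r_def]
    have lay: "layered A1 x r N"
    proof
      show "snd f \<noteq> []" if "f \<in> A1" for f using inst_nonempty[OF sch A1i that] .
      show "sparse N A1" by (rule sp)
      show "2 * r + 2 \<le> N" by (simp add: N_def)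
      show "\<exists>y\<in>set (snd f). reach A1 x r y" if "f \<in> A1" for f using x(2)[OF that] near_reach by blast
    qed
    have empty: "b \<notin> arc_list A1 B (Suc r) x" for b using layered.hom_from_lists[OF lay] A1(2) by blast
    have len: "length (snd f) \<le> m" if "f \<in> A1" for f
      using inst_fact[OF A1i, of "fst f" "snd f"] m[of "fst f"] that by simp
    obtain T where T: "T \<subseteq> A1" "card T \<le> witness_bound (card (adom B)) m (Suc r)"
      "\<And>h. hom h T B \<Longrightarrow> h x \<in> arc_list A1 B (Suc r) x"
      using arc_list_witness[OF inst_finite[OF B] len x(1), of "Suc r"] by blast
    show "\<exists>T\<in>insts sig ar. sparse N T \<and> card T \<le> N \<and> hom_ex T A \<and> \<not> hom_ex T B"
    proof (intro bexI[of _ T] conjI)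
      show "T \<in> insts sig ar" using T(1) A1i by (rule inst_subset)
      show "sparse N T" using sparse_subset[OF sp T(1)] by simp
      show "card T \<le> N" using T(2) by (simp add: N_def)
      have "T \<subseteq> A0" using T(1) A1(1) by blast
      then show "hom_ex T A" using hom_ex_trans[OF hom_ex_subset A0(3)] by blast
      show "\<not> hom_ex T B" using T(3) empty unfolding hom_ex_iff by blast
    qed
  qed
qed

text \<open>Every obstruction contains the image of a small acyclic obstruction, and the profile
  records which of these map to a given instance.\<close>

lemma fo_csp_class_in_berge_comb:
  assumes sch: "schema sig ar" and X: "X \<in> fo_csp_classes sig ar"
  shows "X \<in> bool_comb (insts sig ar) (berge_cq_classes sig ar)"
proof -
  obtain B where B: "X = CSP sig ar B" "B \<in> insts sig ar" "fo_definable sig ar (CSP sig ar B)"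
    using X unfolding fo_csp_classes_def by blast
  obtain N where N: "\<And>A. A \<in> insts sig ar \<Longrightarrow> \<not> hom_ex A B \<Longrightarrow>
    \<exists>T\<in>insts sig ar. sparse N T \<and> card T \<le> N \<and> hom_ex T A \<and> \<not> hom_ex T B"
    using fo_csp_finite_duality[OF sch B(2,3)] by blast
  have imp: "hom_ex D' B" if D: "D' \<in> insts sig ar" "same_profile N sig ar D D'" "hom_ex D B" for D D'
  proof (rule ccontr)
    assume "\<not> hom_ex D' B"
    then obtain T where T: "T \<in> insts sig ar" "sparse N T" "card T \<le> N" "hom_ex T D'" "\<not> hom_ex T B"
      using N[OF D(1)] by blast
    then have "hom_ex T D" using D(2) unfolding same_profile_def by blast
    then show False using hom_ex_trans[OF _ D(3)] T(5) by blast
  qed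
  show ?thesis
  proof (rule profile_determined_in_berge_comb[OF sch])
    show "X \<subseteq> insts sig ar" unfolding B(1) CSP_def by blast
    fix D D' assume D: "D \<in> insts sig ar" "D' \<in> insts sig ar" "same_profile N sig ar D D'"
    show "D \<in> X \<longleftrightarrow> D' \<in> X"
      using imp[OF D(2,3)] imp[OF D(1) same_profile_sym[OF D(3)]] D(1,2) unfolding B(1) CSP_def by blast
  qed
qed

theorem mainTheorem16:
  fixes sig :: "'r set" and ar :: "'r \<Rightarrow> nat" and C :: "'r inst set"
  assumes "schema sig ar"
    and "is_class sig ar C"
  shows "((left_qa KB sig ar C \<and> right_qa KB sig ar C) \<longleftrightarrow>
            (left_qa KN sig ar C \<and> right_qa KB sig ar C))
       \<and> ((left_qa KN sig ar C \<and> right_qa KB sig ar C) \<longleftrightarrow>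
            C \<in> bool_comb (insts sig ar) (berge_cq_classes sig ar))
       \<and> (C \<in> bool_comb (insts sig ar) (berge_cq_classes sig ar) \<longleftrightarrow>
            C \<in> bool_comb (insts sig ar) (fo_csp_classes sig ar))"
proof -
  have 23: "C \<in> bool_comb (insts sig ar) (berge_cq_classes sig ar)"
    if L: "left_qa KN sig ar C" and R: "right_qa KB sig ar C"
  proof -
    obtain N where "\<And>D D'. D \<in> insts sig ar \<Longrightarrow> D' \<in> insts sig ar \<Longrightarrow> same_profile N sig ar D D' \<Longrightarrow> D \<in> C \<longleftrightarrow> D' \<in> C"
      using left_KN_right_KB_profile[OF assms(1) L R] by blast
    moreover have "C \<subseteq> insts sig ar" using assms(2) unfolding is_class_def by blast
    ultimately show ?thesis using profile_determined_in_berge_comb[OF assms(1)] by blast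
  qed
  have 34: "C \<in> bool_comb (insts sig ar) (fo_csp_classes sig ar)"
    if "C \<in> bool_comb (insts sig ar) (berge_cq_classes sig ar)"
    by (rule bool_comb_trans[OF that berge_class_in_fo_csp_comb[OF assms(1)]])
  have 43: "C \<in> bool_comb (insts sig ar) (berge_cq_classes sig ar)"
    if "C \<in> bool_comb (insts sig ar) (fo_csp_classes sig ar)"
    by (rule bool_comb_trans[OF that fo_csp_class_in_berge_comb[OF assms(1)]])
  \<comment> \<open>The left algorithm asks the acyclic queries themselves, while the right one maps
    into the duals; so the step from (3) to (1) passes through (4).\<close>
  have 31: "left_qa KB sig ar C \<and> right_qa KB sig ar C"
    if "C \<in> bool_comb (insts sig ar) (berge_cq_classes sig ar)"
    using berge_comb_left_qa[OF that] fo_csp_comb_right_qa[OF 34[OF that]] by blast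
  have 12: "left_qa KN sig ar C" if "left_qa KB sig ar C" using that by (rule left_qa_KB_imp_KN)
  show ?thesis using 12 23 31 34 43 by blast
qed

end
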